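(* Let $\mathcal{G}\rightrightarrows M$ be a Lie groupoid with Lie algebroid $A$. Consider the $2$-vector space $T^{1,1}_{\mathrm{aff}}(\mathcal{G})\rightrightarrows T^{1,1}_{\mathrm{mult}}(\mathcal{G})$ of affine and multiplicative $(1,1)$-tensors on $\mathcal{G}$, with source $s(N)=N_r:=N-\overrightarrow{n}$, target $t(N)=N_l:=N-\overleftarrow{n}$, where $n=\mathrm{pr}_{T^*M\otimes A}N|_M$, and multiplication $N_1*N_2=N_1+\overleftarrow{n_2}$ (with $n_2=\mathrm{pr}_{T^*M\otimes A}N_2|_M$) whenever $(N_1)_r=(N_2)_l$. Then this category is a strict monoidal category, with product the composition $N\circ N'$ of affine $(1,1)$-tensors (as bundle endomorphisms of $T\mathcal{G}$) and unit object the identity $I:T\mathcal{G}\to T\mathcal{G}$.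
   Context: A strict monoidal category $(\mathcal{C},\circ,e)$ is a category $\mathcal{C}$ with a bifunctor $\circ:\mathcal{C}\times\mathcal{C}\to\mathcal{C}$ that is strictly associative (on objects and arrows) and an object $e$ that is a strict two-sided unit for $\circ$. A $2$-vector space is a category whose objects and arrows form vector spaces and whose structure maps are all linear; here identities are given by the inclusion of multiplicative into affine $(1,1)$-tensors. Conventions: $\mathcal{G}\rightrightarrows M$ has source $s$ and target $t$; $gh$ is defined iff $s(g)=t(h)$; $M\subset\mathcal{G}$ via units. $A=\ker(ds)|_M$, $T\mathcal{G}|_M=TM\oplus A$. For $u\in\Gamma(A)$, $\overrightarrow{u}(g)=dR_g(u_{t(g)})$, $\overleftarrow{u}(g)=-dL_g(d\,\mathrm{inv}(u_{s(g)}))$. The tangent groupoid $T\mathcal{G}\rightrightarrows TM$ has as structure maps the differentials of those of $\mathcal{G}$. The cotangent groupoid $T^*\mathcal{G}\rightrightarrows A^*$ has source and target of $\xi\in T_g^*\mathcal{G}$ given by $\langle s(\xi),u\rangle=\langle\xi,\overleftarrow{u}\rangle$ for $u\in A_{s(g)}$ and $\langle t(\xi),v\rangle=\langle\xi,\overrightarrow{v}\rangle$ for $v\in A_{t(g)}$, and product $(\xi\cdot\eta)(X\cdot Y)=\xi(X)+\eta(Y)$. A $(1,1)$-tensor $N\in\Gamma(T\mathcal{G}\otimes T^*\mathcal{G})$ is identified with a bundle map $N:T\mathcal{G}\to T\mathcal{G}$ and with the function $(X,\xi)\mapsto N(X,\xi)=\langle\xi,N(X)\rangle$ on the groupoid $T\mathcal{G}\oplus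 T^*\mathcal{G}\rightrightarrows TM\oplus A^*$. With $n=\mathrm{pr}_{T^*M\otimes A}N|_M$ (the component $TM\to A$ of $N|_M$), $N$ is affine if $N(X\cdot Y,\xi\cdot\eta)=N(X,\xi)+N(Y,\eta)-n(s(X),s(\xi))$ for all composable $(X,Y)$ in $T\mathcal{G}$ and $(\xi,\eta)$ in $T^*\mathcal{G}$ over the same composable pair $(g,h)$; $N$ is multiplicative if moreover $n=0$ (equivalently, $N:T\mathcal{G}\to T\mathcal{G}$ is a Lie groupoid morphism). For $n\in\Gamma(T^*M\otimes A)$, regarded as a map $TM\to A$, the $(1,1)$-tensors $\overrightarrow{n},\overleftarrow{n}$ on $\mathcal{G}$ are $\overrightarrow{n}(X)=\overrightarrow{n(tX)}$ and $\overleftarrow{n}(X)=\overleftarrow{n(sX)}$, evaluated at $g$ for $X\in T_g\mathcal{G}$. *)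

theory Defs
  imports "HOL-Analysis.Analysis" "HOL-Library.Function_Algebras"
begin

section \<open>Vector space structures on function types and on the one-point type\<close>

instantiation "fun" :: (type, real_vector) real_vector
begin

definition scaleR_fun :: "real \<Rightarrow> ('a \<Rightarrow> 'b) \<Rightarrow> 'a \<Rightarrow> 'b"
  where "scaleR_fun r f = (\<lambda>x. r *\<^sub>R f x)"

instance
  by standard (auto simp: scaleR_fun_def fun_eq_iff scaleR_add_right scaleR_add_left)

end

text \<open>
  Manifolds below are modelled on finite-dimensional normed spaces rather than on types of class
  \<^class>\<open>euclidean_space\<close>, because the latter have positive dimension. The following instance
  provides the model space of a zero-dimensional manifold (for example the base of a Lie group).
\<close>

instantiation unit :: real_normed_vector
begin

definition plus_unit :: "unit \<Rightarrow> unit \<Rightarrow> unit" where "plus_unit _ _ = ()"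
definition minus_unit :: "unit \<Rightarrow> unit \<Rightarrow> unit" where "minus_unit _ _ = ()"
definition uminus_unit :: "unit \<Rightarrow> unit" where "uminus_unit _ = ()"
definition zero_unit :: unit where "zero_unit = ()"
definition scaleR_unit :: "real \<Rightarrow> unit \<Rightarrow> unit" where "scaleR_unit _ _ = ()"
definition norm_unit :: "unit \<Rightarrow> real" where "norm_unit _ = 0"
definition sgn_unit :: "unit \<Rightarrow> unit" where "sgn_unit _ = ()"
definition dist_unit :: "unit \<Rightarrow> unit \<Rightarrow> real" where "dist_unit _ _ = 0"
definition uniformity_unit :: "(unit \<times> unit) filter"
  where "uniformity_unit = (INF e\<in>{0<..}. principal {(x, y). dist x y < e})"
definition open_unit :: "unit set \<Rightarrow> bool"
  where "open_unit U = (\<forall>x\<in>U. \<forall>\<^sub>F (x', y) in uniformity. x' = x \<longrightarrow> y \<in> U)"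

instance
  by standard (auto simp: norm_unit_def dist_unit_def uniformity_unit_def open_unit_def)

end

definition finite_dimensional :: "'e::real_vector itself \<Rightarrow> bool"
  where "finite_dimensional _ \<longleftrightarrow> (\<exists>B::'e set. finite B \<and> span B = UNIV)"


section \<open>Smooth manifolds\<close>

text \<open>
  C^k maps on an open set: all iterated directional derivatives up to order \<open>k\<close> exist (as Frechet
  differentiable functions below order \<open>k\<close>) and are continuous.
\<close>

primrec Ck_on :: "nat \<Rightarrow> 'a::real_normed_vector set \<Rightarrow> ('a \<Rightarrow> 'b::real_normed_vector) \<Rightarrow> bool" where
  "Ck_on 0 S f \<longleftrightarrow> continuous_on S f"
| "Ck_on (Suc k) S f \<longleftrightarrow> (\<forall>x\<in>S. f differentiable (at x)) \<and>
     (\<forall>v. Ck_on k S (\<lambda>x. frechet_derivative f (at x) v))"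

definition smooth_on :: "'a::real_normed_vector set \<Rightarrow> ('a \<Rightarrow> 'b::real_normed_vector) \<Rightarrow> bool"
  where "smooth_on S f \<longleftrightarrow> (\<forall>k. Ck_on k S f)"

type_synonym ('a, 'e) chart = "'a set \<times> ('a \<Rightarrow> 'e)"

text \<open>
  Besides the topology and the atlas, a manifold carries a choice, for every point \<open>p\<close>, of a chart
  around \<open>p\<close>. The tangent space at \<open>p\<close> is the model space \<open>'e\<close>: a vector \<open>v\<close> stands for
  the tangent vector at \<open>p\<close> whose coordinates in \<open>chart_at p\<close> are \<open>v\<close>. Nothing is assumed about how
  \<open>chart_at p\<close> depends on \<open>p\<close>.
\<close>

record ('a, 'e) manifold =
  mtop :: "'a topology"
  atlas :: "('a, 'e) chart set"
  chart_at :: "'a \<Rightarrow> ('a, 'e) chart"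

abbreviation points :: "('a, 'e) manifold \<Rightarrow> 'a set"
  where "points M \<equiv> topspace (mtop M)"

abbreviation chart_inv :: "('a, 'e) chart \<Rightarrow> 'e \<Rightarrow> 'a"
  where "chart_inv c \<equiv> inv_into (fst c) (snd c)"

text \<open>A smooth structure: no separation or countability axioms are required.\<close>

definition smooth_structure :: "('a, 'e::real_normed_vector) manifold \<Rightarrow> bool" where
  "smooth_structure M \<longleftrightarrow>
     finite_dimensional TYPE('e) \<and>
     (\<forall>(U, \<phi>)\<in>atlas M. openin (mtop M) U \<and> open (\<phi> ` U) \<and>
        homeomorphic_map (subtopology (mtop M) U) (top_of_set (\<phi> ` U)) \<phi>) \<and>
     (\<forall>c\<in>atlas M. \<forall>c'\<in>atlas M.
        smooth_on (snd c ` (fst c \<inter> fst c')) (snd c' \<circ> chart_inv c)) \<and>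
     (\<forall>p\<in>points M. chart_at M p \<in> atlas M \<and> p \<in> fst (chart_at M p))"

definition smooth_manifold :: "('a, 'e::real_normed_vector) manifold \<Rightarrow> bool" where
  "smooth_manifold M \<longleftrightarrow>
     smooth_structure M \<and> Hausdorff_space (mtop M) \<and> second_countable (mtop M)"

definition prod_chart :: "('a, 'e) chart \<Rightarrow> ('b, 'f) chart \<Rightarrow> ('a \<times> 'b, 'e \<times> 'f) chart"
  where "prod_chart c d = (fst c \<times> fst d, map_prod (snd c) (snd d))"

definition prod_manifold ::
  "('a, 'e) manifold \<Rightarrow> ('b, 'f) manifold \<Rightarrow> ('a \<times> 'b, 'e \<times> 'f) manifold" where
  "prod_manifold M N =
     \<lparr>mtop = prod_topology (mtop M) (mtop N),
      atlas = {prod_chart c d | c d. c \<in> atlas M \<and> d \<in> atlas N},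
      chart_at = (\<lambda>(p, q). prod_chart (chart_at M p) (chart_at N q))\<rparr>"

text \<open>The expression of \<open>f\<close> in the distinguished charts around \<open>p\<close> and \<open>f p\<close>.\<close>

definition local_rep ::
  "('a, 'e) manifold \<Rightarrow> ('b, 'f) manifold \<Rightarrow> ('a \<Rightarrow> 'b) \<Rightarrow> 'a \<Rightarrow> 'e \<Rightarrow> 'f" where
  "local_rep M N f p = snd (chart_at N (f p)) \<circ> f \<circ> chart_inv (chart_at M p)"

text \<open>
  A map defined on a subset \<open>S\<close> of \<open>M\<close> is smooth if, around every point of \<open>S\<close>, it is the
  restriction of a smooth map defined on an open set. If \<open>S\<close> is an embedded submanifold this is the
  usual notion of a smooth map on \<open>S\<close>.
\<close>

definition smooth_map ::
  "('a, 'e::real_normed_vector) manifold \<Rightarrow> 'a set \<Rightarrow> ('b, 'f::real_normed_vector) manifold \<Rightarrow>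
     ('a \<Rightarrow> 'b) \<Rightarrow> bool" where
  "smooth_map M S N f \<longleftrightarrow>
     S \<subseteq> points M \<and> f ` S \<subseteq> points N \<and>
     (\<forall>p\<in>S. \<exists>O' F. open O' \<and> snd (chart_at M p) p \<in> O' \<and> smooth_on O' F \<and>
        (\<forall>q\<in>S \<inter> fst (chart_at M p). snd (chart_at M p) q \<in> O' \<longrightarrow>
           f q \<in> fst (chart_at N (f p)) \<and>
           F (snd (chart_at M p) q) = snd (chart_at N (f p)) (f q)))"

text \<open>
  The differential at \<open>p\<close> of a map defined on \<open>S\<close>. For an embedded submanifold \<open>S\<close> it is the usual
  differential on vectors tangent to \<open>S\<close>; it is only used on such vectors. (The derivative within
  \<open>S\<close> is the derivative at \<open>p\<close> of an arbitrary extension, so its values on other vectors depend on a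
  choice.)
\<close>

definition differential ::
  "('a, 'e::real_normed_vector) manifold \<Rightarrow> 'a set \<Rightarrow> ('b, 'f::real_normed_vector) manifold \<Rightarrow>
     ('a \<Rightarrow> 'b) \<Rightarrow> 'a \<Rightarrow> 'e \<Rightarrow> 'f" where
  "differential M S N f p =
     frechet_derivative (local_rep M N f p)
       (at (snd (chart_at M p) p) within snd (chart_at M p) ` (S \<inter> fst (chart_at M p)))"


section \<open>Lie groupoids\<close>

record ('g, 'm, 'e, 'f) lie_groupoid_data =
  arrows :: "('g, 'e) manifold"
  objects :: "('m, 'f) manifold"
  src :: "'g \<Rightarrow> 'm"
  tgt :: "'g \<Rightarrow> 'm"
  mul :: "'g \<Rightarrow> 'g \<Rightarrow> 'g"
  gunit :: "'m \<Rightarrow> 'g"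
  ginv :: "'g \<Rightarrow> 'g"

abbreviation Arr :: "('g, 'm, 'e, 'f) lie_groupoid_data \<Rightarrow> 'g set"
  where "Arr G \<equiv> points (arrows G)"

abbreviation Obj :: "('g, 'm, 'e, 'f) lie_groupoid_data \<Rightarrow> 'm set"
  where "Obj G \<equiv> points (objects G)"

definition composable :: "('g, 'm, 'e, 'f) lie_groupoid_data \<Rightarrow> ('g \<times> 'g) set"
  where "composable G = {(g, h). g \<in> Arr G \<and> h \<in> Arr G \<and> src G g = tgt G h}"

definition groupoid :: "('g, 'm, 'e, 'f) lie_groupoid_data \<Rightarrow> bool" where
  "groupoid G \<longleftrightarrow>
     (\<forall>g\<in>Arr G. src G g \<in> Obj G \<and> tgt G g \<in> Obj G \<and> ginv G g \<in> Arr G) \<and>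
     (\<forall>x\<in>Obj G. gunit G x \<in> Arr G \<and> src G (gunit G x) = x \<and> tgt G (gunit G x) = x) \<and>
     (\<forall>(g, h)\<in>composable G. mul G g h \<in> Arr G \<and>
        src G (mul G g h) = src G h \<and> tgt G (mul G g h) = tgt G g) \<and>
     (\<forall>g h k. (g, h) \<in> composable G \<and> (h, k) \<in> composable G \<longrightarrow>
        mul G (mul G g h) k = mul G g (mul G h k)) \<and>
     (\<forall>g\<in>Arr G. mul G (gunit G (tgt G g)) g = g \<and> mul G g (gunit G (src G g)) = g) \<and>
     (\<forall>g\<in>Arr G. src G (ginv G g) = tgt G g \<and> tgt G (ginv G g) = src G g \<and>
        mul G g (ginv G g) = gunit G (tgt G g) \<and> mul G (ginv G g) g = gunit G (src G g))"

definition dsrc :: "('g, 'm, 'e::real_normed_vector, 'f::real_normed_vector) lie_groupoid_data \<Rightarrow>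
    'g \<Rightarrow> 'e \<Rightarrow> 'f"
  where "dsrc G g = differential (arrows G) (Arr G) (objects G) (src G) g"

definition dtgt :: "('g, 'm, 'e::real_normed_vector, 'f::real_normed_vector) lie_groupoid_data \<Rightarrow>
    'g \<Rightarrow> 'e \<Rightarrow> 'f"
  where "dtgt G g = differential (arrows G) (Arr G) (objects G) (tgt G) g"

definition dunit :: "('g, 'm, 'e::real_normed_vector, 'f::real_normed_vector) lie_groupoid_data \<Rightarrow>
    'm \<Rightarrow> 'f \<Rightarrow> 'e"
  where "dunit G x = differential (objects G) (Obj G) (arrows G) (gunit G) x"

definition dinv :: "('g, 'm, 'e::real_normed_vector, 'f::real_normed_vector) lie_groupoid_data \<Rightarrow>
    'g \<Rightarrow> 'e \<Rightarrow> 'e"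
  where "dinv G g = differential (arrows G) (Arr G) (arrows G) (ginv G) g"

text \<open>
  The base is a (Hausdorff, second countable) manifold. As is customary for Lie groupoids, the space
  of arrows is not required to be Hausdorff or second countable. Source and target are submersions,
  so the composable pairs form an embedded submanifold of \<open>G \<times> G\<close>.
\<close>

definition lie_groupoid ::
  "('g, 'm, 'e::real_normed_vector, 'f::real_normed_vector) lie_groupoid_data \<Rightarrow> bool" where
  "lie_groupoid G \<longleftrightarrow>
     groupoid G \<and>
     smooth_structure (arrows G) \<and> smooth_manifold (objects G) \<and>
     smooth_map (arrows G) (Arr G) (objects G) (src G) \<and>
     smooth_map (arrows G) (Arr G) (objects G) (tgt G) \<and>
     (\<forall>g\<in>Arr G. surj (dsrc G g) \<and> surj (dtgt G g)) \<and>
     smooth_map (objects G) (Obj G) (arrows G) (gunit G) \<and>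
     smooth_map (arrows G) (Arr G) (arrows G) (ginv G) \<and>
     smooth_map (prod_manifold (arrows G) (arrows G)) (composable G) (arrows G)
       (\<lambda>(g, h). mul G g h)"

text \<open>The fibre at \<open>x\<close> of the Lie algebroid \<open>A = ker ds|M\<close>, a subspace of the tangent space at the
  unit of \<open>x\<close>.\<close>

definition alg_fibre ::
  "('g, 'm, 'e::real_normed_vector, 'f::real_normed_vector) lie_groupoid_data \<Rightarrow> 'm \<Rightarrow> 'e set"
  where "alg_fibre G x = {u. dsrc G (gunit G x) u = 0}"

text \<open>The values at \<open>g\<close> of the right and left translates of \<open>u \<in> A\<close> at \<open>tgt g\<close> and at \<open>src g\<close>.
  Right (left) translation by \<open>g\<close> is a map on a source (target) fibre.\<close>

definition right_transl ::
  "('g, 'm, 'e::real_normed_vector, 'f::real_normed_vector) lie_groupoid_data \<Rightarrow> 'g \<Rightarrow> 'e \<Rightarrow> 'e" where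
  "right_transl G g u =
     differential (arrows G) {k \<in> Arr G. src G k = tgt G g} (arrows G) (\<lambda>k. mul G k g)
       (gunit G (tgt G g)) u"

definition left_transl ::
  "('g, 'm, 'e::real_normed_vector, 'f::real_normed_vector) lie_groupoid_data \<Rightarrow> 'g \<Rightarrow> 'e \<Rightarrow> 'e" where
  "left_transl G g u =
     - differential (arrows G) {k \<in> Arr G. tgt G k = src G g} (arrows G) (\<lambda>k. mul G g k)
         (gunit G (src G g)) (dinv G (gunit G (src G g)) u)"

subsection \<open>Tangent and cotangent groupoids\<close>

definition tangent_mul ::
  "('g, 'm, 'e::real_normed_vector, 'f::real_normed_vector) lie_groupoid_data \<Rightarrow>
     'g \<Rightarrow> 'g \<Rightarrow> 'e \<Rightarrow> 'e \<Rightarrow> 'e" where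
  "tangent_mul G g h X Y =
     differential (prod_manifold (arrows G) (arrows G)) (composable G) (arrows G)
       (\<lambda>(g, h). mul G g h) (g, h) (X, Y)"

text \<open>Covectors at \<open>g\<close> are linear functionals on the tangent space at \<open>g\<close>; elements of the dual
  of \<open>A\<close> are functions restricted to a fibre of \<open>A\<close>.\<close>

definition cotangent_src ::
  "('g, 'm, 'e::real_normed_vector, 'f::real_normed_vector) lie_groupoid_data \<Rightarrow>
     'g \<Rightarrow> ('e \<Rightarrow> real) \<Rightarrow> ('e \<Rightarrow> real)"
  where "cotangent_src G g \<xi> = (\<lambda>u\<in>alg_fibre G (src G g). \<xi> (left_transl G g u))"

definition cotangent_tgt ::
  "('g, 'm, 'e::real_normed_vector, 'f::real_normed_vector) lie_groupoid_data \<Rightarrow>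
     'g \<Rightarrow> ('e \<Rightarrow> real) \<Rightarrow> ('e \<Rightarrow> real)"
  where "cotangent_tgt G g \<xi> = (\<lambda>v\<in>alg_fibre G (tgt G g). \<xi> (right_transl G g v))"

definition cotangent_mul ::
  "('g, 'm, 'e::real_normed_vector, 'f::real_normed_vector) lie_groupoid_data \<Rightarrow>
     'g \<Rightarrow> 'g \<Rightarrow> ('e \<Rightarrow> real) \<Rightarrow> ('e \<Rightarrow> real) \<Rightarrow> ('e \<Rightarrow> real)" where
  "cotangent_mul G g h \<xi> \<eta> =
     (THE \<zeta>. linear \<zeta> \<and>
        (\<forall>X Y. dsrc G g X = dtgt G h Y \<longrightarrow> \<zeta> (tangent_mul G g h X Y) = \<xi> X + \<eta> Y))"


section \<open>Affine and multiplicative (1,1)-tensors\<close>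

text \<open>
  Smoothness of a field of endomorphisms of the tangent spaces: in every chart \<open>c\<close> its matrix is
  smooth. Passing from the distinguished chart at \<open>p\<close> (in which tangent vectors at \<open>p\<close> are
  written) to the chart \<open>c\<close> and back is done by the derivatives of the coordinate changes.
\<close>

definition to_chart ::
  "('a, 'e::real_normed_vector) manifold \<Rightarrow> ('a, 'e) chart \<Rightarrow> 'a \<Rightarrow> 'e \<Rightarrow> 'e" where
  "to_chart M c p =
     frechet_derivative (snd c \<circ> chart_inv (chart_at M p)) (at (snd (chart_at M p) p))"

definition from_chart ::
  "('a, 'e::real_normed_vector) manifold \<Rightarrow> ('a, 'e) chart \<Rightarrow> 'a \<Rightarrow> 'e \<Rightarrow> 'e" where
  "from_chart M c p =
     frechet_derivative (snd (chart_at M p) \<circ> chart_inv c) (at (snd c p))"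

definition smooth_endo_field ::
  "('a, 'e::real_normed_vector) manifold \<Rightarrow> ('a \<Rightarrow> 'e \<Rightarrow> 'e) \<Rightarrow> bool" where
  "smooth_endo_field M N \<longleftrightarrow>
     (\<forall>c\<in>atlas M. \<forall>v. smooth_on (snd c ` fst c)
        (\<lambda>y. let p = chart_inv c y in to_chart M c p (N p (from_chart M c p v))))"

text \<open>Tensors are normalised to be zero at the elements of the type \<open>'a\<close> that are not points of \<open>M\<close>,
  so that equality of tensors is equality of functions.\<close>

definition tensors11 :: "('a, 'e::real_normed_vector) manifold \<Rightarrow> ('a \<Rightarrow> 'e \<Rightarrow> 'e) set" where
  "tensors11 M = {N. (\<forall>p\<in>points M. linear (N p)) \<and> (\<forall>p. p \<notin> points M \<longrightarrow> N p = 0) \<and>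
     smooth_endo_field M N}"

definition tensor_id :: "('a, 'e::real_normed_vector) manifold \<Rightarrow> 'a \<Rightarrow> 'e \<Rightarrow> 'e"
  where "tensor_id M p = (if p \<in> points M then id else 0)"

definition tensor_comp :: "('a \<Rightarrow> 'e \<Rightarrow> 'e) \<Rightarrow> ('a \<Rightarrow> 'e \<Rightarrow> 'e) \<Rightarrow> 'a \<Rightarrow> 'e \<Rightarrow> 'e"
  where "tensor_comp N N' p = N p \<circ> N' p"

text \<open>The component \<open>TM \<rightarrow> A\<close> of \<open>N\<close> at the units, for the splitting of the tangent space at the unit
  of \<open>x\<close> into the image of \<open>dunit\<close> and \<open>A\<close>; the projection onto \<open>A\<close> is \<open>Z \<mapsto> Z - dunit (dsrc Z)\<close>.\<close>

definition core_part ::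
  "('g, 'm, 'e::real_normed_vector, 'f::real_normed_vector) lie_groupoid_data \<Rightarrow>
     ('g \<Rightarrow> 'e \<Rightarrow> 'e) \<Rightarrow> 'm \<Rightarrow> 'f \<Rightarrow> 'e" where
  "core_part G N x v =
     (let Z = N (gunit G x) (dunit G x v) in Z - dunit G x (dsrc G (gunit G x) Z))"

definition right_tensor ::
  "('g, 'm, 'e::real_normed_vector, 'f::real_normed_vector) lie_groupoid_data \<Rightarrow>
     ('m \<Rightarrow> 'f \<Rightarrow> 'e) \<Rightarrow> 'g \<Rightarrow> 'e \<Rightarrow> 'e" where
  "right_tensor G n g =
     (if g \<in> Arr G then (\<lambda>X. right_transl G g (n (tgt G g) (dtgt G g X))) else 0)"

definition left_tensor ::
  "('g, 'm, 'e::real_normed_vector, 'f::real_normed_vector) lie_groupoid_data \<Rightarrow>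
     ('m \<Rightarrow> 'f \<Rightarrow> 'e) \<Rightarrow> 'g \<Rightarrow> 'e \<Rightarrow> 'e" where
  "left_tensor G n g =
     (if g \<in> Arr G then (\<lambda>X. left_transl G g (n (src G g) (dsrc G g X))) else 0)"

definition affine_tensors ::
  "('g, 'm, 'e::real_normed_vector, 'f::real_normed_vector) lie_groupoid_data \<Rightarrow>
     ('g \<Rightarrow> 'e \<Rightarrow> 'e) set" where
  "affine_tensors G = {N \<in> tensors11 (arrows G).
     \<forall>(g, h)\<in>composable G. \<forall>X Y \<xi> \<eta>.
       dsrc G g X = dtgt G h Y \<and> linear \<xi> \<and> linear \<eta> \<and> cotangent_src G g \<xi> = cotangent_tgt G h \<eta> \<longrightarrow>
       cotangent_mul G g h \<xi> \<eta> (N (mul G g h) (tangent_mul G g h X Y)) =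
         \<xi> (N g X) + \<eta> (N h Y) - cotangent_src G g \<xi> (core_part G N (src G g) (dsrc G g X))}"

definition mult_tensors ::
  "('g, 'm, 'e::real_normed_vector, 'f::real_normed_vector) lie_groupoid_data \<Rightarrow>
     ('g \<Rightarrow> 'e \<Rightarrow> 'e) set" where
  "mult_tensors G = {N \<in> affine_tensors G. \<forall>x\<in>Obj G. \<forall>v. core_part G N x v = 0}"

definition source_tensor ::
  "('g, 'm, 'e::real_normed_vector, 'f::real_normed_vector) lie_groupoid_data \<Rightarrow>
     ('g \<Rightarrow> 'e \<Rightarrow> 'e) \<Rightarrow> 'g \<Rightarrow> 'e \<Rightarrow> 'e"
  where "source_tensor G N = N - right_tensor G (core_part G N)"

definition target_tensor ::
  "('g, 'm, 'e::real_normed_vector, 'f::real_normed_vector) lie_groupoid_data \<Rightarrow>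
     ('g \<Rightarrow> 'e \<Rightarrow> 'e) \<Rightarrow> 'g \<Rightarrow> 'e \<Rightarrow> 'e"
  where "target_tensor G N = N - left_tensor G (core_part G N)"

definition star_tensor ::
  "('g, 'm, 'e::real_normed_vector, 'f::real_normed_vector) lie_groupoid_data \<Rightarrow>
     ('g \<Rightarrow> 'e \<Rightarrow> 'e) \<Rightarrow> ('g \<Rightarrow> 'e \<Rightarrow> 'e) \<Rightarrow> 'g \<Rightarrow> 'e \<Rightarrow> 'e"
  where "star_tensor G N1 N2 = N1 + left_tensor G (core_part G N2)"


section \<open>Strict monoidal categories and 2-vector spaces\<close>

text \<open>\<open>cmp f g\<close> is the composite of \<open>g\<close> followed by \<open>f\<close>, meaningful when \<open>dom f = cod g\<close>.\<close>

locale small_category =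
  fixes Ob :: "'o set" and Ar :: "'a set"
    and dom :: "'a \<Rightarrow> 'o" and cod :: "'a \<Rightarrow> 'o"
    and idn :: "'o \<Rightarrow> 'a" and cmp :: "'a \<Rightarrow> 'a \<Rightarrow> 'a"
  assumes dom_in: "f \<in> Ar \<Longrightarrow> dom f \<in> Ob"
    and cod_in: "f \<in> Ar \<Longrightarrow> cod f \<in> Ob"
    and idn_in: "x \<in> Ob \<Longrightarrow> idn x \<in> Ar"
    and dom_idn: "x \<in> Ob \<Longrightarrow> dom (idn x) = x"
    and cod_idn: "x \<in> Ob \<Longrightarrow> cod (idn x) = x"
    and cmp_in: "\<lbrakk>f \<in> Ar; g \<in> Ar; dom f = cod g\<rbrakk> \<Longrightarrow> cmp f g \<in> Ar"
    and dom_cmp: "\<lbrakk>f \<in> Ar; g \<in> Ar; dom f = cod g\<rbrakk> \<Longrightarrow> dom (cmp f g) = dom g"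
    and cod_cmp: "\<lbrakk>f \<in> Ar; g \<in> Ar; dom f = cod g\<rbrakk> \<Longrightarrow> cod (cmp f g) = cod f"
    and cmp_assoc: "\<lbrakk>f \<in> Ar; g \<in> Ar; h \<in> Ar; dom f = cod g; dom g = cod h\<rbrakk> \<Longrightarrow>
      cmp (cmp f g) h = cmp f (cmp g h)"
    and cmp_idn_left: "f \<in> Ar \<Longrightarrow> cmp (idn (cod f)) f = f"
    and cmp_idn_right: "f \<in> Ar \<Longrightarrow> cmp f (idn (dom f)) = f"

text \<open>The objects and the arrows are subspaces of ambient real vector spaces; \<open>cmp\<close> is linear on the
  space of composable pairs.\<close>

locale two_vector_space = small_category Ob Ar dom cod idn cmp
  for Ob :: "'o::real_vector set" and Ar :: "'a::real_vector set" and dom cod idn cmp +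
  assumes subspace_Ob: "subspace Ob"
    and subspace_Ar: "subspace Ar"
    and dom_linear: "\<lbrakk>f \<in> Ar; g \<in> Ar\<rbrakk> \<Longrightarrow> dom (a *\<^sub>R f + b *\<^sub>R g) = a *\<^sub>R dom f + b *\<^sub>R dom g"
    and cod_linear: "\<lbrakk>f \<in> Ar; g \<in> Ar\<rbrakk> \<Longrightarrow> cod (a *\<^sub>R f + b *\<^sub>R g) = a *\<^sub>R cod f + b *\<^sub>R cod g"
    and idn_linear: "\<lbrakk>x \<in> Ob; y \<in> Ob\<rbrakk> \<Longrightarrow> idn (a *\<^sub>R x + b *\<^sub>R y) = a *\<^sub>R idn x + b *\<^sub>R idn y"
    and cmp_linear: "\<lbrakk>f \<in> Ar; g \<in> Ar; f' \<in> Ar; g' \<in> Ar; dom f = cod g; dom f' = cod g'\<rbrakk> \<Longrightarrow>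
      cmp (a *\<^sub>R f + b *\<^sub>R f') (a *\<^sub>R g + b *\<^sub>R g') = a *\<^sub>R cmp f g + b *\<^sub>R cmp f' g'"

locale strict_monoidal_category = small_category Ob Ar dom cod idn cmp
  for Ob :: "'o set" and Ar :: "'a set" and dom cod idn cmp +
  fixes tensor_ob :: "'o \<Rightarrow> 'o \<Rightarrow> 'o" and tensor_ar :: "'a \<Rightarrow> 'a \<Rightarrow> 'a" and e :: 'o
  assumes tensor_ob_in: "\<lbrakk>x \<in> Ob; y \<in> Ob\<rbrakk> \<Longrightarrow> tensor_ob x y \<in> Ob"
    and tensor_ar_in: "\<lbrakk>f \<in> Ar; g \<in> Ar\<rbrakk> \<Longrightarrow> tensor_ar f g \<in> Ar"
    and dom_tensor: "\<lbrakk>f \<in> Ar; g \<in> Ar\<rbrakk> \<Longrightarrow> dom (tensor_ar f g) = tensor_ob (dom f) (dom g)"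
    and cod_tensor: "\<lbrakk>f \<in> Ar; g \<in> Ar\<rbrakk> \<Longrightarrow> cod (tensor_ar f g) = tensor_ob (cod f) (cod g)"
    and tensor_idn: "\<lbrakk>x \<in> Ob; y \<in> Ob\<rbrakk> \<Longrightarrow> tensor_ar (idn x) (idn y) = idn (tensor_ob x y)"
    and tensor_cmp: "\<lbrakk>f \<in> Ar; g \<in> Ar; f' \<in> Ar; g' \<in> Ar; dom f = cod g; dom f' = cod g'\<rbrakk> \<Longrightarrow>
      tensor_ar (cmp f g) (cmp f' g') = cmp (tensor_ar f f') (tensor_ar g g')"
    and tensor_ob_assoc: "\<lbrakk>x \<in> Ob; y \<in> Ob; z \<in> Ob\<rbrakk> \<Longrightarrow>
      tensor_ob (tensor_ob x y) z = tensor_ob x (tensor_ob y z)"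
    and tensor_ar_assoc: "\<lbrakk>f \<in> Ar; g \<in> Ar; h \<in> Ar\<rbrakk> \<Longrightarrow>
      tensor_ar (tensor_ar f g) h = tensor_ar f (tensor_ar g h)"
    and unit_in: "e \<in> Ob"
    and unit_ob_left: "x \<in> Ob \<Longrightarrow> tensor_ob e x = x"
    and unit_ob_right: "x \<in> Ob \<Longrightarrow> tensor_ob x e = x"
    and unit_ar_left: "f \<in> Ar \<Longrightarrow> tensor_ar (idn e) f = f"
    and unit_ar_right: "f \<in> Ar \<Longrightarrow> tensor_ar f (idn e) = f"

end

theory Submission
  imports Defs
begin

text \<open>
  Pairing with covectors and separating points from the kernel of the tangent multiplication, the
  affinity condition becomes: whenever \<open>X\<close> and \<open>Y\<close> are composable, so are \<open>N\<^sub>l(X)\<close> and \<open>N(Y)\<close>, and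
  \<open>N(X \<cdot> Y) = N\<^sub>l(X) \<cdot> N(Y)\<close>; equivalently \<open>N(X \<cdot> Y) = N(X) \<cdot> N\<^sub>r(Y)\<close>. Conversely, if
  \<open>N(X \<cdot> Y) = M(X) \<cdot> N(Y)\<close> for all composable pairs, then \<open>M = N\<^sub>l\<close>, as one sees by taking \<open>Y\<close> to
  be a unit. Hence composites of affine tensors are affine, with source and target the composites of
  the sources and targets, and \<open>N * N' = N + N' - M\<close> where \<open>M = N\<^sub>r = N'\<^sub>l\<close>. In the interchange law
  the mixed terms vanish because left-invariant vectors are tangent to the target fibres and
  right-invariant ones to the source fibres.

  The groupoid structure of the tangent groupoid is read off from sequences of arrows with prescribed
  velocities: a smooth map sends velocities to velocities by its differential, and composable tangent
  vectors are velocities of composable sequences, since velocities lift through submersions.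
\<close>

section \<open>Finite-dimensional normed spaces\<close>

text \<open>Two features of the setting shape the work. A tangent vector at \<open>p\<close> is a
  coordinate vector in \<open>chart_at M p\<close>, and these charts may jump from point to point;
  and the multiplication lives only on \<open>composable G\<close>, where a derivative within the
  set is pinned down by the map only in tangent directions. Velocities of sequences deal with both:
  a velocity is a limit, hence unique, so an identity between arrows along a sequence passes to the
  tangent vectors, whatever derivative was chosen. Smoothness in the base point is treated
  separately, through vector fields along a map tested in one fixed chart at a time. The covector
  formula says nothing directly about composability of \<open>N\<^sub>l(X)\<close> and
  \<open>N(Y)\<close>. It determines a pair of vectors only modulo the pairs
  \<open>(left_transl G g u, - right_transl G h u)\<close>, and these form the kernel of the tangent
  multiplication on composable vectors. Such pairs are composable themselves, so composability and
  the value of the product are both recovered. The same pairs relate the factorizations through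
  \<open>N\<^sub>l\<close> and \<open>N\<^sub>r\<close>.\<close>

lemma closed_subspace_dist_lower:
  fixes S :: "'a::real_normed_vector set"
  assumes "subspace S" "closed S" "b \<notin> S"
  obtains d where "d > 0" "\<And>c s. s \<in> S \<Longrightarrow> d * \<bar>c\<bar> \<le> norm (c *\<^sub>R b + s)"
proof -
  have ne: "S \<noteq> {}" using subspace_0[OF assms(1)] by auto
  have pos: "infdist b S > 0"
    using in_closed_iff_infdist_zero[OF assms(2) ne] assms(3) infdist_nonneg[of b S] by force
  \<comment> \<open>The constant is the distance from \<open>b\<close> to \<open>S\<close>. For
    \<open>c \<noteq> 0\<close> the bound is that distance scaled by \<open>|c|\<close>, because
    \<open>c b + s = c (b - s')\<close> with \<open>s' = - s / c\<close> in
    \<open>S\<close>.\<close>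
  have "infdist b S * \<bar>c\<bar> \<le> norm (c *\<^sub>R b + s)" if s: "s \<in> S" for c s
  proof (cases "c = 0")
    case False
    have "(- inverse c) *\<^sub>R s \<in> S" using s assms(1) subspace_scale by blast
    then have "infdist b S \<le> dist b ((- inverse c) *\<^sub>R s)" by (rule infdist_le)
    then have "infdist b S * \<bar>c\<bar> \<le> \<bar>c\<bar> * norm (b + inverse c *\<^sub>R s)"
      by (simp add: dist_norm mult.commute mult_left_mono)
    also have "\<dots> = norm (c *\<^sub>R b + s)"
      using False by (simp flip: norm_scaleR add: scaleR_add_right)
    finally show ?thesis .
  qed simp
  with pos show thesis using that by blast
qed

lemma Cauchy_diff:
  fixes f g :: "nat \<Rightarrow> 'a::real_normed_vector"
  assumes "Cauchy f" "Cauchy g"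
  shows "Cauchy (\<lambda>n. f n - g n)"
proof (rule CauchyI)
  fix e :: real assume "0 < e"
  then have e: "0 < e / 2" by simp
  obtain M N where
    M: "\<And>m n. m \<ge> M \<Longrightarrow> n \<ge> M \<Longrightarrow> norm (f m - f n) < e / 2" and
    N: "\<And>m n. m \<ge> N \<Longrightarrow> n \<ge> N \<Longrightarrow> norm (g m - g n) < e / 2"
    using CauchyD[OF assms(1) e] CauchyD[OF assms(2) e] by metis
  have "norm ((f m - g m) - (f n - g n)) < e" if "m \<ge> max M N" "n \<ge> max M N" for m n
    using norm_triangle_ineq4[of "f m - f n" "g m - g n"] M[of m n] N[of m n] that
    by (simp add: algebra_simps)
  then show "\<exists>K. \<forall>m\<ge>K. \<forall>n\<ge>K. norm ((f m - g m) - (f n - g n)) < e" by blast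
qed

text \<open>The coefficient of a new spanning vector is bounded by a multiple of the norm, because
  the earlier span is complete, hence closed. So the coefficients of a Cauchy sequence are Cauchy,
  and the remainders are Cauchy in the earlier span.\<close>

lemma complete_span_finite:
  fixes B :: "'a::real_normed_vector set"
  assumes "finite B"
  shows "complete (span B)"
  using assms
proof (induction B rule: finite_induct)
  case empty
  then show ?case by (simp add: compact_imp_complete finite_imp_compact)
next
  case (insert b B)
  show ?case
  proof (cases "b \<in> span B")
    case True
    then show ?thesis using insert.IH by (simp add: span_redundant)
  next
    case False
    obtain d where d: "d > 0" "\<And>c s. s \<in> span B \<Longrightarrow> d * \<bar>c\<bar> \<le> norm (c *\<^sub>R b + s)"
      using closed_subspace_dist_lower[OF subspace_span complete_imp_closed[OF insert.IH] False]
      by blast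
    show ?thesis
    proof (rule completeI)
      fix f :: "nat \<Rightarrow> 'a"
      assume f: "\<forall>n. f n \<in> span (insert b B)" and cau: "Cauchy f"
      have "\<forall>n. \<exists>k. f n - k *\<^sub>R b \<in> span B" using f span_breakdown_eq by blast
      then obtain c where c: "\<And>n. f n - c n *\<^sub>R b \<in> span B" by metis
      have le: "d * \<bar>c m - c n\<bar> \<le> norm (f m - f n)" for m n
      proof -
        have "(f m - c m *\<^sub>R b) - (f n - c n *\<^sub>R b) \<in> span B"
          using c span_diff by blast
        from d(2)[OF this, of "c m - c n"] show ?thesis
          by (simp add: algebra_simps)
      qed
      have "Cauchy c"
        unfolding Cauchy_def
      proof (intro allI impI)
        fix e :: real assume e: "e > 0"
        with d(1) have "d * e > 0" by simp
        with cau obtain M where M: "\<And>m n. m \<ge> M \<Longrightarrow> n \<ge> M \<Longrightarrow> dist (f m) (f n) < d * e"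
          unfolding Cauchy_def by meson
        have "dist (c m) (c n) < e" if "m \<ge> M" "n \<ge> M" for m n
        proof -
          have "d * \<bar>c m - c n\<bar> < d * e"
            using le[of m n] M[OF that] by (simp add: dist_norm)
          then show ?thesis using d(1) by (simp add: dist_real_def)
        qed
        then show "\<exists>M. \<forall>m\<ge>M. \<forall>n\<ge>M. dist (c m) (c n) < e" by blast
      qed
      then obtain c0 where c0: "c \<longlonglongrightarrow> c0" using real_Cauchy_convergent convergent_def by blast
      then have cb: "(\<lambda>n. c n *\<^sub>R b) \<longlonglongrightarrow> c0 *\<^sub>R b" by (intro tendsto_intros)
      have "Cauchy (\<lambda>n. f n - c n *\<^sub>R b)"
        using Cauchy_diff[OF cau LIMSEQ_imp_Cauchy[OF cb]] by simp
      then obtain l where l: "l \<in> span B" "(\<lambda>n. f n - c n *\<^sub>R b) \<longlonglongrightarrow> l"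
        using completeE[OF insert.IH, of "\<lambda>n. f n - c n *\<^sub>R b"] c by blast
      have "f \<longlonglongrightarrow> l + c0 *\<^sub>R b" using tendsto_add[OF l(2) cb] by simp
      moreover have "l + c0 *\<^sub>R b \<in> span (insert b B)"
        using l(1) span_breakdown_eq[of "l + c0 *\<^sub>R b" b B] by (metis add_diff_cancel_right')
      ultimately show "\<exists>l\<in>span (insert b B). f \<longlonglongrightarrow> l" by blast
    qed
  qed
qed

text \<open>Same induction: closedness of the earlier span bounds the coefficient \<open>c\<close>
  of \<open>b\<close> by \<open>norm v / d\<close>, after which the remainder \<open>v - c b\<close>
  falls under the induction hypothesis.\<close>

lemma linear_bounded_span_finite:
  fixes f :: "'a::real_normed_vector \<Rightarrow> 'b::real_normed_vector"
  assumes "finite B" and f: "linear f"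
  shows "\<exists>K. \<forall>v\<in>span B. norm (f v) \<le> K * norm v"
  using assms(1)
proof (induction B rule: finite_induct)
  case empty
  then show ?case using linear_0[OF f] by simp
next
  case (insert b B)
  show ?case
  proof (cases "b \<in> span B")
    case True
    then show ?thesis using insert.IH by (simp add: span_redundant)
  next
    case False
    obtain d where d: "d > 0" "\<And>c s. s \<in> span B \<Longrightarrow> d * \<bar>c\<bar> \<le> norm (c *\<^sub>R b + s)"
      using closed_subspace_dist_lower[OF subspace_span
          complete_imp_closed[OF complete_span_finite[OF insert.hyps(1)]] False]
      by blast
    obtain K0 where K0: "\<And>v. v \<in> span B \<Longrightarrow> norm (f v) \<le> K0 * norm v" using insert.IH by blast
    \<comment> \<open>Truncated at 0, since a bound valid on a trivial span may be negative and
      \<open>K\<close> multiplies an inequality below.\<close>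
    define K where "K = max K0 0"
    have K: "K \<ge> 0" and fK: "\<And>v. v \<in> span B \<Longrightarrow> norm (f v) \<le> K * norm v"
      using order_trans[OF K0 mult_right_mono[of K0 K]] by (auto simp: K_def)
    have "norm (f v) \<le> (norm (f b) / d + K * (1 + norm b / d)) * norm v" if v: "v \<in> span (insert b B)" for v
    proof -
      obtain c where c: "v - c *\<^sub>R b \<in> span B" using v span_breakdown_eq by blast
      have "d * \<bar>c\<bar> \<le> norm v" using d(2)[OF c, of c] by simp
      then have c1: "\<bar>c\<bar> \<le> norm v / d" using d(1) by (simp add: field_simps)
      have "norm (v - c *\<^sub>R b) \<le> norm v + \<bar>c\<bar> * norm b"
        using norm_triangle_ineq4[of v "c *\<^sub>R b"] by simp
      also have "\<dots> \<le> norm v + norm v / d * norm b"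
        using c1 by (intro add_left_mono mult_right_mono) auto
      finally have n1: "norm (v - c *\<^sub>R b) \<le> norm v + norm v / d * norm b" .
      have "f v = c *\<^sub>R f b + f (v - c *\<^sub>R b)"
        using f by (simp add: linear_diff linear_scale)
      then have "norm (f v) \<le> \<bar>c\<bar> * norm (f b) + norm (f (v - c *\<^sub>R b))"
        by (metis norm_scaleR norm_triangle_ineq)
      also have "\<dots> \<le> norm v / d * norm (f b) + K * (norm v + norm v / d * norm b)"
        using c1 fK[OF c] n1 K
        by (intro add_mono mult_right_mono) (auto intro: order_trans mult_left_mono)
      finally show ?thesis by (simp add: algebra_simps)
    qed
    then show ?thesis by blast
  qed
qed

lemma finite_dimensional_bounded_linear:
  fixes f :: "'a::real_normed_vector \<Rightarrow> 'b::real_normed_vector"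
  assumes "finite_dimensional TYPE('a)" "linear f"
  shows "bounded_linear f"
proof -
  obtain B :: "'a set" where B: "finite B" "span B = UNIV"
    using assms(1) unfolding finite_dimensional_def by blast
  obtain K where "\<forall>v\<in>span B. norm (f v) \<le> K * norm v"
    using linear_bounded_span_finite[OF B(1) assms(2)] by blast
  then show ?thesis
    using assms(2) B(2) by (intro bounded_linear_intro[of f K]) (auto simp: linear_add linear_scale mult.commute)
qed

lemma finite_dimensional_complete:
  assumes "finite_dimensional TYPE('a::real_normed_vector)"
  shows "complete (UNIV :: 'a::real_normed_vector set)"
proof -
  obtain B :: "'a set" where "finite B" "span B = UNIV"
    using assms unfolding finite_dimensional_def by blast
  with complete_span_finite[of B] show ?thesis by simp
qed

text \<open>A linear map that varies with a point is controlled through its values in fixed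
  directions; expanding its argument in these coordinates turns its value into a finite sum of
  products.\<close>

lemma finite_dimensional_coords:
  assumes "finite_dimensional TYPE('a::real_normed_vector)"
  obtains B :: "'a::real_normed_vector set" and \<kappa> :: "'a \<Rightarrow> 'a \<Rightarrow> real"
  where "finite B" "\<And>b. bounded_linear (\<kappa> b)" "\<And>v. v = (\<Sum>b\<in>B. \<kappa> b v *\<^sub>R b)"
proof -
  obtain B0 :: "'a set" where B0: "finite B0" "span B0 = UNIV"
    using assms unfolding finite_dimensional_def by blast
  obtain B where B: "B \<subseteq> B0" "independent B" "B0 \<subseteq> span B"
    using maximal_independent_subset[of B0] by blast
  have fB: "finite B" using B(1) B0(1) finite_subset by blast
  have sB: "span B = UNIV" using B(3) B0(2) span_minimal[OF _ subspace_span] by blast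
  define \<kappa> where "\<kappa> = (\<lambda>b v. representation B v b)"
  have "linear (\<kappa> b)" for b
    using B(2) sB by (auto simp: \<kappa>_def linear_iff representation_add representation_scale)
  then have "bounded_linear (\<kappa> b)" for b
    using finite_dimensional_bounded_linear[OF assms] by blast
  moreover have "v = (\<Sum>b\<in>B. \<kappa> b v *\<^sub>R b)" for v
    using sum_representation_eq[OF B(2) _ fB, of v] sB by (simp add: \<kappa>_def)
  ultimately show thesis using that fB by blast
qed

lemma linear_expand:
  assumes "linear f" "\<And>v. v = (\<Sum>b\<in>B. \<kappa> b v *\<^sub>R b)"
  shows "f v = (\<Sum>b\<in>B. \<kappa> b v *\<^sub>R f b)"
proof -
  have "f v = f (\<Sum>b\<in>B. \<kappa> b v *\<^sub>R b)" using assms(2)[of v] by simp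
  then show ?thesis using assms(1) by (simp add: linear_sum linear_scale)
qed

lemma finite_dimensional_prod:
  assumes "finite_dimensional TYPE('a::real_normed_vector)" "finite_dimensional TYPE('b::real_normed_vector)"
  shows "finite_dimensional TYPE('a::real_normed_vector \<times> 'b::real_normed_vector)"
proof -
  obtain A :: "'a set" where A: "finite A" "span A = UNIV"
    using assms(1) unfolding finite_dimensional_def by blast
  obtain B :: "'b set" where B: "finite B" "span B = UNIV"
    using assms(2) unfolding finite_dimensional_def by blast
  let ?C = "(\<lambda>a. (a, 0::'b)) ` A \<union> (\<lambda>b. (0::'a, b)) ` B"
  have lin: "linear (\<lambda>a::'a. (a, 0::'b))" "linear (\<lambda>b::'b. (0::'a, b))"
    by (auto simp: linear_iff)
  have "(x, y) \<in> span ?C" for x y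
  proof -
    have "(x, 0) \<in> span ?C"
    proof -
      have "(x, 0) \<in> span ((\<lambda>a. (a, 0::'b)) ` A)"
        unfolding linear_span_image[OF lin(1)] A(2) by blast
      then show ?thesis using span_mono[OF Un_upper1] by blast
    qed
    moreover have "(0, y) \<in> span ?C"
    proof -
      have "(0, y) \<in> span ((\<lambda>b. (0::'a, b)) ` B)"
        unfolding linear_span_image[OF lin(2)] B(2) by blast
      then show ?thesis using span_mono[OF Un_upper2] by blast
    qed
    ultimately show ?thesis using span_add by fastforce
  qed
  then have "span ?C = UNIV" by (metis UNIV_eq_I surj_pair)
  moreover have "finite ?C" using A(1) B(1) by simp
  ultimately show ?thesis unfolding finite_dimensional_def by metis
qed

section \<open>Maps of class C^k\<close>

lemma Ck_on_subset: "Ck_on k S f \<Longrightarrow> T \<subseteq> S \<Longrightarrow> Ck_on k T f"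
proof (induction k arbitrary: f)
  case 0
  then show ?case by (metis Ck_on.simps(1) continuous_on_subset)
next
  case (Suc k)
  then show ?case by (simp add: subset_eq)
qed

lemma Ck_on_cong:
  assumes "open S" "\<And>x. x \<in> S \<Longrightarrow> f x = g x" "Ck_on k S f"
  shows "Ck_on k S g"
  using assms(2,3)
proof (induction k arbitrary: f g)
  case 0
  then show ?case using continuous_on_cong[of S S f g] by simp
next
  case (Suc k)
  have d: "f differentiable at x" if "x \<in> S" for x using Suc.prems(2) that by simp
  have "g differentiable at x" if x: "x \<in> S" for x
    using d[OF x] has_derivative_transform_within_open[where f = f and g = g, OF _ assms(1) x Suc.prems(1)]
    unfolding differentiable_def by blast
  moreover have "Ck_on k S (\<lambda>x. frechet_derivative g (at x) v)" for v
  proof (rule Suc.IH)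
    show "Ck_on k S (\<lambda>x. frechet_derivative f (at x) v)" using Suc.prems(2) by simp
    show "frechet_derivative f (at x) v = frechet_derivative g (at x) v" if "x \<in> S" for x
      using frechet_derivative_transform_within_open[OF d[OF that] assms(1) that Suc.prems(1)] by simp
  qed
  ultimately show ?case by simp
qed

lemma Ck_on_SucD: "Ck_on (Suc k) S f \<Longrightarrow> Ck_on k S f"
proof (induction k arbitrary: f)
  case 0
  then show ?case
    by (auto intro!: continuous_at_imp_continuous_on differentiable_imp_continuous_within)
next
  case (Suc k)
  then have "\<And>v. Ck_on k S (\<lambda>x. frechet_derivative f (at x) v)" by simp
  with Suc.prems show ?case by simp
qed

lemma Ck_on_const: "Ck_on k S (\<lambda>_. c)"
  by (induction k arbitrary: c) simp_all

lemma Ck_on_SucI: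
  assumes "open S" "\<And>x. x \<in> S \<Longrightarrow> (f has_derivative f' x) (at x)"
    "\<And>v. Ck_on k S (\<lambda>x. f' x v)"
  shows "Ck_on (Suc k) S f"
proof -
  have "frechet_derivative f (at x) = f' x" if "x \<in> S" for x
    using frechet_derivative_at[OF assms(2)[OF that]] by simp
  then have "Ck_on k S (\<lambda>x. frechet_derivative f (at x) v)" for v
    using Ck_on_cong[OF assms(1) _ assms(3)[of v]] by simp
  then show ?thesis using assms(2) by (auto simp: differentiable_def)
qed

lemma Ck_on_has_derivative:
  "Ck_on (Suc k) S f \<Longrightarrow> x \<in> S \<Longrightarrow> (f has_derivative frechet_derivative f (at x)) (at x)"
  by (simp add: frechet_derivative_works)

lemma Ck_on_bounded_linear:
  assumes "open S" "bounded_linear L"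
  shows "Ck_on k S L"
proof (cases k)
  case 0
  then show ?thesis using linear_continuous_on[OF assms(2)] by simp
next
  case (Suc j)
  show ?thesis unfolding Suc
    by (rule Ck_on_SucI[OF assms(1) bounded_linear_imp_has_derivative[OF assms(2)] Ck_on_const])
qed

lemma Ck_on_add:
  assumes "open S" "Ck_on k S f" "Ck_on k S g"
  shows "Ck_on k S (\<lambda>x. f x + g x)"
  using assms(2,3)
proof (induction k arbitrary: f g)
  case 0
  then show ?case by (auto intro: continuous_intros)
next
  case (Suc k)
  show ?case
  proof (rule Ck_on_SucI[OF assms(1)])
    show "((\<lambda>x. f x + g x) has_derivative
        (\<lambda>v. frechet_derivative f (at x) v + frechet_derivative g (at x) v)) (at x)" if "x \<in> S" for x
      using Suc.prems that by (intro has_derivative_add Ck_on_has_derivative)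
    show "Ck_on k S (\<lambda>x. frechet_derivative f (at x) v + frechet_derivative g (at x) v)" for v
      using Suc.prems by (intro Suc.IH) auto
  qed
qed

lemma Ck_on_sum:
  assumes "open S" "\<And>i. i \<in> I \<Longrightarrow> Ck_on k S (f i)"
  shows "Ck_on k S (\<lambda>x. \<Sum>i\<in>I. f i x)"
  using assms(2)
  by (induction I rule: infinite_finite_induct) (auto intro: Ck_on_const Ck_on_add[OF assms(1)])

lemma Ck_on_bilinear:
  assumes "open S" "bounded_bilinear p" "Ck_on k S f" "Ck_on k S g"
  shows "Ck_on k S (\<lambda>x. p (f x) (g x))"
  using assms(3,4)
proof (induction k arbitrary: f g)
  case 0
  then show ?case using bounded_bilinear.continuous_on[OF assms(2)] by auto
next
  case (Suc k)
  show ?case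
  proof (rule Ck_on_SucI[OF assms(1)])
    show "((\<lambda>x. p (f x) (g x)) has_derivative
        (\<lambda>v. p (f x) (frechet_derivative g (at x) v) + p (frechet_derivative f (at x) v) (g x))) (at x)"
      if "x \<in> S" for x
      using Suc.prems that by (intro bounded_bilinear.FDERIV[OF assms(2)] Ck_on_has_derivative)
    show "Ck_on k S (\<lambda>x. p (f x) (frechet_derivative g (at x) v) + p (frechet_derivative f (at x) v) (g x))" for v
      using Suc.prems Ck_on_SucD[OF Suc.prems(1)] Ck_on_SucD[OF Suc.prems(2)]
      by (intro Ck_on_add[OF assms(1)] Suc.IH) auto
  qed
qed

lemma Ck_on_compose_linear:
  assumes "open S" "bounded_linear L" "Ck_on k S f"
  shows "Ck_on k S (\<lambda>x. L (f x))"
  using assms(3)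
proof (induction k arbitrary: f)
  case 0
  then show ?case using bounded_linear.continuous_on[OF assms(2)] by auto
next
  case (Suc k)
  show ?case
  proof (rule Ck_on_SucI[OF assms(1)])
    show "((\<lambda>x. L (f x)) has_derivative (\<lambda>v. L (frechet_derivative f (at x) v))) (at x)"
      if "x \<in> S" for x
      using Suc.prems that by (intro bounded_linear.has_derivative[OF assms(2)] Ck_on_has_derivative)
    show "Ck_on k S (\<lambda>x. L (frechet_derivative f (at x) v))" for v
      using Suc.prems by (intro Suc.IH) auto
  qed
qed

text \<open>In the chain rule, \<open>g\<close> is differentiated in the moving direction
  \<open>Df(x) v\<close>. Expanding that direction in a basis leaves derivatives of \<open>g\<close>
  in fixed directions, composed with \<open>f\<close>, and to these the induction over
  \<open>k\<close> (with \<open>f\<close> fixed and \<open>g\<close> varying) applies.\<close>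

lemma Ck_on_compose:
  fixes f :: "'a::real_normed_vector \<Rightarrow> 'b::real_normed_vector"
  assumes "finite_dimensional TYPE('b)" "open S" "open T" "f ` S \<subseteq> T" "Ck_on k T g" "Ck_on k S f"
  shows "Ck_on k S (\<lambda>x. g (f x))"
proof -
  obtain B :: "'b set" and \<kappa> :: "'b \<Rightarrow> 'b \<Rightarrow> real" where
    B: "finite B" "\<And>b. bounded_linear (\<kappa> b)" "\<And>v. v = (\<Sum>b\<in>B. \<kappa> b v *\<^sub>R b)"
    using finite_dimensional_coords[OF assms(1)] by metis
  show ?thesis using assms(5,6)
  proof (induction k arbitrary: g)
    case 0
    then show ?case using assms(4) by (auto intro: continuous_on_compose2)
  next
    case (Suc k)
    show ?case
    proof (rule Ck_on_SucI[OF assms(2)])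
      fix x assume x: "x \<in> S"
      then have fx: "f x \<in> T" using assms(4) by blast
      have g: "(g has_derivative frechet_derivative g (at (f x))) (at (f x))"
        by (rule Ck_on_has_derivative[OF Suc.prems(1) fx])
      have lin: "linear (frechet_derivative g (at (f x)))"
        using has_derivative_linear[OF g] .
      have "((\<lambda>x. g (f x)) has_derivative (\<lambda>v. frechet_derivative g (at (f x)) (frechet_derivative f (at x) v))) (at x)"
        by (rule has_derivative_compose[OF Ck_on_has_derivative[OF Suc.prems(2) x] g])
      then show "((\<lambda>x. g (f x)) has_derivative
          (\<lambda>v. \<Sum>b\<in>B. \<kappa> b (frechet_derivative f (at x) v) *\<^sub>R frechet_derivative g (at (f x)) b)) (at x)"
        unfolding linear_expand[OF lin B(3), symmetric] .
    next
      fix v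
      have "Ck_on k S (\<lambda>x. frechet_derivative g (at (f x)) b)" for b
        using Suc.prems Ck_on_SucD[OF Suc.prems(2)] by (intro Suc.IH) auto
      then show "Ck_on k S (\<lambda>x. \<Sum>b\<in>B. \<kappa> b (frechet_derivative f (at x) v) *\<^sub>R frechet_derivative g (at (f x)) b)"
        using Suc.prems
        by (intro Ck_on_sum[OF assms(2)] Ck_on_bilinear[OF assms(2) bounded_bilinear_scaleR]
            Ck_on_compose_linear[OF assms(2) B(2)]) auto
    qed
  qed
qed

section \<open>Closure properties of smooth maps\<close>

lemma smooth_on_subset: "smooth_on S f \<Longrightarrow> T \<subseteq> S \<Longrightarrow> smooth_on T f"
  by (auto simp: smooth_on_def intro: Ck_on_subset)

lemma smooth_on_cong: "open S \<Longrightarrow> (\<And>x. x \<in> S \<Longrightarrow> f x = g x) \<Longrightarrow> smooth_on S f \<Longrightarrow> smooth_on S g"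
  unfolding smooth_on_def using Ck_on_cong by blast

lemma smooth_on_const: "smooth_on S (\<lambda>_. c)"
  by (simp add: smooth_on_def Ck_on_const)

lemma smooth_on_bounded_linear: "open S \<Longrightarrow> bounded_linear L \<Longrightarrow> smooth_on S L"
  by (simp add: smooth_on_def Ck_on_bounded_linear)

lemma smooth_on_add: "open S \<Longrightarrow> smooth_on S f \<Longrightarrow> smooth_on S g \<Longrightarrow> smooth_on S (\<lambda>x. f x + g x)"
  by (simp add: smooth_on_def Ck_on_add)

lemma smooth_on_sum:
  "open S \<Longrightarrow> (\<And>i. i \<in> I \<Longrightarrow> smooth_on S (f i)) \<Longrightarrow> smooth_on S (\<lambda>x. \<Sum>i\<in>I. f i x)"
  by (simp add: smooth_on_def Ck_on_sum)

lemma smooth_on_scaleR: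
  "open S \<Longrightarrow> smooth_on S f \<Longrightarrow> smooth_on S g \<Longrightarrow> smooth_on S (\<lambda>x. f x *\<^sub>R g x)"
  by (simp add: smooth_on_def Ck_on_bilinear[OF _ bounded_bilinear_scaleR])

lemma smooth_on_compose_linear:
  "open S \<Longrightarrow> bounded_linear L \<Longrightarrow> smooth_on S f \<Longrightarrow> smooth_on S (\<lambda>x. L (f x))"
  by (simp add: smooth_on_def Ck_on_compose_linear)

lemma smooth_on_compose:
  fixes f :: "'a::real_normed_vector \<Rightarrow> 'b::real_normed_vector"
  assumes "finite_dimensional TYPE('b)" "open S" "open T" "f ` S \<subseteq> T" "smooth_on T g" "smooth_on S f"
  shows "smooth_on S (\<lambda>x. g (f x))"
  using assms by (auto simp: smooth_on_def intro: Ck_on_compose)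

lemma smooth_on_Pair:
  assumes "open S" "smooth_on S f" "smooth_on S g"
  shows "smooth_on S (\<lambda>x. (f x, g x))"
proof -
  have "smooth_on S (\<lambda>x. (f x, 0) + (0, g x))"
    using assms by (intro smooth_on_add smooth_on_compose_linear[where L = "\<lambda>x. (x, 0)"]
        smooth_on_compose_linear[where L = "\<lambda>x. (0, x)"] bounded_linear_Pair
        bounded_linear_ident bounded_linear_zero)
  then show ?thesis by simp
qed

lemma smooth_on_continuous_on: "smooth_on S f \<Longrightarrow> continuous_on S f"
  unfolding smooth_on_def by (drule spec[of _ 0]) simp

lemma smooth_on_has_derivative:
  "smooth_on S f \<Longrightarrow> x \<in> S \<Longrightarrow> (f has_derivative frechet_derivative f (at x)) (at x)"
  unfolding smooth_on_def by (blast intro: Ck_on_has_derivative[of 0])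

lemma smooth_on_frechet_derivative:
  "smooth_on S f \<Longrightarrow> smooth_on S (\<lambda>x. frechet_derivative f (at x) v)"
  unfolding smooth_on_def
proof
  show "Ck_on k S (\<lambda>x. frechet_derivative f (at x) v)" if "\<forall>k. Ck_on k S f" for k
    using that[rule_format, of "Suc k"] by simp
qed

text \<open>Smoothness of \<open>A\<close> in each fixed direction suffices: expanding
  \<open>V x\<close> in a basis leaves a finite sum of scalar functions times fixed-direction values
  of \<open>A\<close>.\<close>

lemma smooth_on_apply:
  fixes V :: "'a::real_normed_vector \<Rightarrow> 'b::real_normed_vector"
  assumes "finite_dimensional TYPE('b)" "open S" "\<And>x. x \<in> S \<Longrightarrow> linear (A x)"
    "\<And>v. smooth_on S (\<lambda>x. A x v)" "smooth_on S V"
  shows "smooth_on S (\<lambda>x. A x (V x))"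
proof -
  obtain B :: "'b set" and \<kappa> :: "'b \<Rightarrow> 'b \<Rightarrow> real" where
    B: "finite B" "\<And>b. bounded_linear (\<kappa> b)" "\<And>v. v = (\<Sum>b\<in>B. \<kappa> b v *\<^sub>R b)"
    using finite_dimensional_coords[OF assms(1)] by metis
  have "smooth_on S (\<lambda>x. \<Sum>b\<in>B. \<kappa> b (V x) *\<^sub>R A x b)"
    by (rule smooth_on_sum[OF assms(2)],
        rule smooth_on_scaleR[OF assms(2) smooth_on_compose_linear[OF assms(2) B(2) assms(5)] assms(4)])
  then show ?thesis
    using smooth_on_cong[OF assms(2), of "\<lambda>x. \<Sum>b\<in>B. \<kappa> b (V x) *\<^sub>R A x b" "\<lambda>x. A x (V x)"]
      linear_expand[OF assms(3) B(3)] by simp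
qed

lemma smooth_on_local:
  assumes "\<And>x. x \<in> S \<Longrightarrow> \<exists>U. open U \<and> x \<in> U \<and> smooth_on U f"
  shows "smooth_on S f"
proof -
  have "Ck_on k S f" if "\<And>x. x \<in> S \<Longrightarrow> \<exists>U. open U \<and> x \<in> U \<and> Ck_on k U f" for k
    using that
  proof (induction k arbitrary: f)
    case 0
    then show ?case
      by (auto intro!: continuous_at_imp_continuous_on) (metis continuous_on_eq_continuous_at)
  next
    case (Suc k)
    have "f differentiable at x" if "x \<in> S" for x
      using Suc.prems[OF that] by auto
    moreover have "Ck_on k S (\<lambda>x. frechet_derivative f (at x) v)" for v
    proof (rule Suc.IH)
      fix x assume "x \<in> S"
      then obtain U where "open U" "x \<in> U" "Ck_on (Suc k) U f" using Suc.prems by blast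
      then show "\<exists>U. open U \<and> x \<in> U \<and> Ck_on k U (\<lambda>x. frechet_derivative f (at x) v)" by auto
    qed
    ultimately show ?case by simp
  qed
  then show ?thesis using assms unfolding smooth_on_def by blast
qed

section \<open>Lifting velocities through submersions\<close>

lemma tendsto_inverse_rate:
  fixes x :: "nat \<Rightarrow> 'a::real_normed_vector"
  assumes "(\<lambda>n. real n *\<^sub>R (x n - a)) \<longlonglongrightarrow> v"
  shows "x \<longlonglongrightarrow> a"
proof -
  have "(\<lambda>n. inverse (real n) *\<^sub>R (real n *\<^sub>R (x n - a))) \<longlonglongrightarrow> 0 *\<^sub>R v"
    by (intro tendsto_scaleR lim_inverse_n assms)
  moreover have "\<forall>\<^sub>F n in sequentially. inverse (real n) *\<^sub>R (real n *\<^sub>R (x n - a)) = x n - a"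
    using eventually_gt_at_top[of 0] by eventually_elim simp
  ultimately have "(\<lambda>n. x n - a) \<longlonglongrightarrow> 0"
    using Lim_transform_eventually by force
  then show ?thesis by (simp add: LIM_zero_iff)
qed

text \<open>Chain rule for a sequence at step size \<open>1 / n\<close>: the Frechet remainder at
  \<open>x n\<close> is small compared with \<open>norm (x n - a)\<close>, and \<open>n\<close>
  times the latter stays bounded.\<close>

lemma has_derivative_rate:
  fixes f :: "'a::real_normed_vector \<Rightarrow> 'b::real_normed_vector"
  assumes f: "(f has_derivative D) (at a within S)"
    and ev: "\<forall>\<^sub>F n in sequentially. x n \<in> S"
    and lim: "(\<lambda>n. real n *\<^sub>R (x n - a)) \<longlonglongrightarrow> v"
  shows "(\<lambda>n. real n *\<^sub>R (f (x n) - f a)) \<longlonglongrightarrow> D v"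
proof -
  have D: "bounded_linear D" using f by (rule has_derivative_bounded_linear)
  have xa: "x \<longlonglongrightarrow> a" by (rule tendsto_inverse_rate[OF lim])
  define R where "R = (\<lambda>n. real n *\<^sub>R (f (x n) - f a - D (x n - a)))"
  have "R \<longlonglongrightarrow> 0"
  proof (rule tendstoI)
    fix e :: real assume e: "e > 0"
    \<comment> \<open>Eventually \<open>n * norm (x n - a)\<close> is below
      \<open>norm v + 1\<close>; the summand 1 gives room above the limit and covers the case
      \<open>v = 0\<close>.\<close>
    define \<epsilon> where "\<epsilon> = e / (norm v + 1)"
    have nv: "0 < norm v + 1" using norm_ge_zero[of v] by linarith
    have \<epsilon>: "\<epsilon> > 0" using e nv by (simp add: \<epsilon>_def)
    obtain \<delta> where \<delta>: "\<delta> > 0"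
      "\<And>y. y \<in> S \<Longrightarrow> norm (y - a) < \<delta> \<Longrightarrow> norm (f y - f a - D (y - a)) \<le> \<epsilon> * norm (y - a)"
      using f \<epsilon> unfolding has_derivative_within_alt by blast
    have "\<forall>\<^sub>F n in sequentially. norm (x n - a) < \<delta>"
      using tendstoD[OF xa \<delta>(1)] by (simp add: dist_norm)
    moreover have "\<forall>\<^sub>F n in sequentially. norm (real n *\<^sub>R (x n - a)) < norm v + 1"
      using tendsto_norm[OF lim] by (rule order_tendstoD) simp
    ultimately show "\<forall>\<^sub>F n in sequentially. dist (R n) 0 < e"
      using ev
    proof eventually_elim
      case (elim n)
      have "norm (R n) = real n * norm (f (x n) - f a - D (x n - a))" by (simp add: R_def)
      also have "\<dots> \<le> real n * (\<epsilon> * norm (x n - a))"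
        using \<delta>(2) elim by (intro mult_left_mono) auto
      also have "\<dots> = \<epsilon> * norm (real n *\<^sub>R (x n - a))" by simp
      also have "\<dots> < \<epsilon> * (norm v + 1)" using elim \<epsilon> by simp
      also have "\<dots> = e" using nv by (simp add: \<epsilon>_def)
      finally show ?case by simp
    qed
  qed
  moreover have "(\<lambda>n. D (real n *\<^sub>R (x n - a))) \<longlonglongrightarrow> D v"
    by (rule bounded_linear.tendsto[OF D lim])
  ultimately have "(\<lambda>n. R n + D (real n *\<^sub>R (x n - a))) \<longlonglongrightarrow> 0 + D v" by (rule tendsto_add)
  moreover have "R n + D (real n *\<^sub>R (x n - a)) = real n *\<^sub>R (f (x n) - f a)" for n
    using linear_scale[OF bounded_linear.linear[OF D], of "real n" "x n - a"]
    by (simp add: R_def scaleR_diff_right)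
  ultimately show ?thesis by simp
qed

text \<open>Continuity of the derivative in finitely many basis directions makes it close to the
  derivative at \<open>a\<close> in operator norm on a ball; the mean value inequality is then
  applied to \<open>F\<close> minus its linear part at \<open>a\<close>.\<close>

lemma strict_differentiable:
  fixes F :: "'a::real_normed_vector \<Rightarrow> 'b::real_normed_vector"
  assumes fd: "finite_dimensional TYPE('a)" and "open U" "a \<in> U" "smooth_on U F" "e > 0"
  obtains \<delta> where "\<delta> > 0" "ball a \<delta> \<subseteq> U"
    "\<And>x y. x \<in> ball a \<delta> \<Longrightarrow> y \<in> ball a \<delta> \<Longrightarrow>
      norm (F x - F y - frechet_derivative F (at a) (x - y)) \<le> e * norm (x - y)"
proof -
  obtain B :: "'a set" and \<kappa> :: "'a \<Rightarrow> 'a \<Rightarrow> real" where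
    B: "finite B" "\<And>b. bounded_linear (\<kappa> b)" "\<And>v. v = (\<Sum>b\<in>B. \<kappa> b v *\<^sub>R b)"
    using finite_dimensional_coords[OF fd] by metis
  define D where "D = (\<lambda>x. frechet_derivative F (at x))"
  have D: "(F has_derivative D x) (at x)" if "x \<in> U" for x
    unfolding D_def by (rule smooth_on_has_derivative[OF assms(4) that])
  \<comment> \<open>A deviation of \<open>e / K\<close> in every basis direction adds up to at most
    \<open>e\<close> in operator norm; the summand 1 keeps \<open>K\<close> positive even if the
    basis is empty.\<close>
  define K where "K = (\<Sum>b\<in>B. onorm (\<kappa> b)) + 1"
  have K: "K > 0" using sum_nonneg[of B "\<lambda>b. onorm (\<kappa> b)"] onorm_pos_le[OF B(2)]
    by (simp add: K_def add_nonneg_pos)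
  have "\<forall>\<^sub>F x in at a. dist (D x b) (D a b) < e / K" for b
  proof -
    have "continuous_on U (\<lambda>x. D x b)"
      unfolding D_def by (rule smooth_on_continuous_on[OF smooth_on_frechet_derivative[OF assms(4)]])
    then have "((\<lambda>x. D x b) \<longlongrightarrow> D a b) (at a)"
      using assms(2,3) by (simp add: continuous_on_eq_continuous_at isCont_def)
    then show ?thesis by (rule tendstoD) (use K \<open>e > 0\<close> in simp)
  qed
  then have "\<forall>\<^sub>F x in at a. \<forall>b\<in>B. dist (D x b) (D a b) < e / K"
    using B(1) by (simp add: eventually_ball_finite_distrib)
  then have "\<forall>\<^sub>F x in nhds a. \<forall>b\<in>B. dist (D x b) (D a b) < e / K"
    using K \<open>e > 0\<close> by (auto simp: eventually_at_filter elim!: eventually_mono)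
  moreover have "\<forall>\<^sub>F x in nhds a. x \<in> U" using assms(2,3) by (rule eventually_nhds_in_open)
  ultimately have "\<forall>\<^sub>F x in nhds a. x \<in> U \<and> (\<forall>b\<in>B. dist (D x b) (D a b) < e / K)"
    by eventually_elim simp
  then obtain \<delta> where \<delta>: "\<delta> > 0" "\<And>x. dist x a < \<delta> \<Longrightarrow> x \<in> U \<and> (\<forall>b\<in>B. dist (D x b) (D a b) < e / K)"
    unfolding eventually_nhds_metric by blast
  have U: "ball a \<delta> \<subseteq> U" using \<delta>(2) by (auto simp: dist_commute)
  have lin: "linear (D x)" if "x \<in> U" for x using has_derivative_linear[OF D[OF that]] .
  have bd: "onorm (\<lambda>v. D x v - D a v) \<le> e" if x: "x \<in> ball a \<delta>" for x
  proof (rule onorm_bound)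
    show "0 \<le> e" using \<open>e > 0\<close> by simp
    fix v
    have xU: "x \<in> U" using x U by blast
    have l: "linear (\<lambda>v. D x v - D a v)"
      using lin[OF xU] lin[OF assms(3)] by (rule linear_compose_sub)
    have "norm (D x v - D a v) = norm (\<Sum>b\<in>B. \<kappa> b v *\<^sub>R (D x b - D a b))"
      using linear_expand[OF l B(3), of v] by simp
    also have "\<dots> \<le> (\<Sum>b\<in>B. norm (\<kappa> b v *\<^sub>R (D x b - D a b)))" by (rule norm_sum)
    also have "\<dots> \<le> (\<Sum>b\<in>B. (onorm (\<kappa> b) * norm v) * (e / K))"
    proof (rule sum_mono)
      fix b assume b: "b \<in> B"
      have "\<bar>\<kappa> b v\<bar> \<le> onorm (\<kappa> b) * norm v" using onorm[OF B(2), of b v] by simp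
      moreover have "norm (D x b - D a b) \<le> e / K"
        using \<delta>(2)[of x] x b by (auto simp: dist_commute dist_norm norm_minus_commute less_imp_le)
      ultimately show "norm (\<kappa> b v *\<^sub>R (D x b - D a b)) \<le> (onorm (\<kappa> b) * norm v) * (e / K)"
        unfolding norm_scaleR real_norm_def
        by (intro mult_mono) (use onorm_pos_le[OF B(2)] in auto)
    qed
    also have "\<dots> = (\<Sum>b\<in>B. onorm (\<kappa> b)) * norm v * (e / K)"
      unfolding sum_distrib_right ..
    also have "\<dots> = (K - 1) * (e / K) * norm v"
      by (simp add: K_def)
    also have "\<dots> \<le> e * norm v"
      using K \<open>e > 0\<close> by (intro mult_right_mono) (auto simp: field_simps)
    finally show "norm (D x v - D a v) \<le> e * norm v" .
  qed
  have "norm (F x - F y - D a (x - y)) \<le> e * norm (x - y)" if xy: "x \<in> ball a \<delta>" "y \<in> ball a \<delta>" for x y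
  proof -
    have "norm ((F x - D a x) - (F y - D a y)) \<le> e * norm (x - y)"
    proof (rule differentiable_bound[where S = "ball a \<delta>" and f' = "\<lambda>x v. D x v - D a v"])
      show "((\<lambda>x. F x - D a x) has_derivative (\<lambda>v. D z v - D a v)) (at z within ball a \<delta>)"
        if "z \<in> ball a \<delta>" for z
        using D[of z] that U assms(3) D has_derivative_bounded_linear
        by (intro has_derivative_diff has_derivative_at_withinI[OF D] bounded_linear_imp_has_derivative) auto
    qed (use bd xy in auto)
    then show ?thesis using lin[OF assms(3)] by (simp add: linear_diff algebra_simps)
  qed
  then show thesis using that[OF \<delta>(1) U] unfolding D_def by blast
qed

text \<open>Graves' theorem. With a linear right inverse \<open>R\<close> of the derivative at
  \<open>a\<close>, the equation \<open>F (x + R w) = y\<close> becomes the fixed point equation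
  \<open>G w = w\<close>, and \<open>G\<close> is a contraction uniformly for \<open>x\<close> near
  \<open>a\<close>. The bound on \<open>z\<close> by the defect \<open>y - F x\<close> is the point:
  it lets a correction keep a prescribed velocity.\<close>

lemma metric_regularity:
  fixes F :: "'a::real_normed_vector \<Rightarrow> 'b::real_normed_vector"
  assumes fda: "finite_dimensional TYPE('a)" and fdb: "finite_dimensional TYPE('b)"
    and U: "open U" "a \<in> U" "smooth_on U F" and surj: "surj (frechet_derivative F (at a))"
  obtains \<delta> K where "\<delta> > 0" "K > 0"
    "\<And>x y. norm (x - a) < \<delta> \<Longrightarrow> norm (y - F x) < \<delta> \<Longrightarrow>
      \<exists>z. x + z \<in> U \<and> F (x + z) = y \<and> norm z \<le> K * norm (y - F x)"
proof -
  define D where "D = frechet_derivative F (at a)"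
  have "linear D" unfolding D_def
    using has_derivative_linear[OF smooth_on_has_derivative[OF U(3,2)]] .
  then obtain R where R: "linear R" "D \<circ> R = id"
    using linear_surjective_right_inverse surj unfolding D_def by blast
  obtain c where c: "c > 0" "\<And>w. norm (R w) \<le> norm w * c"
    using bounded_linear.pos_bounded[OF finite_dimensional_bounded_linear[OF fdb R(1)]] by blast
  \<comment> \<open>\<open>c\<close> bounds \<open>R\<close>, so an error of
    \<open>1 / (2 * c)\<close> in the linearization becomes a contraction factor 1/2 after composing
    with \<open>R\<close>.\<close>
  have "1 / (2 * c) > 0" using c(1) by simp
  from strict_differentiable[OF fda U this]
  obtain \<rho> where \<rho>: "\<rho> > 0" "ball a \<rho> \<subseteq> U"
    "\<And>x y. x \<in> ball a \<rho> \<Longrightarrow> y \<in> ball a \<rho> \<Longrightarrow> norm (F x - F y - D (x - y)) \<le> 1 / (2 * c) * norm (x - y)"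
    unfolding D_def by metis
  \<comment> \<open>Half of the radius \<open>\<rho>\<close> is reserved for the distance of
    \<open>x\<close> from \<open>a\<close>, half for the correction \<open>R w\<close>, whose norm
    is at most \<open>2 * c * \<delta>\<close>.\<close>
  define \<delta> where "\<delta> = min (\<rho> / 2) (\<rho> / (4 * c))"
  have \<delta>: "\<delta> > 0" "\<delta> \<le> \<rho> / 2" "2 * c * \<delta> \<le> \<rho> / 2"
    using \<rho>(1) c(1) by (auto simp: \<delta>_def min_def field_simps)
  have "\<exists>z. x + z \<in> U \<and> F (x + z) = y \<and> norm z \<le> (2 * c) * norm (y - F x)"
    if x: "norm (x - a) < \<delta>" and y: "norm (y - F x) < \<delta>" for x y
  proof -
    \<comment> \<open>\<open>G 0\<close> has norm \<open>r / 2\<close>, so a contraction by 1/2 maps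
      the ball of radius \<open>r\<close> into itself.\<close>
    define r where "r = 2 * norm (y - F x)"
    define G where "G = (\<lambda>w. w - (F (x + R w) - y))"
    have inball: "x + R w \<in> ball a \<rho>" if "w \<in> cball 0 r" for w
    proof -
      have "norm (R w) \<le> r * c" using c that order_trans[OF c(2)] by (simp add: mult_right_mono)
      also have "\<dots> \<le> 2 * c * \<delta>" using y c(1) by (simp add: r_def mult_ac)
      finally have "norm (R w) \<le> \<rho> / 2" using \<delta>(3) by simp
      moreover have "norm (a - (x + R w)) \<le> norm (x - a) + norm (R w)"
        by (metis diff_diff_eq norm_minus_commute norm_triangle_ineq4)
      ultimately show ?thesis using x \<delta>(2) by (simp add: dist_norm)
    qed
    have contr: "norm (G w - G w') \<le> 1/2 * norm (w - w')" if "w \<in> cball 0 r" "w' \<in> cball 0 r" for w w'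
    proof -
      have DR: "D (R (w - w')) = w - w'" using R(2) by (metis comp_apply id_apply)
      have "G w - G w' = - (F (x + R w) - F (x + R w') - D ((x + R w) - (x + R w')))"
        using DR R(1) by (simp add: G_def linear_diff algebra_simps)
      then have "norm (G w - G w') \<le> 1 / (2 * c) * norm ((x + R w) - (x + R w'))"
        using \<rho>(3)[OF inball[OF that(1)] inball[OF that(2)]] by (simp add: norm_minus_commute)
      also have "\<dots> = 1 / (2 * c) * norm (R (w - w'))" using R(1) by (simp add: linear_diff)
      also have "\<dots> \<le> 1 / (2 * c) * (norm (w - w') * c)"
        using c by (intro mult_left_mono) auto
      finally show ?thesis using c(1) by simp
    qed
    have G0: "norm (G 0) = r / 2"
      using linear_0[OF R(1)] by (simp add: G_def r_def norm_minus_commute)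
    have "\<exists>!w\<in>cball 0 r. G w = w"
    proof (rule Banach_fix[where c = "1/2"])
      show "complete (cball (0::'b) r)"
        using complete_closed_subset[OF closed_cball _ finite_dimensional_complete[OF fdb]] by simp
      show "cball (0::'b) r \<noteq> {}" by (auto simp: r_def)
      show "G ` cball 0 r \<subseteq> cball 0 r"
      proof clarify
        fix w :: 'b assume w: "w \<in> cball 0 r"
        have "norm (G w - G 0) \<le> 1/2 * norm (w - 0)" by (rule contr) (use w in \<open>auto simp: r_def\<close>)
        moreover have "norm (G w) \<le> norm (G w - G 0) + norm (G 0)"
          by (metis diff_add_cancel norm_triangle_ineq)
        ultimately show "G w \<in> cball 0 r" using w G0 by simp
      qed
    qed (use contr in \<open>auto simp: dist_norm\<close>)
    then obtain w where w: "w \<in> cball 0 r" "G w = w" by blast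
    have "F (x + R w) = y" using w(2) by (simp add: G_def)
    moreover have "x + R w \<in> U" using inball[OF w(1)] \<rho>(2) by blast
    moreover have "norm (R w) \<le> (2 * c) * norm (y - F x)"
      using c(2)[of w] w(1) c(1) order_trans[OF c(2)] by (simp add: r_def mult_ac)
    ultimately show ?thesis by blast
  qed
  then show thesis using that[of \<delta> "2 * c"] \<delta>(1) c(1) by simp
qed

text \<open>The image of the straight line through \<open>a\<close> with velocity \<open>v\<close>
  misses \<open>y n\<close> by o(1/n). Metric regularity repairs this by a displacement of the same
  order, which leaves the velocity unchanged.\<close>

lemma submersion_lift_rate:
  fixes F :: "'a::real_normed_vector \<Rightarrow> 'b::real_normed_vector"
  assumes "finite_dimensional TYPE('a)" "finite_dimensional TYPE('b)"
    and U: "open U" "a \<in> U" "smooth_on U F" and surj: "surj (frechet_derivative F (at a))"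
    and lim: "(\<lambda>n. real n *\<^sub>R (y n - F a)) \<longlonglongrightarrow> frechet_derivative F (at a) v"
  obtains x where "\<forall>\<^sub>F n in sequentially. x n \<in> U \<and> F (x n) = y n"
    "(\<lambda>n. real n *\<^sub>R (x n - a)) \<longlonglongrightarrow> v"
proof -
  define D where "D = frechet_derivative F (at a)"
  have D: "(F has_derivative D) (at a)" unfolding D_def by (rule smooth_on_has_derivative[OF U(3,2)])
  obtain \<delta> K where \<delta>: "\<delta> > 0" "K > 0" and reg: "\<And>x y. norm (x - a) < \<delta> \<Longrightarrow> norm (y - F x) < \<delta> \<Longrightarrow>
      \<exists>z. x + z \<in> U \<and> F (x + z) = y \<and> norm z \<le> K * norm (y - F x)"
    using metric_regularity[OF assms(1,2) U surj] by metis
  define x0 where "x0 = (\<lambda>n. a + inverse (real n) *\<^sub>R v)"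
  have x0: "(\<lambda>n. real n *\<^sub>R (x0 n - a)) \<longlonglongrightarrow> v"
  proof (rule Lim_transform_eventually[OF tendsto_const])
    show "\<forall>\<^sub>F n in sequentially. v = real n *\<^sub>R (x0 n - a)"
      using eventually_gt_at_top[of 0] by eventually_elim (simp add: x0_def)
  qed
  have "(\<lambda>n. real n *\<^sub>R (F (x0 n) - F a)) \<longlonglongrightarrow> D v"
    by (rule has_derivative_rate[OF D _ x0]) simp
  from tendsto_diff[OF lim this] have diff: "(\<lambda>n. real n *\<^sub>R (y n - F (x0 n))) \<longlonglongrightarrow> 0"
    by (simp add: D_def algebra_simps)
  have lim0: "(\<lambda>n. y n - F (x0 n)) \<longlonglongrightarrow> 0"
    using tendsto_inverse_rate[of "\<lambda>n. y n - F (x0 n)" 0] diff by simp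
  define P where "P = (\<lambda>n z. x0 n + z \<in> U \<and> F (x0 n + z) = y n \<and> norm z \<le> K * norm (y n - F (x0 n)))"
  define z where "z = (\<lambda>n. SOME z. P n z)"
  have "\<forall>\<^sub>F n in sequentially. norm (x0 n - a) < \<delta>"
    using tendstoD[OF tendsto_inverse_rate[OF x0] \<delta>(1)] by (simp add: dist_norm)
  moreover have "\<forall>\<^sub>F n in sequentially. norm (y n - F (x0 n)) < \<delta>"
    using tendstoD[OF lim0 \<delta>(1)] by simp
  ultimately have z: "\<forall>\<^sub>F n in sequentially. P n (z n)"
  proof eventually_elim
    case (elim n)
    then show ?case using reg someI_ex[of "P n"] unfolding P_def z_def by blast
  qed
  have "(\<lambda>n. real n *\<^sub>R z n) \<longlonglongrightarrow> 0"
  proof (rule Lim_null_comparison)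
    show "\<forall>\<^sub>F n in sequentially. norm (real n *\<^sub>R z n) \<le> K * norm (real n *\<^sub>R (y n - F (x0 n)))"
      using z
    proof eventually_elim
      case (elim n)
      then have "real n * norm (z n) \<le> real n * (K * norm (y n - F (x0 n)))"
        unfolding P_def by (intro mult_left_mono) auto
      then show ?case by (simp add: mult.left_commute)
    qed
    show "(\<lambda>n. K * norm (real n *\<^sub>R (y n - F (x0 n)))) \<longlonglongrightarrow> 0"
      using tendsto_mult_right_zero[OF tendsto_norm_zero[OF diff]] .
  qed
  from tendsto_add[OF x0 this] have "(\<lambda>n. real n *\<^sub>R ((x0 n + z n) - a)) \<longlonglongrightarrow> v"
    by (simp add: algebra_simps)
  moreover have "\<forall>\<^sub>F n in sequentially. x0 n + z n \<in> U \<and> F (x0 n + z n) = y n"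
    using z by eventually_elim (simp add: P_def)
  ultimately show thesis using that[of "\<lambda>n. x0 n + z n"] by blast
qed

section \<open>Velocities in manifolds\<close>

text \<open>The part of a smooth structure that does not refer to the topology; it is inherited by
  products without topological arguments.\<close>

definition charted :: "('a, 'e::real_normed_vector) manifold \<Rightarrow> bool" where
  "charted M \<longleftrightarrow> finite_dimensional TYPE('e) \<and>
     (\<forall>c\<in>atlas M. fst c \<subseteq> points M \<and> inj_on (snd c) (fst c)) \<and>
     (\<forall>c\<in>atlas M. \<forall>d\<in>atlas M. open (snd c ` (fst c \<inter> fst d)) \<and>
        smooth_on (snd c ` (fst c \<inter> fst d)) (snd d \<circ> chart_inv c)) \<and>
     (\<forall>p\<in>points M. chart_at M p \<in> atlas M \<and> p \<in> fst (chart_at M p))"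

lemma chartedD:
  assumes "charted (M :: ('a, 'e::real_normed_vector) manifold)"
  shows "finite_dimensional TYPE('e)"
    and "c \<in> atlas M \<Longrightarrow> fst c \<subseteq> points M"
    and "c \<in> atlas M \<Longrightarrow> inj_on (snd c) (fst c)"
    and "c \<in> atlas M \<Longrightarrow> d \<in> atlas M \<Longrightarrow> open (snd c ` (fst c \<inter> fst d))"
    and "c \<in> atlas M \<Longrightarrow> d \<in> atlas M \<Longrightarrow> smooth_on (snd c ` (fst c \<inter> fst d)) (snd d \<circ> chart_inv c)"
    and "p \<in> points M \<Longrightarrow> chart_at M p \<in> atlas M"
    and "p \<in> points M \<Longrightarrow> p \<in> fst (chart_at M p)"
  using assms unfolding charted_def by blast+

lemma smooth_structure_charted:
  assumes "smooth_structure M"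
  shows "charted M"
proof -
  have c: "openin (mtop M) (fst c)" "open (snd c ` fst c)"
    "homeomorphic_map (subtopology (mtop M) (fst c)) (top_of_set (snd c ` fst c)) (snd c)"
    if "c \<in> atlas M" for c
    using assms that unfolding smooth_structure_def by (auto simp: case_prod_beta)
  have sub: "fst c \<subseteq> points M" if "c \<in> atlas M" for c
    using c(1)[OF that] by (rule openin_subset)
  have top: "topspace (subtopology (mtop M) (fst c)) = fst c" if "c \<in> atlas M" for c
    using sub[OF that] by auto
  have inj: "inj_on (snd c) (fst c)" if "c \<in> atlas M" for c
    using c(3)[OF that] top[OF that] unfolding homeomorphic_eq_everything_map by metis
  have op: "open (snd c ` (fst c \<inter> fst d))" if cd: "c \<in> atlas M" "d \<in> atlas M" for c d
  proof -
    have "openin (subtopology (mtop M) (fst c)) (fst c \<inter> fst d)"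
      using c(1)[OF cd(2)] by (simp add: openin_subtopology_Int2)
    then have "openin (top_of_set (snd c ` fst c)) (snd c ` (fst c \<inter> fst d))"
      using homeomorphic_imp_open_map[OF c(3)[OF cd(1)]] unfolding open_map_def by blast
    then show ?thesis using c(2)[OF cd(1)] openin_open_eq by blast
  qed
  show ?thesis
    using assms sub inj op unfolding charted_def smooth_structure_def by blast
qed

text \<open>Membership in the chart domain is demanded separately: \<open>snd c\<close> has
  arbitrary values outside it, so the limit alone would not make the points approach
  \<open>p\<close>.\<close>

definition vel_in :: "('a, 'e::real_normed_vector) chart \<Rightarrow> 'a \<Rightarrow> (nat \<Rightarrow> 'a) \<Rightarrow> 'e \<Rightarrow> bool" where
  "vel_in c p s v \<longleftrightarrow> (\<forall>\<^sub>F n in sequentially. s n \<in> fst c) \<and>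
     (\<lambda>n. real n *\<^sub>R (snd c (s n) - snd c p)) \<longlonglongrightarrow> v"

text \<open>The tangent vector \<open>v\<close> at \<open>p\<close> is the velocity at \<open>0\<close> of a curve passing through \<open>s n\<close> at
  time \<open>1 / n\<close>.\<close>

abbreviation velocity :: "('a, 'e::real_normed_vector) manifold \<Rightarrow> 'a \<Rightarrow> (nat \<Rightarrow> 'a) \<Rightarrow> 'e \<Rightarrow> bool"
  where "velocity M p \<equiv> vel_in (chart_at M p) p"

text \<open>On these vectors the value of \<open>differential\<close> is forced by the map itself,
  whereas on others it may depend on the chosen extension.\<close>

definition tangent_to :: "('a, 'e::real_normed_vector) manifold \<Rightarrow> 'a set \<Rightarrow> 'a \<Rightarrow> 'e \<Rightarrow> bool"
  where "tangent_to M S p v \<longleftrightarrow> (\<exists>s. (\<forall>\<^sub>F n in sequentially. s n \<in> S) \<and> velocity M p s v)"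

abbreviation transition :: "('a, 'e::real_normed_vector) chart \<Rightarrow> ('a, 'e) chart \<Rightarrow> 'a \<Rightarrow> 'e \<Rightarrow> 'e"
  where "transition c d p \<equiv> frechet_derivative (snd d \<circ> chart_inv c) (at (snd c p))"

lemma vel_in_unique: "vel_in c p s v \<Longrightarrow> vel_in c p s w \<Longrightarrow> v = w"
  unfolding vel_in_def using LIMSEQ_unique by blast

lemma vel_in_const: "p \<in> fst c \<Longrightarrow> vel_in c p (\<lambda>_. p) 0"
  by (simp add: vel_in_def)

lemma vel_in_cong:
  "vel_in c p s v \<Longrightarrow> \<forall>\<^sub>F n in sequentially. s n = t n \<Longrightarrow> vel_in c p t v"
  unfolding vel_in_def
proof (elim conjE, rule conjI)
  assume eq: "\<forall>\<^sub>F n in sequentially. s n = t n" and s: "\<forall>\<^sub>F n in sequentially. s n \<in> fst c"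
  then show "\<forall>\<^sub>F n in sequentially. t n \<in> fst c" by eventually_elim simp
  have "\<forall>\<^sub>F n in sequentially. real n *\<^sub>R (snd c (s n) - snd c p) = real n *\<^sub>R (snd c (t n) - snd c p)"
    using eq by eventually_elim simp
  moreover assume "(\<lambda>n. real n *\<^sub>R (snd c (s n) - snd c p)) \<longlonglongrightarrow> v"
  ultimately show "(\<lambda>n. real n *\<^sub>R (snd c (t n) - snd c p)) \<longlonglongrightarrow> v"
    by (rule Lim_transform_eventually[rotated])
qed

lemma vel_in_tendsto: "vel_in c p s v \<Longrightarrow> (\<lambda>n. snd c (s n)) \<longlonglongrightarrow> snd c p"
  unfolding vel_in_def by (blast intro: tendsto_inverse_rate)

lemma vel_in_eventually:
  assumes "vel_in c p s v" "open W" "snd c p \<in> W"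
  shows "\<forall>\<^sub>F n in sequentially. snd c (s n) \<in> W"
  using topological_tendstoD[OF vel_in_tendsto[OF assms(1)] assms(2,3)] .

section \<open>Charts and changes of chart acting on velocities\<close>

context
  fixes M :: "('a, 'e::real_normed_vector) manifold"
  assumes M: "charted M"
begin

lemma open_chart_image: "c \<in> atlas M \<Longrightarrow> open (snd c ` fst c)"
  using chartedD(4)[OF M, of c c] by simp

lemma chart_inv_f: "c \<in> atlas M \<Longrightarrow> q \<in> fst c \<Longrightarrow> chart_inv c (snd c q) = q"
  by (rule inv_into_f_f[OF chartedD(3)[OF M]])

lemma vel_in_exists:
  assumes "c \<in> atlas M" "p \<in> fst c"
  obtains s where "vel_in c p s v"
proof -
  define x where "x = (\<lambda>n. snd c p + inverse (real n) *\<^sub>R v)"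
  have x: "(\<lambda>n. real n *\<^sub>R (x n - snd c p)) \<longlonglongrightarrow> v"
  proof (rule Lim_transform_eventually[OF tendsto_const])
    show "\<forall>\<^sub>F n in sequentially. v = real n *\<^sub>R (x n - snd c p)"
      using eventually_gt_at_top[of 0] by eventually_elim (simp add: x_def)
  qed
  have ev: "\<forall>\<^sub>F n in sequentially. x n \<in> snd c ` fst c"
    using topological_tendstoD[OF tendsto_inverse_rate[OF x] open_chart_image[OF assms(1)]] assms(2)
    by blast
  have "vel_in c p (\<lambda>n. chart_inv c (x n)) v"
    unfolding vel_in_def
  proof
    show "\<forall>\<^sub>F n in sequentially. chart_inv c (x n) \<in> fst c"
      using ev by eventually_elim (rule inv_into_into)
    have "\<forall>\<^sub>F n in sequentially. real n *\<^sub>R (x n - snd c p) =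
        real n *\<^sub>R (snd c (chart_inv c (x n)) - snd c p)"
      using ev by eventually_elim (simp add: f_inv_into_f)
    then show "(\<lambda>n. real n *\<^sub>R (snd c (chart_inv c (x n)) - snd c p)) \<longlonglongrightarrow> v"
      by (rule Lim_transform_eventually[OF x])
  qed
  then show thesis by (rule that)
qed

text \<open>Coordinates close to those of \<open>p\<close> lie in the open image of the overlap, and
  injectivity of the chart puts the points themselves into the overlap.\<close>

lemma vel_in_eventually_chart:
  assumes c: "c \<in> atlas M" and d: "d \<in> atlas M" and p: "p \<in> fst c" "p \<in> fst d" and v: "vel_in c p s v"
  shows "\<forall>\<^sub>F n in sequentially. s n \<in> fst c \<inter> fst d"
proof -
  have "\<forall>\<^sub>F n in sequentially. snd c (s n) \<in> snd c ` (fst c \<inter> fst d)"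
    using vel_in_eventually[OF v chartedD(4)[OF M c d]] p by blast
  moreover have "\<forall>\<^sub>F n in sequentially. s n \<in> fst c" using v by (simp add: vel_in_def)
  ultimately show ?thesis
    by eventually_elim (metis inj_on_image_mem_iff[OF chartedD(3)[OF M c]] Int_lower1)
qed

lemma transition_has_derivative:
  assumes "c \<in> atlas M" "d \<in> atlas M" "p \<in> fst c" "p \<in> fst d"
  shows "((snd d \<circ> chart_inv c) has_derivative transition c d p) (at (snd c p))"
  using smooth_on_has_derivative[OF chartedD(5)[OF M assms(1,2)]] assms(3,4) by blast

lemma linear_transition:
  assumes "c \<in> atlas M" "d \<in> atlas M" "p \<in> fst c" "p \<in> fst d"
  shows "linear (transition c d p)"
  using has_derivative_linear[OF transition_has_derivative[OF assms]] .

lemma vel_in_change: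
  assumes c: "c \<in> atlas M" and d: "d \<in> atlas M" and p: "p \<in> fst c" "p \<in> fst d" and v: "vel_in c p s v"
  shows "vel_in d p s (transition c d p v)"
  unfolding vel_in_def
proof
  note ev = vel_in_eventually_chart[OF assms]
  show "\<forall>\<^sub>F n in sequentially. s n \<in> fst d" using ev by eventually_elim simp
  have "(\<lambda>n. real n *\<^sub>R (snd c (s n) - snd c p)) \<longlonglongrightarrow> v" using v by (simp add: vel_in_def)
  from has_derivative_rate[OF transition_has_derivative[OF c d p] _ this]
  have "(\<lambda>n. real n *\<^sub>R ((snd d \<circ> chart_inv c) (snd c (s n)) - (snd d \<circ> chart_inv c) (snd c p)))
      \<longlonglongrightarrow> transition c d p v" by simp
  moreover have "\<forall>\<^sub>F n in sequentially.
      real n *\<^sub>R ((snd d \<circ> chart_inv c) (snd c (s n)) - (snd d \<circ> chart_inv c) (snd c p)) =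
      real n *\<^sub>R (snd d (s n) - snd d p)"
    using ev by eventually_elim (simp add: chart_inv_f[OF c] p)
  ultimately show "(\<lambda>n. real n *\<^sub>R (snd d (s n) - snd d p)) \<longlonglongrightarrow> transition c d p v"
    by (rule Lim_transform_eventually)
qed

lemma transition_id:
  assumes "c \<in> atlas M" "p \<in> fst c"
  shows "transition c c p v = v"
proof -
  obtain s where s: "vel_in c p s v" using vel_in_exists[OF assms] by blast
  show ?thesis using vel_in_unique[OF vel_in_change[OF assms(1,1,2,2) s] s] .
qed

text \<open>Both sides are the velocity in \<open>e\<close> of one sequence, and velocities in a
  chart are unique. Most identities between differentials below follow this pattern.\<close>

lemma transition_trans:
  assumes "c \<in> atlas M" "d \<in> atlas M" "e \<in> atlas M" "p \<in> fst c" "p \<in> fst d" "p \<in> fst e"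
  shows "transition d e p (transition c d p v) = transition c e p v"
proof -
  obtain s where s: "vel_in c p s v" using vel_in_exists[OF assms(1,4)] by blast
  show ?thesis
    using vel_in_unique[OF vel_in_change[OF assms(2,3,5,6) vel_in_change[OF assms(1,2,4,5) s]]
        vel_in_change[OF assms(1,3,4,6) s]] .
qed

lemma velocity_exists:
  assumes "p \<in> points M"
  obtains s where "velocity M p s v"
  using vel_in_exists[OF chartedD(6,7)[OF M assms]] by blast

lemma velocity_in_points:
  assumes "p \<in> points M" "velocity M p s v"
  shows "\<forall>\<^sub>F n in sequentially. s n \<in> points M"
  using chartedD(2)[OF M chartedD(6)[OF M assms(1)]] assms(2)
  by (auto simp: vel_in_def elim: eventually_mono)

lemma tangent_to_points: "p \<in> points M \<Longrightarrow> tangent_to M (points M) p v"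
  unfolding tangent_to_def using velocity_exists velocity_in_points by metis

lemma linear_to_chart:
  assumes "c \<in> atlas M" "p \<in> fst c"
  shows "linear (to_chart M c p)"
proof -
  have p: "p \<in> points M" using chartedD(2)[OF M assms(1)] assms(2) by blast
  show ?thesis
    unfolding to_chart_def using linear_transition[OF chartedD(6)[OF M p] assms(1)
        chartedD(7)[OF M p] assms(2)] .
qed

lemma linear_from_chart:
  assumes "c \<in> atlas M" "p \<in> fst c"
  shows "linear (from_chart M c p)"
proof -
  have p: "p \<in> points M" using chartedD(2)[OF M assms(1)] assms(2) by blast
  show ?thesis
    unfolding from_chart_def using linear_transition[OF assms(1) chartedD(6)[OF M p]
        assms(2) chartedD(7)[OF M p]] .
qed

lemma from_to_chart:
  assumes "c \<in> atlas M" "p \<in> fst c"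
  shows "from_chart M c p (to_chart M c p v) = v"
proof -
  have p: "p \<in> points M" using chartedD(2)[OF M assms(1)] assms(2) by blast
  note q = chartedD(6)[OF M p] chartedD(7)[OF M p]
  show ?thesis
    unfolding to_chart_def from_chart_def
    by (simp add: transition_trans[OF q(1) assms(1) q(1) q(2) assms(2) q(2)] transition_id q)
qed

lemma velocity_to_chart:
  assumes "c \<in> atlas M" "p \<in> fst c" "velocity M p s v"
  shows "vel_in c p s (to_chart M c p v)"
proof -
  have p: "p \<in> points M" using chartedD(2)[OF M assms(1)] assms(2) by blast
  show ?thesis
    unfolding to_chart_def using vel_in_change[OF chartedD(6)[OF M p] assms(1)
        chartedD(7)[OF M p] assms(2,3)] .
qed

end

section \<open>Differentials of smooth maps\<close>

lemma smooth_mapD: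
  assumes "smooth_map M S N f"
  shows "S \<subseteq> points M" "f ` S \<subseteq> points N"
    and "p \<in> S \<Longrightarrow> \<exists>O' F. open O' \<and> snd (chart_at M p) p \<in> O' \<and> smooth_on O' F \<and>
        (\<forall>q\<in>S \<inter> fst (chart_at M p). snd (chart_at M p) q \<in> O' \<longrightarrow>
           f q \<in> fst (chart_at N (f p)) \<and>
           F (snd (chart_at M p) q) = snd (chart_at N (f p)) (f q))"
  using assms unfolding smooth_map_def by blast+

text \<open>The local smooth extension supplies some derivative within \<open>S\<close>;
  \<open>frechet_derivative\<close> then also selects a derivative, though possibly a different
  one.\<close>

lemma differential_has_derivative:
  assumes M: "charted M" and f: "smooth_map M S N f" and p: "p \<in> S"
  shows "(local_rep M N f p has_derivative differential M S N f p)
    (at (snd (chart_at M p) p) within snd (chart_at M p) ` (S \<inter> fst (chart_at M p)))"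
proof -
  let ?\<phi> = "snd (chart_at M p)"
  let ?T = "?\<phi> ` (S \<inter> fst (chart_at M p))"
  have pM: "p \<in> points M" using smooth_mapD(1)[OF f] p by blast
  note c = chartedD(6)[OF M pM] chartedD(7)[OF M pM]
  obtain O' F where F: "open O'" "?\<phi> p \<in> O'" "smooth_on O' F"
    "\<And>q. q \<in> S \<inter> fst (chart_at M p) \<Longrightarrow> ?\<phi> q \<in> O' \<Longrightarrow> F (?\<phi> q) = snd (chart_at N (f p)) (f q)"
    using smooth_mapD(3)[OF f p] by blast
  have "(F has_derivative frechet_derivative F (at (?\<phi> p))) (at (?\<phi> p) within ?T)"
    by (rule has_derivative_at_withinI[OF smooth_on_has_derivative[OF F(3,2)]])
  then have "(local_rep M N f p has_derivative frechet_derivative F (at (?\<phi> p))) (at (?\<phi> p) within ?T)"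
  proof (rule has_derivative_transform_eventually)
    have "\<forall>\<^sub>F x in at (?\<phi> p) within ?T. x \<in> O'"
      using eventually_at_topological F(1,2) by blast
    moreover have "\<forall>\<^sub>F x in at (?\<phi> p) within ?T. x \<in> ?T"
      by (simp add: eventually_at_filter)
    ultimately show "\<forall>\<^sub>F x in at (?\<phi> p) within ?T. F x = local_rep M N f p x"
    proof eventually_elim
      case (elim x)
      then obtain q where q: "q \<in> S \<inter> fst (chart_at M p)" "x = ?\<phi> q" by blast
      then show ?case using F(4)[OF q(1)] elim chart_inv_f[OF M c(1), of q] by (simp add: local_rep_def)
    qed
    show "F (?\<phi> p) = local_rep M N f p (?\<phi> p)"
      using F(4)[of p] F(2) p c chart_inv_f[OF M c] by (simp add: local_rep_def)
    show "?\<phi> p \<in> ?T" using p c by blast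
  qed
  then show ?thesis
    unfolding differential_def by (metis differentiableI frechet_derivative_works)
qed

lemma linear_differential:
  assumes "charted M" "smooth_map M S N f" "p \<in> S"
  shows "linear (differential M S N f p)"
  using has_derivative_linear[OF differential_has_derivative[OF assms]] .

text \<open>Derivatives within \<open>S\<close> need not be unique, but every one of them gives the
  limit of the difference quotients along a sequence in \<open>S\<close>.\<close>

lemma velocity_map:
  assumes M: "charted M" and f: "smooth_map M S N f" and p: "p \<in> S"
    and s: "velocity M p s v" and ev: "\<forall>\<^sub>F n in sequentially. s n \<in> S"
  shows "velocity N (f p) (\<lambda>n. f (s n)) (differential M S N f p v)"
  unfolding vel_in_def
proof
  let ?\<phi> = "snd (chart_at M p)"
  have pM: "p \<in> points M" using smooth_mapD(1)[OF f] p by blast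
  note c = chartedD(6)[OF M pM] chartedD(7)[OF M pM]
  obtain O' where O': "open O'" "?\<phi> p \<in> O'"
    "\<And>q. q \<in> S \<inter> fst (chart_at M p) \<Longrightarrow> ?\<phi> q \<in> O' \<Longrightarrow> f q \<in> fst (chart_at N (f p))"
    using smooth_mapD(3)[OF f p] by blast
  have ev': "\<forall>\<^sub>F n in sequentially. s n \<in> S \<inter> fst (chart_at M p)"
    using ev s unfolding vel_in_def by (auto elim: eventually_elim2)
  have "\<forall>\<^sub>F n in sequentially. ?\<phi> (s n) \<in> O'" by (rule vel_in_eventually[OF s O'(1,2)])
  with ev' show "\<forall>\<^sub>F n in sequentially. f (s n) \<in> fst (chart_at N (f p))"
    by eventually_elim (rule O'(3))
  have T: "\<forall>\<^sub>F n in sequentially. ?\<phi> (s n) \<in> ?\<phi> ` (S \<inter> fst (chart_at M p))"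
    using ev' by eventually_elim (rule imageI)
  have "(\<lambda>n. real n *\<^sub>R (?\<phi> (s n) - ?\<phi> p)) \<longlonglongrightarrow> v" using s by (simp add: vel_in_def)
  from has_derivative_rate[OF differential_has_derivative[OF M f p] T this]
  have "(\<lambda>n. real n *\<^sub>R (local_rep M N f p (?\<phi> (s n)) - local_rep M N f p (?\<phi> p)))
      \<longlonglongrightarrow> differential M S N f p v" .
  moreover have "\<forall>\<^sub>F n in sequentially.
      real n *\<^sub>R (local_rep M N f p (?\<phi> (s n)) - local_rep M N f p (?\<phi> p)) =
      real n *\<^sub>R (snd (chart_at N (f p)) (f (s n)) - snd (chart_at N (f p)) (f p))"
    using ev' by eventually_elim (simp add: local_rep_def chart_inv_f[OF M c(1)] c)
  ultimately show "(\<lambda>n. real n *\<^sub>R (snd (chart_at N (f p)) (f (s n)) - snd (chart_at N (f p)) (f p)))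
      \<longlonglongrightarrow> differential M S N f p v"
    by (rule Lim_transform_eventually)
qed

lemma velocity_map_points:
  assumes "charted M" "smooth_map M (points M) N f" "p \<in> points M" "velocity M p s v"
  shows "velocity N (f p) (\<lambda>n. f (s n)) (differential M (points M) N f p v)"
  by (rule velocity_map[OF assms velocity_in_points[OF assms(1,3,4)]])

text \<open>The charts at \<open>q\<close> and at \<open>f q\<close> are unrelated to those at
  \<open>p\<close> and at \<open>f p\<close>, hence the conversions by \<open>to_chart\<close>. What
  is gained is one smooth \<open>F\<close> whose derivative represents the differential at all
  nearby points of \<open>S\<close>, on tangent vectors; smooth dependence on \<open>q\<close> is
  read off from it.\<close>

lemma differential_in_charts:
  assumes M: "charted M" and N: "charted N" and f: "smooth_map M S N f" and p: "p \<in> S"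
  obtains O' F where "open O'" "snd (chart_at M p) p \<in> O'" "smooth_on O' F"
    "\<And>q. q \<in> S \<Longrightarrow> q \<in> fst (chart_at M p) \<Longrightarrow> snd (chart_at M p) q \<in> O' \<Longrightarrow>
        f q \<in> fst (chart_at N (f p)) \<and> F (snd (chart_at M p) q) = snd (chart_at N (f p)) (f q)"
    "\<And>q v. q \<in> S \<Longrightarrow> q \<in> fst (chart_at M p) \<Longrightarrow> snd (chart_at M p) q \<in> O' \<Longrightarrow> tangent_to M S q v \<Longrightarrow>
        to_chart N (chart_at N (f p)) (f q) (differential M S N f q v) =
        frechet_derivative F (at (snd (chart_at M p) q)) (to_chart M (chart_at M p) q v)"
proof -
  let ?c = "chart_at M p" and ?d = "chart_at N (f p)"
  have pM: "p \<in> points M" using smooth_mapD(1)[OF f] p by blast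
  have fpN: "f p \<in> points N" using smooth_mapD(2)[OF f] p by blast
  note c = chartedD(6)[OF M pM] chartedD(7)[OF M pM]
  note d = chartedD(6)[OF N fpN] chartedD(7)[OF N fpN]
  obtain O' F where F: "open O'" "snd ?c p \<in> O'" "smooth_on O' F"
    "\<And>q. q \<in> S \<Longrightarrow> q \<in> fst ?c \<Longrightarrow> snd ?c q \<in> O' \<Longrightarrow> f q \<in> fst ?d \<and> F (snd ?c q) = snd ?d (f q)"
    using smooth_mapD(3)[OF f p] by blast
  have "to_chart N ?d (f q) (differential M S N f q v) =
        frechet_derivative F (at (snd ?c q)) (to_chart M ?c q v)"
    if q: "q \<in> S" "q \<in> fst ?c" "snd ?c q \<in> O'" "tangent_to M S q v" for q v
  proof -
    obtain s where s: "\<forall>\<^sub>F n in sequentially. s n \<in> S" "velocity M q s v"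
      using q(4) unfolding tangent_to_def by blast
    have fq: "f q \<in> fst ?d" using F(4) q by blast
    have 1: "vel_in ?d (f q) (\<lambda>n. f (s n)) (to_chart N ?d (f q) (differential M S N f q v))"
      by (rule velocity_to_chart[OF N d(1) fq velocity_map[OF M f q(1) s(2,1)]])
    have s': "vel_in ?c q s (to_chart M ?c q v)"
      by (rule velocity_to_chart[OF M c(1) q(2) s(2)])
    have "(\<lambda>n. real n *\<^sub>R (F (snd ?c (s n)) - F (snd ?c q)))
        \<longlonglongrightarrow> frechet_derivative F (at (snd ?c q)) (to_chart M ?c q v)"
      using has_derivative_rate[OF smooth_on_has_derivative[OF F(3) q(3)]] s'
      by (simp add: vel_in_def)
    moreover have "\<forall>\<^sub>F n in sequentially. s n \<in> fst ?c" using s' by (simp add: vel_in_def)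
    with s(1) vel_in_eventually[OF s' F(1) q(3)]
    have "\<forall>\<^sub>F n in sequentially. real n *\<^sub>R (F (snd ?c (s n)) - F (snd ?c q)) =
        real n *\<^sub>R (snd ?d (f (s n)) - snd ?d (f q))"
      by eventually_elim (use F(4) q in simp)
    ultimately have "(\<lambda>n. real n *\<^sub>R (snd ?d (f (s n)) - snd ?d (f q)))
        \<longlonglongrightarrow> frechet_derivative F (at (snd ?c q)) (to_chart M ?c q v)"
      by (rule Lim_transform_eventually)
    then show ?thesis using 1 LIMSEQ_unique unfolding vel_in_def by blast
  qed
  then show thesis using that F by blast
qed

text \<open>The lifted sequence covers \<open>t\<close> exactly, not only to first order. This is
  what makes sequences of arrows composable in the groupoid.\<close>

lemma velocity_lift:
  assumes M: "charted M" and N: "charted N" and f: "smooth_map M (points M) N f"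
    and p: "p \<in> points M" and surj: "surj (differential M (points M) N f p)"
    and t: "velocity N (f p) t (differential M (points M) N f p v)"
  obtains s where "velocity M p s v" "\<forall>\<^sub>F n in sequentially. s n \<in> points M \<and> f (s n) = t n"
proof -
  let ?c = "chart_at M p" and ?d = "chart_at N (f p)"
  have fpN: "f p \<in> points N" using smooth_mapD(2)[OF f] p by blast
  note c = chartedD(6)[OF M p] chartedD(7)[OF M p]
  note d = chartedD(6)[OF N fpN] chartedD(7)[OF N fpN]
  obtain O' F where F: "open O'" "snd ?c p \<in> O'" "smooth_on O' F"
    "\<And>q. q \<in> points M \<Longrightarrow> q \<in> fst ?c \<Longrightarrow> snd ?c q \<in> O' \<Longrightarrow>
       f q \<in> fst ?d \<and> F (snd ?c q) = snd ?d (f q)"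
    "\<And>q v. q \<in> points M \<Longrightarrow> q \<in> fst ?c \<Longrightarrow> snd ?c q \<in> O' \<Longrightarrow> tangent_to M (points M) q v \<Longrightarrow>
        to_chart N ?d (f q) (differential M (points M) N f q v) =
        frechet_derivative F (at (snd ?c q)) (to_chart M ?c q v)"
    using differential_in_charts[OF M N f p] by metis
  have D: "frechet_derivative F (at (snd ?c p)) v = differential M (points M) N f p v" for v
    using F(5)[OF p c(2) F(2) tangent_to_points[OF M p], of v] d c
    by (simp add: to_chart_def transition_id[OF M c] transition_id[OF N d])
  \<comment> \<open>Cut down to coordinates of actual points, so that the lift found in the model
    space comes from a sequence in \<open>M\<close>.\<close>
  define W where "W = O' \<inter> snd ?c ` fst ?c"
  have W: "open W" "snd ?c p \<in> W" "smooth_on W F"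
    using F(1,2) open_chart_image[OF M c(1)] c(2) smooth_on_subset[OF F(3)]
    by (auto simp: W_def)
  have Fp: "F (snd ?c p) = snd ?d (f p)" using F(4)[OF p c(2) F(2)] by simp
  have lim: "(\<lambda>n. real n *\<^sub>R (snd ?d (t n) - F (snd ?c p))) \<longlonglongrightarrow> frechet_derivative F (at (snd ?c p)) v"
    using t by (simp add: D Fp vel_in_def)
  have "frechet_derivative F (at (snd ?c p)) = differential M (points M) N f p" by (rule ext) (rule D)
  with surj have sur: "surj (frechet_derivative F (at (snd ?c p)))" by simp
  obtain x where x: "\<forall>\<^sub>F n in sequentially. x n \<in> W \<and> F (x n) = snd ?d (t n)"
    "(\<lambda>n. real n *\<^sub>R (x n - snd ?c p)) \<longlonglongrightarrow> v"
    by (rule submersion_lift_rate[OF chartedD(1)[OF M] chartedD(1)[OF N] W sur lim])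
  define s where "s = (\<lambda>n. chart_inv ?c (x n))"
  have xs: "\<forall>\<^sub>F n in sequentially. s n \<in> fst ?c \<and> snd ?c (s n) = x n \<and> x n \<in> O'"
    using x(1) by eventually_elim (auto simp: W_def s_def inv_into_into f_inv_into_f)
  have "\<forall>\<^sub>F n in sequentially. real n *\<^sub>R (x n - snd ?c p) = real n *\<^sub>R (snd ?c (s n) - snd ?c p)"
    using xs by eventually_elim simp
  from Lim_transform_eventually[OF x(2) this] have "velocity M p s v"
    using xs by (auto simp: vel_in_def elim: eventually_mono)
  moreover have "\<forall>\<^sub>F n in sequentially. t n \<in> fst ?d" using t by (simp add: vel_in_def)
  with xs x(1) have "\<forall>\<^sub>F n in sequentially. s n \<in> points M \<and> f (s n) = t n"
  proof eventually_elim
    case (elim n)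
    have sM: "s n \<in> points M" using elim chartedD(2)[OF M c(1)] by blast
    have "f (s n) \<in> fst ?d" "snd ?d (f (s n)) = snd ?d (t n)"
      using F(4)[OF sM] elim by auto
    then have "f (s n) = t n" using elim inj_onD[OF chartedD(3)[OF N d(1)]] by blast
    with sM show ?case by blast
  qed
  ultimately show thesis using that by blast
qed

section \<open>Products of manifolds\<close>

lemma vel_in_prod_chart:
  "vel_in (prod_chart c d) (p, q) (\<lambda>n. (s n, t n)) (v, w) \<longleftrightarrow> vel_in c p s v \<and> vel_in d q t w"
proof
  assume "vel_in (prod_chart c d) (p, q) (\<lambda>n. (s n, t n)) (v, w)"
  then have 1: "\<forall>\<^sub>F n in sequentially. s n \<in> fst c \<and> t n \<in> fst d"
    and 2: "(\<lambda>n. (real n *\<^sub>R (snd c (s n) - snd c p), real n *\<^sub>R (snd d (t n) - snd d q))) \<longlonglongrightarrow> (v, w)"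
    by (simp_all add: vel_in_def prod_chart_def)
  show "vel_in c p s v \<and> vel_in d q t w"
    using 1 tendsto_fst[OF 2] tendsto_snd[OF 2] by (auto simp: vel_in_def elim: eventually_mono)
next
  assume "vel_in c p s v \<and> vel_in d q t w"
  then show "vel_in (prod_chart c d) (p, q) (\<lambda>n. (s n, t n)) (v, w)"
    by (auto simp: vel_in_def prod_chart_def eventually_conj intro!: tendsto_Pair)
qed

lemma prod_manifold_simps [simp]:
  "points (prod_manifold M N) = points M \<times> points N"
  "chart_at (prod_manifold M N) (p, q) = prod_chart (chart_at M p) (chart_at N q)"
  "atlas (prod_manifold M N) = {prod_chart c d | c d. c \<in> atlas M \<and> d \<in> atlas N}"
  by (simp_all add: prod_manifold_def)

lemma fst_prod_chart [simp]: "fst (prod_chart c d) = fst c \<times> fst d"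
  by (simp add: prod_chart_def)

lemma snd_prod_chart [simp]: "snd (prod_chart c d) = map_prod (snd c) (snd d)"
  by (simp add: prod_chart_def)

lemma charted_prod:
  assumes M: "charted (M :: ('a, 'e::real_normed_vector) manifold)"
    and N: "charted (N :: ('b, 'f::real_normed_vector) manifold)"
  shows "charted (prod_manifold M N)"
proof -
  have inj: "inj_on (snd (prod_chart c d)) (fst (prod_chart c d))" if "c \<in> atlas M" "d \<in> atlas N" for c d
    using map_prod_inj_on[OF chartedD(3)[OF M that(1)] chartedD(3)[OF N that(2)]] by simp
  have img: "snd (prod_chart c d) ` (fst (prod_chart c d) \<inter> fst (prod_chart c' d')) =
      snd c ` (fst c \<inter> fst c') \<times> snd d ` (fst d \<inter> fst d')" for c d c' d'
    by (simp add: Times_Int_Times map_prod_surj_on[OF refl refl])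
  have op: "open (snd (prod_chart c d) ` (fst (prod_chart c d) \<inter> fst (prod_chart c' d')))"
    if "c \<in> atlas M" "d \<in> atlas N" "c' \<in> atlas M" "d' \<in> atlas N" for c d c' d'
    unfolding img using that chartedD(4)[OF M] chartedD(4)[OF N] by (intro open_Times)
  have sm: "smooth_on (snd (prod_chart c d) ` (fst (prod_chart c d) \<inter> fst (prod_chart c' d')))
      (snd (prod_chart c' d') \<circ> chart_inv (prod_chart c d))"
    if cd: "c \<in> atlas M" "d \<in> atlas N" "c' \<in> atlas M" "d' \<in> atlas N" for c d c' d'
  proof -
    let ?A = "snd c ` (fst c \<inter> fst c')" and ?B = "snd d ` (fst d \<inter> fst d')"
    have o: "open ?A" "open ?B" "open (?A \<times> ?B)"
      using chartedD(4)[OF M cd(1,3)] chartedD(4)[OF N cd(2,4)] open_Times by blast+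
    have "smooth_on (?A \<times> ?B) (\<lambda>x. ((snd c' \<circ> chart_inv c) (fst x), (snd d' \<circ> chart_inv d) (snd x)))"
      using cd o
      by (intro smooth_on_Pair
          smooth_on_compose[OF chartedD(1)[OF M] o(3,1) _ chartedD(5)[OF M]]
          smooth_on_compose[OF chartedD(1)[OF N] o(3,2) _ chartedD(5)[OF N]]
          smooth_on_bounded_linear bounded_linear_fst bounded_linear_snd) auto
    then have "smooth_on (?A \<times> ?B) (snd (prod_chart c' d') \<circ> chart_inv (prod_chart c d))"
    proof (rule smooth_on_cong[OF o(3), rotated])
      fix x assume "x \<in> ?A \<times> ?B"
      then obtain a b where ab: "a \<in> fst c" "b \<in> fst d" "x = (snd c a, snd d b)" by auto
      have "chart_inv (prod_chart c d) x = (a, b)"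
        using inv_into_f_f[OF inj[OF cd(1,2)], of "(a, b)"] ab by simp
      then show "((snd c' \<circ> chart_inv c) (fst x), (snd d' \<circ> chart_inv d) (snd x)) =
          (snd (prod_chart c' d') \<circ> chart_inv (prod_chart c d)) x"
        using ab chart_inv_f[OF M cd(1)] chart_inv_f[OF N cd(2)] by simp
    qed
    then show ?thesis unfolding img .
  qed
  show ?thesis
    unfolding charted_def
  proof (intro conjI ballI)
    show "finite_dimensional TYPE('e \<times> 'f)"
      by (rule finite_dimensional_prod[OF chartedD(1)[OF M] chartedD(1)[OF N]])
  next
    fix c assume "c \<in> atlas (prod_manifold M N)"
    then obtain a b where c: "c = prod_chart a b" "a \<in> atlas M" "b \<in> atlas N" by auto
    then show "fst c \<subseteq> points (prod_manifold M N)" "inj_on (snd c) (fst c)"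
      using chartedD(2)[OF M] chartedD(2)[OF N] inj by (simp_all add: Sigma_mono)
    fix d assume "d \<in> atlas (prod_manifold M N)"
    then obtain a' b' where d: "d = prod_chart a' b'" "a' \<in> atlas M" "b' \<in> atlas N" by auto
    show "open (snd c ` (fst c \<inter> fst d))" "smooth_on (snd c ` (fst c \<inter> fst d)) (snd d \<circ> chart_inv c)"
      unfolding c(1) d(1) using op sm c d by blast+
  next
    fix p assume "p \<in> points (prod_manifold M N)"
    then obtain a b where p: "p = (a, b)" "a \<in> points M" "b \<in> points N" by auto
    show "p \<in> fst (chart_at (prod_manifold M N) p)"
      using p chartedD(7)[OF M p(2)] chartedD(7)[OF N p(3)] by simp
    show "chart_at (prod_manifold M N) p \<in> atlas (prod_manifold M N)"
      unfolding p(1) prod_manifold_simps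
      using chartedD(6)[OF M p(2)] chartedD(6)[OF N p(3)] by blast
  qed
qed

lemma to_chart_prod:
  assumes M: "charted M" and N: "charted N"
    and c: "c \<in> atlas M" "p \<in> fst c" and d: "d \<in> atlas N" "q \<in> fst d"
  shows "to_chart (prod_manifold M N) (prod_chart c d) (p, q) (v, w) = (to_chart M c p v, to_chart N d q w)"
proof -
  have p: "p \<in> points M" using chartedD(2)[OF M c(1)] c(2) by blast
  have q: "q \<in> points N" using chartedD(2)[OF N d(1)] d(2) by blast
  obtain s where s: "velocity M p s v" using velocity_exists[OF M p] by blast
  obtain t where t: "velocity N q t w" using velocity_exists[OF N q] by blast
  have "vel_in (prod_chart c d) (p, q) (\<lambda>n. (s n, t n))
      (to_chart (prod_manifold M N) (prod_chart c d) (p, q) (v, w))"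
  proof (rule velocity_to_chart[OF charted_prod[OF M N]])
    show "prod_chart c d \<in> atlas (prod_manifold M N)"
      unfolding prod_manifold_simps using c d by blast
  qed (use s t c d in \<open>auto simp: vel_in_prod_chart\<close>)
  moreover have "vel_in (prod_chart c d) (p, q) (\<lambda>n. (s n, t n)) (to_chart M c p v, to_chart N d q w)"
    unfolding vel_in_prod_chart using velocity_to_chart[OF M c s] velocity_to_chart[OF N d t] ..
  ultimately show ?thesis by (rule vel_in_unique)
qed

section \<open>Smooth vector fields along a map\<close>

text \<open>A smooth map \<open>f\<close> with a smooth section \<open>V\<close> of the pullback of
  the tangent bundle. Near each \<open>y\<close> both are tested in the single chart at
  \<open>f y\<close>, since the values \<open>V z\<close> are written in charts that may jump with
  \<open>z\<close>.\<close>

definition smooth_along :: "'x::real_normed_vector set \<Rightarrow> ('a, 'e::real_normed_vector) manifold \<Rightarrow>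
    ('x \<Rightarrow> 'a) \<Rightarrow> ('x \<Rightarrow> 'e) \<Rightarrow> bool" where
  "smooth_along P M f V \<longleftrightarrow> (\<forall>y\<in>P. f y \<in> points M \<and>
     (\<exists>W. open W \<and> y \<in> W \<and> W \<subseteq> P \<and> f ` W \<subseteq> fst (chart_at M (f y)) \<and>
        smooth_on W (\<lambda>z. snd (chart_at M (f y)) (f z)) \<and>
        smooth_on W (\<lambda>z. to_chart M (chart_at M (f y)) (f z) (V z))))"

lemma smooth_alongD:
  assumes "smooth_along P M f V" "y \<in> P"
  shows "f y \<in> points M"
    and "\<exists>W. open W \<and> y \<in> W \<and> W \<subseteq> P \<and> f ` W \<subseteq> fst (chart_at M (f y)) \<and>
        smooth_on W (\<lambda>z. snd (chart_at M (f y)) (f z)) \<and>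
        smooth_on W (\<lambda>z. to_chart M (chart_at M (f y)) (f z) (V z))"
  using assms unfolding smooth_along_def by blast+

lemma smooth_along_cong:
  assumes "smooth_along P M f V" "\<And>y. y \<in> P \<Longrightarrow> f y = g y" "\<And>y. y \<in> P \<Longrightarrow> V y = V' y"
  shows "smooth_along P M g V'"
  unfolding smooth_along_def
proof (intro ballI conjI)
  fix y assume y: "y \<in> P"
  then show "g y \<in> points M" using smooth_alongD(1)[OF assms(1)] assms(2) by metis
  obtain W where W: "open W" "y \<in> W" "W \<subseteq> P" "f ` W \<subseteq> fst (chart_at M (f y))"
    "smooth_on W (\<lambda>z. snd (chart_at M (f y)) (f z))"
    "smooth_on W (\<lambda>z. to_chart M (chart_at M (f y)) (f z) (V z))"
    using smooth_alongD(2)[OF assms(1) y] by blast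
  have 1: "smooth_on W (\<lambda>z. snd (chart_at M (g y)) (g z))"
    by (rule smooth_on_cong[OF W(1) _ W(5)]) (use assms(2) W(3) y in auto)
  have 2: "smooth_on W (\<lambda>z. to_chart M (chart_at M (g y)) (g z) (V' z))"
    by (rule smooth_on_cong[OF W(1) _ W(6)]) (use assms(2,3) W(3) y in \<open>auto simp: subset_iff\<close>)
  have 3: "g ` W \<subseteq> fst (chart_at M (g y))" using W(3,4) assms(2) y by fastforce
  show "\<exists>W. open W \<and> y \<in> W \<and> W \<subseteq> P \<and> g ` W \<subseteq> fst (chart_at M (g y)) \<and>
      smooth_on W (\<lambda>z. snd (chart_at M (g y)) (g z)) \<and>
      smooth_on W (\<lambda>z. to_chart M (chart_at M (g y)) (g z) (V' z))"
    using W(1,2,3) 1 2 3 by blast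
qed

text \<open>The tangent functor applied to a vector field along a map. Tangency to \<open>S\<close>
  is needed because the differential of \<open>h\<close> is represented by the derivative of a local
  extension only on such vectors.\<close>

lemma smooth_along_map:
  assumes M: "charted M" and N: "charted N" and h: "smooth_map M S N h"
    and V: "smooth_along P M f V" and S: "\<And>y. y \<in> P \<Longrightarrow> f y \<in> S"
    and T: "\<And>y. y \<in> P \<Longrightarrow> tangent_to M S (f y) (V y)"
  shows "smooth_along P N (\<lambda>y. h (f y)) (\<lambda>y. differential M S N h (f y) (V y))"
  unfolding smooth_along_def
proof (intro ballI conjI)
  fix y assume y: "y \<in> P"
  show "h (f y) \<in> points N" using smooth_mapD(2)[OF h] S[OF y] by blast
  let ?c = "chart_at M (f y)" and ?d = "chart_at N (h (f y))"
  obtain W where W: "open W" "y \<in> W" "W \<subseteq> P" "f ` W \<subseteq> fst ?c"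
    "smooth_on W (\<lambda>z. snd ?c (f z))" "smooth_on W (\<lambda>z. to_chart M ?c (f z) (V z))"
    using smooth_alongD(2)[OF V y] by blast
  obtain O' F where F: "open O'" "snd ?c (f y) \<in> O'" "smooth_on O' F"
    "\<And>q. q \<in> S \<Longrightarrow> q \<in> fst ?c \<Longrightarrow> snd ?c q \<in> O' \<Longrightarrow> h q \<in> fst ?d \<and> F (snd ?c q) = snd ?d (h q)"
    "\<And>q v. q \<in> S \<Longrightarrow> q \<in> fst ?c \<Longrightarrow> snd ?c q \<in> O' \<Longrightarrow> tangent_to M S q v \<Longrightarrow>
        to_chart N ?d (h q) (differential M S N h q v) =
        frechet_derivative F (at (snd ?c q)) (to_chart M ?c q v)"
    using differential_in_charts[OF M N h S[OF y]] by metis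
  define W' where "W' = {z \<in> W. snd ?c (f z) \<in> O'}"
  have W': "open W'" "y \<in> W'" "W' \<subseteq> W"
    using continuous_open_preimage[OF smooth_on_continuous_on[OF W(5)] W(1) F(1)] W(2) F(2)
    by (auto simp: W'_def vimage_def Int_def)
  have z: "f z \<in> S" "f z \<in> fst ?c" "snd ?c (f z) \<in> O'" "tangent_to M S (f z) (V z)" if "z \<in> W'" for z
    using that W(3,4) S T by (auto simp: W'_def)
  have f': "smooth_on W' (\<lambda>z. snd ?c (f z))" by (rule smooth_on_subset[OF W(5) W'(3)])
  have sub: "(\<lambda>z. snd ?c (f z)) ` W' \<subseteq> O'" using z(3) by blast
  have 1: "smooth_on W' (\<lambda>z. snd ?d (h (f z)))"
    by (rule smooth_on_cong[OF W'(1) _ smooth_on_compose[OF chartedD(1)[OF M] W'(1) F(1) sub F(3) f']])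
       (use F(4) z in blast)
  have "smooth_on W' (\<lambda>z. frechet_derivative F (at (snd ?c (f z))) (to_chart M ?c (f z) (V z)))"
  proof (rule smooth_on_apply[OF chartedD(1)[OF M] W'(1)])
    show "linear (frechet_derivative F (at (snd ?c (f x))))" if "x \<in> W'" for x
      using has_derivative_linear[OF smooth_on_has_derivative[OF F(3) z(3)[OF that]]] .
    show "smooth_on W' (\<lambda>x. frechet_derivative F (at (snd ?c (f x))) v)" for v
      by (rule smooth_on_compose[OF chartedD(1)[OF M] W'(1) F(1) sub
            smooth_on_frechet_derivative[OF F(3)] f'])
    show "smooth_on W' (\<lambda>z. to_chart M ?c (f z) (V z))" by (rule smooth_on_subset[OF W(6) W'(3)])
  qed
  then have 2: "smooth_on W' (\<lambda>z. to_chart N ?d (h (f z)) (differential M S N h (f z) (V z)))"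
    by (rule smooth_on_cong[OF W'(1), rotated]) (use F(5) z in simp)
  have 3: "(\<lambda>y. h (f y)) ` W' \<subseteq> fst ?d" using F(4) z by blast
  show "\<exists>W. open W \<and> y \<in> W \<and> W \<subseteq> P \<and> (\<lambda>y. h (f y)) ` W \<subseteq> fst ?d \<and>
      smooth_on W (\<lambda>z. snd ?d (h (f z))) \<and>
      smooth_on W (\<lambda>z. to_chart N ?d (h (f z)) (differential M S N h (f z) (V z)))"
    using W'(1,2) subset_trans[OF W'(3) W(3)] 1 2 3 by blast
qed

lemma smooth_along_map_points:
  assumes M: "charted M" and N: "charted N" and h: "smooth_map M (points M) N h"
    and V: "smooth_along P M f V"
  shows "smooth_along P N (\<lambda>y. h (f y)) (\<lambda>y. differential M (points M) N h (f y) (V y))"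
  by (rule smooth_along_map[OF M N h V smooth_alongD(1)[OF V] tangent_to_points[OF M smooth_alongD(1)[OF V]]])

text \<open>\<open>smooth_endo_field\<close> speaks of vectors with constant coordinates; linearity
  of \<open>N\<close> on each fibre extends this to arbitrary smooth fields.\<close>

lemma smooth_along_endo:
  assumes M: "charted M" and lin: "\<And>p. p \<in> points M \<Longrightarrow> linear (N p)"
    and sm: "smooth_endo_field M N" and V: "smooth_along P M f V"
  shows "smooth_along P M f (\<lambda>y. N (f y) (V y))"
  unfolding smooth_along_def
proof (intro ballI conjI)
  fix y assume y: "y \<in> P"
  show fy: "f y \<in> points M" using smooth_alongD(1)[OF V y] .
  let ?c = "chart_at M (f y)"
  note c = chartedD(6)[OF M fy]
  obtain W where W: "open W" "y \<in> W" "W \<subseteq> P" "f ` W \<subseteq> fst ?c"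
    "smooth_on W (\<lambda>z. snd ?c (f z))" "smooth_on W (\<lambda>z. to_chart M ?c (f z) (V z))"
    using smooth_alongD(2)[OF V y] by blast
  define A where "A = (\<lambda>x v. to_chart M ?c (chart_inv ?c x)
      (N (chart_inv ?c x) (from_chart M ?c (chart_inv ?c x) v)))"
  have A: "smooth_on (snd ?c ` fst ?c) (\<lambda>x. A x v)" for v
    using sm c unfolding smooth_endo_field_def A_def Let_def by blast
  have inv: "chart_inv ?c (snd ?c (f z)) = f z" if "z \<in> W" for z
    using chart_inv_f[OF M c] that W(4) by blast
  have "smooth_on W (\<lambda>z. A (snd ?c (f z)) (to_chart M ?c (f z) (V z)))"
  proof (rule smooth_on_apply[OF chartedD(1)[OF M] W(1) _ _ W(6)])
    show "linear (A (snd ?c (f x)))" if x: "x \<in> W" for x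
    proof -
      have fx: "f x \<in> fst ?c" using x W(4) by blast
      have fxM: "f x \<in> points M" using chartedD(2)[OF M c] fx by blast
      have "linear (to_chart M ?c (f x) \<circ> (N (f x) \<circ> from_chart M ?c (f x)))"
        by (intro linear_compose linear_to_chart[OF M c fx] linear_from_chart[OF M c fx] lin[OF fxM])
      then show ?thesis by (simp add: A_def inv[OF x] comp_def)
    qed
    show "smooth_on W (\<lambda>x. A (snd ?c (f x)) v)" for v
      by (rule smooth_on_compose[OF chartedD(1)[OF M] W(1) open_chart_image[OF M c] _ A W(5)])
         (use W(4) in blast)
  qed
  then have 1: "smooth_on W (\<lambda>z. to_chart M ?c (f z) (N (f z) (V z)))"
  proof (rule smooth_on_cong[OF W(1), rotated])
    fix z assume z: "z \<in> W"
    then have "f z \<in> fst ?c" using W(4) by blast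
    then show "A (snd ?c (f z)) (to_chart M ?c (f z) (V z)) = to_chart M ?c (f z) (N (f z) (V z))"
      by (simp add: A_def inv[OF z] from_to_chart[OF M c])
  qed
  show "\<exists>W. open W \<and> y \<in> W \<and> W \<subseteq> P \<and> f ` W \<subseteq> fst ?c \<and> smooth_on W (\<lambda>z. snd ?c (f z)) \<and>
      smooth_on W (\<lambda>z. to_chart M ?c (f z) (N (f z) (V z)))"
    using W 1 by blast
qed

lemma smooth_along_lincomb:
  assumes M: "charted M" and V: "smooth_along P M f V" and V': "smooth_along P M f V'"
  shows "smooth_along P M f (\<lambda>y. a *\<^sub>R V y + b *\<^sub>R V' y)"
  unfolding smooth_along_def
proof (intro ballI conjI)
  fix y assume y: "y \<in> P"
  show fy: "f y \<in> points M" using smooth_alongD(1)[OF V y] .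
  let ?c = "chart_at M (f y)"
  note c = chartedD(6)[OF M fy]
  obtain W where W: "open W" "y \<in> W" "W \<subseteq> P" "f ` W \<subseteq> fst ?c"
    "smooth_on W (\<lambda>z. snd ?c (f z))" "smooth_on W (\<lambda>z. to_chart M ?c (f z) (V z))"
    using smooth_alongD(2)[OF V y] by blast
  obtain W' where W': "open W'" "y \<in> W'" "smooth_on W' (\<lambda>z. to_chart M ?c (f z) (V' z))"
    using smooth_alongD(2)[OF V' y] by blast
  have o: "open (W \<inter> W')" using W(1) W'(1) by blast
  have "smooth_on (W \<inter> W') (\<lambda>z. a *\<^sub>R to_chart M ?c (f z) (V z) + b *\<^sub>R to_chart M ?c (f z) (V' z))"
    by (intro smooth_on_add[OF o] smooth_on_compose_linear[OF o bounded_linear_scaleR_right]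
        smooth_on_subset[OF W(6)] smooth_on_subset[OF W'(3)]) auto
  then have "smooth_on (W \<inter> W') (\<lambda>z. to_chart M ?c (f z) (a *\<^sub>R V z + b *\<^sub>R V' z))"
  proof (rule smooth_on_cong[OF o, rotated])
    fix z assume "z \<in> W \<inter> W'"
    then have "f z \<in> fst ?c" using W(4) by blast
    then show "a *\<^sub>R to_chart M ?c (f z) (V z) + b *\<^sub>R to_chart M ?c (f z) (V' z) =
        to_chart M ?c (f z) (a *\<^sub>R V z + b *\<^sub>R V' z)"
      using linear_to_chart[OF M c] by (simp add: linear_add linear_scale)
  qed
  then show "\<exists>W. open W \<and> y \<in> W \<and> W \<subseteq> P \<and> f ` W \<subseteq> fst ?c \<and> smooth_on W (\<lambda>z. snd ?c (f z)) \<and>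
      smooth_on W (\<lambda>z. to_chart M ?c (f z) (a *\<^sub>R V z + b *\<^sub>R V' z))"
    using o W(2) W'(2) W(3) W(4) smooth_on_subset[OF W(5), of "W \<inter> W'"]
    by (intro exI[of _ "W \<inter> W'"]) auto
qed

lemma smooth_along_Pair:
  assumes M: "charted M" and N: "charted N"
    and V: "smooth_along P M f V" and V': "smooth_along P N g V'"
  shows "smooth_along P (prod_manifold M N) (\<lambda>y. (f y, g y)) (\<lambda>y. (V y, V' y))"
  unfolding smooth_along_def
proof (intro ballI conjI)
  fix y assume y: "y \<in> P"
  have fy: "f y \<in> points M" using smooth_alongD(1)[OF V y] .
  have gy: "g y \<in> points N" using smooth_alongD(1)[OF V' y] .
  show "(f y, g y) \<in> points (prod_manifold M N)" using fy gy by simp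
  let ?c = "chart_at M (f y)" and ?d = "chart_at N (g y)"
  obtain W where W: "open W" "y \<in> W" "W \<subseteq> P" "f ` W \<subseteq> fst ?c"
    "smooth_on W (\<lambda>z. snd ?c (f z))" "smooth_on W (\<lambda>z. to_chart M ?c (f z) (V z))"
    using smooth_alongD(2)[OF V y] by blast
  obtain W' where W': "open W'" "y \<in> W'" "W' \<subseteq> P" "g ` W' \<subseteq> fst ?d"
    "smooth_on W' (\<lambda>z. snd ?d (g z))" "smooth_on W' (\<lambda>z. to_chart N ?d (g z) (V' z))"
    using smooth_alongD(2)[OF V' y] by blast
  let ?W = "W \<inter> W'"
  have o: "open ?W" using W(1) W'(1) by blast
  have 1: "smooth_on ?W (\<lambda>z. (snd ?c (f z), snd ?d (g z)))"
    by (intro smooth_on_Pair[OF o] smooth_on_subset[OF W(5)] smooth_on_subset[OF W'(5)]) auto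
  have "smooth_on ?W (\<lambda>z. (to_chart M ?c (f z) (V z), to_chart N ?d (g z) (V' z)))"
    by (intro smooth_on_Pair[OF o] smooth_on_subset[OF W(6)] smooth_on_subset[OF W'(6)]) auto
  then have 2: "smooth_on ?W (\<lambda>z. to_chart (prod_manifold M N) (prod_chart ?c ?d) (f z, g z) (V z, V' z))"
  proof (rule smooth_on_cong[OF o, rotated])
    fix z assume "z \<in> ?W"
    then have "f z \<in> fst ?c" "g z \<in> fst ?d" using W(4) W'(4) by blast+
    then show "(to_chart M ?c (f z) (V z), to_chart N ?d (g z) (V' z)) =
        to_chart (prod_manifold M N) (prod_chart ?c ?d) (f z, g z) (V z, V' z)"
      using to_chart_prod[OF M N chartedD(6)[OF M fy] _ chartedD(6)[OF N gy]] by simp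
  qed
  show "\<exists>W. open W \<and> y \<in> W \<and> W \<subseteq> P \<and>
      (\<lambda>y. (f y, g y)) ` W \<subseteq> fst (chart_at (prod_manifold M N) (f y, g y)) \<and>
      smooth_on W (\<lambda>z. snd (chart_at (prod_manifold M N) (f y, g y)) (f z, g z)) \<and>
      smooth_on W (\<lambda>z. to_chart (prod_manifold M N) (chart_at (prod_manifold M N) (f y, g y)) (f z, g z) (V z, V' z))"
    using o W(2,3,4) W'(2,4) 1 2 by (intro exI[of _ ?W]) auto
qed

text \<open>These are the constant-coefficient vector fields of the chart \<open>c\<close>. In the
  chart at a nearby point they are given by the Jacobian of a coordinate change, hence
  smooth.\<close>

lemma smooth_along_from_chart:
  assumes M: "charted M" and c: "c \<in> atlas M"
  shows "smooth_along (snd c ` fst c) M (chart_inv c) (\<lambda>y. from_chart M c (chart_inv c y) v)"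
  unfolding smooth_along_def
proof (intro ballI conjI)
  fix y assume "y \<in> snd c ` fst c"
  then obtain p where p: "p \<in> fst c" "y = snd c p" by blast
  have inv: "chart_inv c y = p" using chart_inv_f[OF M c p(1)] p(2) by simp
  have pM: "p \<in> points M" using chartedD(2)[OF M c] p(1) by blast
  then show "chart_inv c y \<in> points M" using inv by simp
  let ?d = "chart_at M p"
  note d = chartedD(6,7)[OF M pM]
  let ?W = "snd c ` (fst c \<inter> fst ?d)"
  have o: "open ?W" by (rule chartedD(4)[OF M c d(1)])
  have sm: "smooth_on ?W (snd ?d \<circ> chart_inv c)" by (rule chartedD(5)[OF M c d(1)])
  have "smooth_on ?W (\<lambda>z. to_chart M ?d (chart_inv c z) (from_chart M c (chart_inv c z) v))"
  proof (rule smooth_on_cong[OF o _ smooth_on_frechet_derivative[OF sm, of v]])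
    fix z assume "z \<in> ?W"
    then obtain q where q: "q \<in> fst c" "q \<in> fst ?d" "z = snd c q" by blast
    have qM: "q \<in> points M" using chartedD(2)[OF M c] q(1) by blast
    show "frechet_derivative (snd ?d \<circ> chart_inv c) (at z) v =
        to_chart M ?d (chart_inv c z) (from_chart M c (chart_inv c z) v)"
      using transition_trans[OF M c chartedD(6)[OF M qM] d(1) q(1) chartedD(7)[OF M qM] q(2)]
      by (simp add: q(3) chart_inv_f[OF M c q(1)] to_chart_def from_chart_def)
  qed
  moreover have "chart_inv c ` ?W \<subseteq> fst ?d" using chart_inv_f[OF M c] by auto
  ultimately show "\<exists>W. open W \<and> y \<in> W \<and> W \<subseteq> snd c ` fst c \<and>
      chart_inv c ` W \<subseteq> fst (chart_at M (chart_inv c y)) \<and>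
      smooth_on W (\<lambda>z. snd (chart_at M (chart_inv c y)) (chart_inv c z)) \<and>
      smooth_on W (\<lambda>z. to_chart M (chart_at M (chart_inv c y)) (chart_inv c z)
        (from_chart M c (chart_inv c z) v))"
    unfolding inv using o sm p d by (intro exI[of _ ?W]) (auto simp: comp_def)
qed

text \<open>Around each point the field is smooth in the chart chosen there, and the change from
  that chart to \<open>c\<close> has smooth coefficients.\<close>

lemma smooth_on_to_chart:
  assumes M: "charted M" and c: "c \<in> atlas M"
    and V: "smooth_along (snd c ` fst c) M (chart_inv c) V"
  shows "smooth_on (snd c ` fst c) (\<lambda>y. to_chart M c (chart_inv c y) (V y))"
proof (rule smooth_on_local)
  fix y assume y: "y \<in> snd c ` fst c"
  then obtain p where p: "p \<in> fst c" "y = snd c p" by blast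
  have inv: "chart_inv c y = p" using chart_inv_f[OF M c p(1)] p(2) by simp
  have pM: "p \<in> points M" using chartedD(2)[OF M c] p(1) by blast
  let ?d = "chart_at M p"
  note d = chartedD(6,7)[OF M pM]
  obtain W where W: "open W" "y \<in> W" "W \<subseteq> snd c ` fst c" "chart_inv c ` W \<subseteq> fst ?d"
    "smooth_on W (\<lambda>z. snd ?d (chart_inv c z))" "smooth_on W (\<lambda>z. to_chart M ?d (chart_inv c z) (V z))"
    using smooth_alongD(2)[OF V y] unfolding inv by blast
  have q: "chart_inv c z \<in> fst c" "chart_inv c z \<in> fst ?d" if "z \<in> W" for z
    using that W(3,4) inv_into_into[of z "snd c" "fst c"] by blast+
  define A where "A = (\<lambda>z. transition ?d c (chart_inv c z))"
  have "smooth_on W (\<lambda>z. A z (to_chart M ?d (chart_inv c z) (V z)))"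
  proof (rule smooth_on_apply[OF chartedD(1)[OF M] W(1) _ _ W(6)])
    show "linear (A z)" if "z \<in> W" for z
      unfolding A_def by (rule linear_transition[OF M d(1) c q(2,1)[OF that]])
    show "smooth_on W (\<lambda>z. A z v)" for v
      unfolding A_def
      by (rule smooth_on_compose[OF chartedD(1)[OF M] W(1) chartedD(4)[OF M d(1) c] _
            smooth_on_frechet_derivative[OF chartedD(5)[OF M d(1) c]] W(5)])
         (use q in auto)
  qed
  then have "smooth_on W (\<lambda>z. to_chart M c (chart_inv c z) (V z))"
  proof (rule smooth_on_cong[OF W(1), rotated])
    fix z assume z: "z \<in> W"
    let ?q = "chart_inv c z"
    have qM: "?q \<in> points M" using chartedD(2)[OF M c] q(1)[OF z] by blast
    show "A z (to_chart M ?d ?q (V z)) = to_chart M c ?q (V z)"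
      unfolding A_def to_chart_def
      by (rule transition_trans[OF M chartedD(6)[OF M qM] d(1) c chartedD(7)[OF M qM] q(2,1)[OF z]])
  qed
  then show "\<exists>U. open U \<and> y \<in> U \<and> smooth_on U (\<lambda>y. to_chart M c (chart_inv c y) (V y))"
    using W(1,2) by blast
qed

lemma smooth_endo_fieldI:
  assumes M: "charted M"
    and V: "\<And>c v. c \<in> atlas M \<Longrightarrow>
      smooth_along (snd c ` fst c) M (chart_inv c) (\<lambda>y. N (chart_inv c y) (from_chart M c (chart_inv c y) v))"
  shows "smooth_endo_field M N"
  unfolding smooth_endo_field_def Let_def using smooth_on_to_chart[OF M _ V] by blast

lemma smooth_endo_fieldD:
  assumes M: "charted M" and "\<And>p. p \<in> points M \<Longrightarrow> linear (N p)"
    and "smooth_endo_field M N" and c: "c \<in> atlas M"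
  shows "smooth_along (snd c ` fst c) M (chart_inv c) (\<lambda>y. N (chart_inv c y) (from_chart M c (chart_inv c y) v))"
  by (rule smooth_along_endo[OF assms(1-3) smooth_along_from_chart[OF M c]])

section \<open>The space of (1,1)-tensors\<close>

lemma tensors11D:
  assumes "N \<in> tensors11 M"
  shows "p \<in> points M \<Longrightarrow> linear (N p)" "p \<notin> points M \<Longrightarrow> N p = 0" "smooth_endo_field M N"
  using assms by (simp_all add: tensors11_def)

lemma tensors11I:
  assumes "\<And>p. p \<in> points M \<Longrightarrow> linear (N p)" "\<And>p. p \<notin> points M \<Longrightarrow> N p = 0" "smooth_endo_field M N"
  shows "N \<in> tensors11 M"
  using assms by (simp add: tensors11_def)

lemma tensors11_lincomb:
  assumes M: "charted M" and N: "N \<in> tensors11 M" and N': "N' \<in> tensors11 M"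
  shows "a *\<^sub>R N + b *\<^sub>R N' \<in> tensors11 M"
proof (rule tensors11I)
  show "smooth_endo_field M (a *\<^sub>R N + b *\<^sub>R N')"
  proof (rule smooth_endo_fieldI[OF M])
    fix c v assume c: "c \<in> atlas M"
    have "smooth_along (snd c ` fst c) M (chart_inv c) (\<lambda>y.
        a *\<^sub>R N (chart_inv c y) (from_chart M c (chart_inv c y) v) +
        b *\<^sub>R N' (chart_inv c y) (from_chart M c (chart_inv c y) v))"
      by (rule smooth_along_lincomb[OF M
            smooth_endo_fieldD[OF M tensors11D(1)[OF N] tensors11D(3)[OF N] c]
            smooth_endo_fieldD[OF M tensors11D(1)[OF N'] tensors11D(3)[OF N'] c]])
    then show "smooth_along (snd c ` fst c) M (chart_inv c)
        (\<lambda>y. (a *\<^sub>R N + b *\<^sub>R N') (chart_inv c y) (from_chart M c (chart_inv c y) v))"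
      by (simp add: scaleR_fun_def)
  qed
  show "linear ((a *\<^sub>R N + b *\<^sub>R N') p)" if "p \<in> points M" for p
    using tensors11D(1)[OF N that] tensors11D(1)[OF N' that]
    by (simp add: linear_iff scaleR_fun_def scaleR_add_right algebra_simps)
  show "(a *\<^sub>R N + b *\<^sub>R N') p = 0" if "p \<notin> points M" for p
    using tensors11D(2)[OF N that] tensors11D(2)[OF N' that] by (auto simp: scaleR_fun_def)
qed

lemma tensors11_zero:
  assumes M: "charted M"
  shows "0 \<in> tensors11 M"
proof -
  have "smooth_endo_field M 0"
  proof (rule smooth_endo_fieldI[OF M])
    fix c v assume c: "c \<in> atlas M"
    show "smooth_along (snd c ` fst c) M (chart_inv c) (\<lambda>y. 0 (chart_inv c y) (from_chart M c (chart_inv c y) v))"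
      using smooth_along_lincomb[OF M smooth_along_from_chart[OF M c] smooth_along_from_chart[OF M c],
          where a = 0 and b = 0] by simp
  qed
  then show ?thesis by (auto simp: tensors11_def linear_iff)
qed

lemma tensors11_comp:
  assumes M: "charted M" and N: "N \<in> tensors11 M" and N': "N' \<in> tensors11 M"
  shows "tensor_comp N N' \<in> tensors11 M"
proof (rule tensors11I)
  show "smooth_endo_field M (tensor_comp N N')"
  proof (rule smooth_endo_fieldI[OF M])
    fix c v assume c: "c \<in> atlas M"
    have "smooth_along (snd c ` fst c) M (chart_inv c)
        (\<lambda>y. N (chart_inv c y) (N' (chart_inv c y) (from_chart M c (chart_inv c y) v)))"
      by (rule smooth_along_endo[OF M tensors11D(1)[OF N] tensors11D(3)[OF N]
            smooth_endo_fieldD[OF M tensors11D(1)[OF N'] tensors11D(3)[OF N'] c]])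
    then show "smooth_along (snd c ` fst c) M (chart_inv c)
        (\<lambda>y. tensor_comp N N' (chart_inv c y) (from_chart M c (chart_inv c y) v))"
      by (simp add: tensor_comp_def)
  qed
  show "linear (tensor_comp N N' p)" if "p \<in> points M" for p
    unfolding tensor_comp_def
    by (rule linear_compose[OF tensors11D(1)[OF N' that] tensors11D(1)[OF N that]])
  show "tensor_comp N N' p = 0" if "p \<notin> points M" for p
    using tensors11D(2)[OF N that] by (auto simp: tensor_comp_def)
qed

lemma tensors11_id:
  assumes M: "charted M"
  shows "tensor_id M \<in> tensors11 M"
proof -
  have "smooth_endo_field M (tensor_id M)"
  proof (rule smooth_endo_fieldI[OF M])
    fix c v assume c: "c \<in> atlas M"
    show "smooth_along (snd c ` fst c) M (chart_inv c)
        (\<lambda>y. tensor_id M (chart_inv c y) (from_chart M c (chart_inv c y) v))"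
      by (rule smooth_along_cong[OF smooth_along_from_chart[OF M c]])
         (use smooth_alongD(1)[OF smooth_along_from_chart[OF M c]] in \<open>auto simp: tensor_id_def\<close>)
  qed
  then show ?thesis by (auto simp: tensors11_def tensor_id_def linear_iff)
qed

section \<open>The tangent groupoid\<close>

text \<open>Meant for inclusions of slices: their coordinate expressions \<open>\<iota> q\<close>
  are affine, hence smooth on the whole model space.\<close>

lemma smooth_map_precompose:
  fixes M :: "('a, 'e::real_normed_vector) manifold" and Q :: "('b, 'f::real_normed_vector) manifold"
  assumes M: "charted M" and Q: "charted Q" and f: "smooth_map Q S N f"
    and T: "T \<subseteq> points M" "i ` T \<subseteq> S"
    and \<iota>: "\<And>q. q \<in> T \<Longrightarrow> smooth_on UNIV (\<iota> q)"
      "\<And>q x. q \<in> T \<Longrightarrow> x \<in> T \<Longrightarrow> x \<in> fst (chart_at M q) \<Longrightarrow>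
        i x \<in> fst (chart_at Q (i q)) \<and> snd (chart_at Q (i q)) (i x) = \<iota> q (snd (chart_at M q) x)"
  shows "smooth_map M T N (\<lambda>q. f (i q))"
  unfolding smooth_map_def
proof (intro conjI ballI)
  show "T \<subseteq> points M" "(\<lambda>q. f (i q)) ` T \<subseteq> points N" using smooth_mapD(2)[OF f] T by blast+
  fix q assume q: "q \<in> T"
  then have iq: "i q \<in> S" and qc: "q \<in> fst (chart_at M q)" using T chartedD(7)[OF M] by auto
  let ?c = "chart_at M q" and ?d = "chart_at Q (i q)"
  obtain O' F where F: "open O'" "snd ?d (i q) \<in> O'" "smooth_on O' F"
    "\<And>x. x \<in> S \<inter> fst ?d \<Longrightarrow> snd ?d x \<in> O' \<Longrightarrow>
      f x \<in> fst (chart_at N (f (i q))) \<and> F (snd ?d x) = snd (chart_at N (f (i q))) (f x)"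
    using smooth_mapD(3)[OF f iq] by blast
  have o: "open (\<iota> q -` O')" using open_vimage[OF F(1) smooth_on_continuous_on[OF \<iota>(1)[OF q]]] .
  have "smooth_on (\<iota> q -` O') (\<lambda>y. F (\<iota> q y))"
    by (rule smooth_on_compose[OF chartedD(1)[OF Q] o F(1) _ F(3) smooth_on_subset[OF \<iota>(1)[OF q]]]) auto
  moreover have "f (i x) \<in> fst (chart_at N (f (i q))) \<and> F (\<iota> q (snd ?c x)) = snd (chart_at N (f (i q))) (f (i x))"
    if "x \<in> T" "x \<in> fst ?c" "snd ?c x \<in> \<iota> q -` O'" for x
    using F(4)[of "i x"] \<iota>(2)[OF q that(1,2)] that T(2) by auto
  ultimately show "\<exists>O' F. open O' \<and> snd ?c q \<in> O' \<and> smooth_on O' F \<and>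
      (\<forall>x\<in>T \<inter> fst ?c. snd ?c x \<in> O' \<longrightarrow>
        f (i x) \<in> fst (chart_at N (f (i q))) \<and> F (snd ?c x) = snd (chart_at N (f (i q))) (f (i x)))"
    using o F(2) \<iota>(2)[OF q q qc] by (intro exI[of _ "\<iota> q -` O'"] exI[of _ "\<lambda>y. F (\<iota> q y)"]) simp
qed

text \<open>Applied to the multiplication, this makes translation by a fixed arrow smooth on a
  source or target fibre.\<close>

lemma smooth_map_section:
  assumes M: "charted M" and M': "charted M'" and f: "smooth_map (prod_manifold M M') S N f"
  shows "p \<in> points M \<Longrightarrow> smooth_map M' {q. (p, q) \<in> S} N (\<lambda>q. f (p, q))"
    and "q \<in> points M' \<Longrightarrow> smooth_map M {p. (p, q) \<in> S} N (\<lambda>p. f (p, q))"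
proof -
  note lin = smooth_on_bounded_linear[OF open_UNIV bounded_linear_ident]
  show "smooth_map M' {q. (p, q) \<in> S} N (\<lambda>q. f (p, q))" if "p \<in> points M"
    by (rule smooth_map_precompose[OF M' charted_prod[OF M M'] f, where \<iota> = "\<lambda>_ y. (snd (chart_at M p) p, y)"])
       (use smooth_mapD(1)[OF f] chartedD(7)[OF M that] in
        \<open>auto intro: smooth_on_Pair[OF open_UNIV smooth_on_const lin]\<close>)
  show "smooth_map M {p. (p, q) \<in> S} N (\<lambda>p. f (p, q))" if "q \<in> points M'"
    by (rule smooth_map_precompose[OF M charted_prod[OF M M'] f, where \<iota> = "\<lambda>_ y. (y, snd (chart_at M' q) q)"])
       (use smooth_mapD(1)[OF f] chartedD(7)[OF M' that] in
        \<open>auto intro: smooth_on_Pair[OF open_UNIV lin smooth_on_const]\<close>)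
qed

section \<open>Algebra of a Lie groupoid and linearity of its differentials\<close>

locale lie_gpd =
  fixes G :: "('g, 'm, 'e::real_normed_vector, 'f::real_normed_vector) lie_groupoid_data"
  assumes lie: "lie_groupoid G"
begin

lemma charted_arrows: "charted (arrows G)"
  and charted_objects: "charted (objects G)"
  using lie by (auto simp: lie_groupoid_def smooth_manifold_def intro: smooth_structure_charted)

lemmas charted_arrows2 = charted_prod[OF charted_arrows charted_arrows]

lemma smooth_src: "smooth_map (arrows G) (Arr G) (objects G) (src G)"
  and smooth_tgt: "smooth_map (arrows G) (Arr G) (objects G) (tgt G)"
  and smooth_gunit: "smooth_map (objects G) (Obj G) (arrows G) (gunit G)"
  and smooth_ginv: "smooth_map (arrows G) (Arr G) (arrows G) (ginv G)"
  and smooth_mul: "smooth_map (prod_manifold (arrows G) (arrows G)) (composable G) (arrows G) (\<lambda>(g, h). mul G g h)"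
  and surj_dsrc: "g \<in> Arr G \<Longrightarrow> surj (dsrc G g)"
  and surj_dtgt: "g \<in> Arr G \<Longrightarrow> surj (dtgt G g)"
  and gpd: "groupoid G"
  using lie by (simp_all add: lie_groupoid_def)

lemma composable_iff [simp]: "(g, h) \<in> composable G \<longleftrightarrow> g \<in> Arr G \<and> h \<in> Arr G \<and> src G g = tgt G h"
  by (simp add: composable_def)

lemma gpd_simps [simp]:
  "g \<in> Arr G \<Longrightarrow> src G g \<in> Obj G" "g \<in> Arr G \<Longrightarrow> tgt G g \<in> Obj G" "g \<in> Arr G \<Longrightarrow> ginv G g \<in> Arr G"
  "x \<in> Obj G \<Longrightarrow> gunit G x \<in> Arr G" "x \<in> Obj G \<Longrightarrow> src G (gunit G x) = x" "x \<in> Obj G \<Longrightarrow> tgt G (gunit G x) = x"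
  "g \<in> Arr G \<Longrightarrow> mul G (gunit G (tgt G g)) g = g" "g \<in> Arr G \<Longrightarrow> mul G g (gunit G (src G g)) = g"
  "g \<in> Arr G \<Longrightarrow> src G (ginv G g) = tgt G g" "g \<in> Arr G \<Longrightarrow> tgt G (ginv G g) = src G g"
  "g \<in> Arr G \<Longrightarrow> mul G g (ginv G g) = gunit G (tgt G g)"
  "g \<in> Arr G \<Longrightarrow> mul G (ginv G g) g = gunit G (src G g)"
  using gpd unfolding groupoid_def by blast+

lemma mul_gunit [simp]:
  "g \<in> Arr G \<Longrightarrow> src G g = x \<Longrightarrow> mul G g (gunit G x) = g"
  "g \<in> Arr G \<Longrightarrow> tgt G g = x \<Longrightarrow> mul G (gunit G x) g = g"
  by auto

lemma mul_simps [simp]: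
  assumes "g \<in> Arr G" "h \<in> Arr G" "src G g = tgt G h"
  shows "mul G g h \<in> Arr G" "src G (mul G g h) = src G h" "tgt G (mul G g h) = tgt G g"
proof -
  have "\<forall>(g, h)\<in>composable G. mul G g h \<in> Arr G \<and> src G (mul G g h) = src G h \<and> tgt G (mul G g h) = tgt G g"
    using gpd unfolding groupoid_def by blast
  then show "mul G g h \<in> Arr G" "src G (mul G g h) = src G h" "tgt G (mul G g h) = tgt G g"
    using assms composable_iff by blast+
qed

lemma mul_assoc:
  assumes "g \<in> Arr G" "h \<in> Arr G" "k \<in> Arr G" "src G g = tgt G h" "src G h = tgt G k"
  shows "mul G (mul G g h) k = mul G g (mul G h k)"
proof -
  have "\<forall>g h k. (g, h) \<in> composable G \<and> (h, k) \<in> composable G \<longrightarrow> mul G (mul G g h) k = mul G g (mul G h k)"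
    using gpd unfolding groupoid_def by blast
  then show ?thesis using assms composable_iff by blast
qed

lemma mul_mul_inv:
  assumes "g \<in> Arr G" "h \<in> Arr G" "src G g = tgt G h"
  shows "mul G (mul G g h) (ginv G h) = g"
  using mul_assoc[of g h "ginv G h"] assms gpd_simps(8)[of g] by simp

lemma ginv_gunit [simp]: "x \<in> Obj G \<Longrightarrow> ginv G (gunit G x) = gunit G x"
  using gpd_simps(7)[of "ginv G (gunit G x)"] gpd_simps(11)[of "gunit G x"] by simp

lemma linear_dsrc: "g \<in> Arr G \<Longrightarrow> linear (dsrc G g)"
  and linear_dtgt: "g \<in> Arr G \<Longrightarrow> linear (dtgt G g)"
  and linear_dinv: "g \<in> Arr G \<Longrightarrow> linear (dinv G g)"
  and linear_dunit: "x \<in> Obj G \<Longrightarrow> linear (dunit G x)"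
  unfolding dsrc_def dtgt_def dinv_def dunit_def
  using linear_differential[OF charted_arrows smooth_src]
    linear_differential[OF charted_arrows smooth_tgt]
    linear_differential[OF charted_arrows smooth_ginv]
    linear_differential[OF charted_objects smooth_gunit] by blast+

lemma linear_tangent_mul:
  assumes "(g, h) \<in> composable G"
  shows "linear (\<lambda>(X, Y). tangent_mul G g h X Y)"
  using linear_differential[OF charted_arrows2 smooth_mul assms]
  by (simp add: tangent_mul_def case_prod_beta)

lemma tangent_mul_add:
  assumes "g \<in> Arr G" "h \<in> Arr G" "src G g = tgt G h"
  shows "tangent_mul G g h (X + X') (Y + Y') = tangent_mul G g h X Y + tangent_mul G g h X' Y'"
  using linear_add[OF linear_tangent_mul, of g h "(X, Y)" "(X', Y')"] assms by simp

lemma tangent_mul_scaleR: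
  assumes "g \<in> Arr G" "h \<in> Arr G" "src G g = tgt G h"
  shows "tangent_mul G g h (r *\<^sub>R X) (r *\<^sub>R Y) = r *\<^sub>R tangent_mul G g h X Y"
  using linear_scale[OF linear_tangent_mul, of g h r "(X, Y)"] assms by simp

lemma tangent_mul_diff:
  assumes "g \<in> Arr G" "h \<in> Arr G" "src G g = tgt G h"
  shows "tangent_mul G g h (X - X') (Y - Y') = tangent_mul G g h X Y - tangent_mul G g h X' Y'"
  using linear_diff[OF linear_tangent_mul, of g h "(X, Y)" "(X', Y')"] assms by simp

lemma tangent_mul_minus:
  assumes "g \<in> Arr G" "h \<in> Arr G" "src G g = tgt G h"
  shows "tangent_mul G g h (- X) (- Y) = - tangent_mul G g h X Y"
  using linear_neg[OF linear_tangent_mul, of g h "(X, Y)"] assms by simp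

lemma tangent_mul_zero:
  assumes "g \<in> Arr G" "h \<in> Arr G" "src G g = tgt G h"
  shows "tangent_mul G g h 0 0 = 0"
  using linear_0[OF linear_tangent_mul, of g h] assms by (simp add: zero_prod_def)

section \<open>Velocities of arrows and of composable pairs\<close>

lemma velocity_arrow_exists:
  assumes "g \<in> Arr G"
  obtains c where "velocity (arrows G) g c X"
  using velocity_exists[OF charted_arrows assms] by blast

lemma velocity_src:
  assumes "g \<in> Arr G" "velocity (arrows G) g c X"
  shows "velocity (objects G) (src G g) (\<lambda>n. src G (c n)) (dsrc G g X)"
  unfolding dsrc_def by (rule velocity_map_points[OF charted_arrows smooth_src assms])

lemma velocity_tgt:
  assumes "g \<in> Arr G" "velocity (arrows G) g c X"
  shows "velocity (objects G) (tgt G g) (\<lambda>n. tgt G (c n)) (dtgt G g X)"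
  unfolding dtgt_def by (rule velocity_map_points[OF charted_arrows smooth_tgt assms])

lemma velocity_ginv:
  assumes "g \<in> Arr G" "velocity (arrows G) g c X"
  shows "velocity (arrows G) (ginv G g) (\<lambda>n. ginv G (c n)) (dinv G g X)"
  unfolding dinv_def by (rule velocity_map_points[OF charted_arrows smooth_ginv assms])

lemma velocity_gunit:
  assumes "x \<in> Obj G" "velocity (objects G) x c v"
  shows "velocity (arrows G) (gunit G x) (\<lambda>n. gunit G (c n)) (dunit G x v)"
  unfolding dunit_def by (rule velocity_map_points[OF charted_objects smooth_gunit assms])

lemma velocity_mul:
  assumes "g \<in> Arr G" "h \<in> Arr G" "src G g = tgt G h"
    "velocity (arrows G) g c X" "velocity (arrows G) h d Y" "\<forall>\<^sub>F n in sequentially. src G (c n) = tgt G (d n)"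
  shows "velocity (arrows G) (mul G g h) (\<lambda>n. mul G (c n) (d n)) (tangent_mul G g h X Y)"
proof -
  have "velocity (prod_manifold (arrows G) (arrows G)) (g, h) (\<lambda>n. (c n, d n)) (X, Y)"
    using assms(4,5) by (simp add: vel_in_prod_chart)
  moreover have "\<forall>\<^sub>F n in sequentially. (c n, d n) \<in> composable G"
    using velocity_in_points[OF charted_arrows assms(1,4)]
      velocity_in_points[OF charted_arrows assms(2,5)] assms(6)
    by eventually_elim simp
  ultimately show ?thesis
    using velocity_map[OF charted_arrows2 smooth_mul, of "(g, h)" "\<lambda>n. (c n, d n)" "(X, Y)"] assms(1-3)
    by (simp only: tangent_mul_def composable_iff case_prod_conv simp_thms)
qed

lemma lift_src:
  assumes "g \<in> Arr G" "velocity (objects G) (src G g) t (dsrc G g X)"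
  obtains c where "velocity (arrows G) g c X" "\<forall>\<^sub>F n in sequentially. c n \<in> Arr G \<and> src G (c n) = t n"
  using velocity_lift[OF charted_arrows charted_objects smooth_src assms(1)
      surj_dsrc[OF assms(1), unfolded dsrc_def] assms(2)[unfolded dsrc_def]] that .

lemma lift_tgt:
  assumes "g \<in> Arr G" "velocity (objects G) (tgt G g) t (dtgt G g X)"
  obtains c where "velocity (arrows G) g c X" "\<forall>\<^sub>F n in sequentially. c n \<in> Arr G \<and> tgt G (c n) = t n"
  using velocity_lift[OF charted_arrows charted_objects smooth_tgt assms(1)
      surj_dtgt[OF assms(1), unfolded dtgt_def] assms(2)[unfolded dtgt_def]] that .

lemma lift_composable_left:
  assumes "g \<in> Arr G" "h \<in> Arr G" "src G g = tgt G h" "dsrc G g X = dtgt G h Y" "velocity (arrows G) h d Y"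
  obtains c where "velocity (arrows G) g c X" "\<forall>\<^sub>F n in sequentially. c n \<in> Arr G \<and> src G (c n) = tgt G (d n)"
proof -
  have "velocity (objects G) (src G g) (\<lambda>n. tgt G (d n)) (dsrc G g X)"
    using velocity_tgt[OF assms(2,5)] assms(3,4) by simp
  then show thesis by (rule lift_src[OF assms(1)]) (rule that)
qed

lemma lift_composable_right:
  assumes "g \<in> Arr G" "h \<in> Arr G" "src G g = tgt G h" "dsrc G g X = dtgt G h Y" "velocity (arrows G) g c X"
  obtains d where "velocity (arrows G) h d Y" "\<forall>\<^sub>F n in sequentially. d n \<in> Arr G \<and> src G (c n) = tgt G (d n)"
proof -
  have "velocity (objects G) (tgt G h) (\<lambda>n. src G (c n)) (dtgt G h Y)"
    using velocity_src[OF assms(1,5)] assms(3,4) by simp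
  then show thesis by (rule lift_tgt[OF assms(2)]) (rule that, auto elim: eventually_mono)
qed

lemma velocity_composable_exists:
  assumes "g \<in> Arr G" "h \<in> Arr G" "src G g = tgt G h" "dsrc G g X = dtgt G h Y"
  obtains c d where "velocity (arrows G) g c X" "velocity (arrows G) h d Y"
    "\<forall>\<^sub>F n in sequentially. c n \<in> Arr G \<and> d n \<in> Arr G \<and> src G (c n) = tgt G (d n)"
proof -
  obtain d where d: "velocity (arrows G) h d Y" using velocity_arrow_exists[OF assms(2)] .
  obtain c where c: "velocity (arrows G) g c X" "\<forall>\<^sub>F n in sequentially. c n \<in> Arr G \<and> src G (c n) = tgt G (d n)"
    using lift_composable_left[OF assms d] .
  have "\<forall>\<^sub>F n in sequentially. c n \<in> Arr G \<and> d n \<in> Arr G \<and> src G (c n) = tgt G (d n)"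
    using c(2) velocity_in_points[OF charted_arrows assms(2) d] by eventually_elim simp
  then show thesis using that c(1) d by blast
qed

text \<open>\<open>tangent_mul\<close> is a differential within the composable pairs; this puts
  composable vectors among those on which its value is forced and depends smoothly on the base
  point.\<close>

lemma tangent_to_composable:
  assumes "g \<in> Arr G" "h \<in> Arr G" "src G g = tgt G h" "dsrc G g X = dtgt G h Y"
  shows "tangent_to (prod_manifold (arrows G) (arrows G)) (composable G) (g, h) (X, Y)"
proof -
  obtain c d where cd: "velocity (arrows G) g c X" "velocity (arrows G) h d Y"
    "\<forall>\<^sub>F n in sequentially. c n \<in> Arr G \<and> d n \<in> Arr G \<and> src G (c n) = tgt G (d n)"
    using velocity_composable_exists[OF assms] .
  have "\<forall>\<^sub>F n in sequentially. (c n, d n) \<in> composable G" using cd(3) by eventually_elim simp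
  moreover have "velocity (prod_manifold (arrows G) (arrows G)) (g, h) (\<lambda>n. (c n, d n)) (X, Y)"
    using cd(1,2) by (simp add: vel_in_prod_chart)
  ultimately show ?thesis unfolding tangent_to_def by (intro exI[of _ "\<lambda>n. (c n, d n)"] conjI)
qed

lemma dsrc_tangent_mul:
  assumes "g \<in> Arr G" "h \<in> Arr G" "src G g = tgt G h" "dsrc G g X = dtgt G h Y"
  shows "dsrc G (mul G g h) (tangent_mul G g h X Y) = dsrc G h Y"
    and "dtgt G (mul G g h) (tangent_mul G g h X Y) = dtgt G g X"
proof -
  obtain c d where cd: "velocity (arrows G) g c X" "velocity (arrows G) h d Y"
    and ev: "\<forall>\<^sub>F n in sequentially. c n \<in> Arr G \<and> d n \<in> Arr G \<and> src G (c n) = tgt G (d n)"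
    using velocity_composable_exists[OF assms] .
  have "\<forall>\<^sub>F n in sequentially. src G (c n) = tgt G (d n)" using ev by eventually_elim simp
  note m = velocity_mul[OF assms(1-3) cd this]
  have gh: "mul G g h \<in> Arr G" using assms by simp
  have "\<forall>\<^sub>F n in sequentially. src G (mul G (c n) (d n)) = src G (d n)"
    using ev by eventually_elim simp
  from vel_in_cong[OF velocity_src[OF gh m] this]
  show "dsrc G (mul G g h) (tangent_mul G g h X Y) = dsrc G h Y"
    using velocity_src[OF assms(2) cd(2)] assms by (simp add: vel_in_unique)
  have "\<forall>\<^sub>F n in sequentially. tgt G (mul G (c n) (d n)) = tgt G (c n)"
    using ev by eventually_elim simp
  from vel_in_cong[OF velocity_tgt[OF gh m] this]
  show "dtgt G (mul G g h) (tangent_mul G g h X Y) = dtgt G g X"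
    using velocity_tgt[OF assms(1) cd(1)] assms by (simp add: vel_in_unique)
qed

section \<open>Units, inverses, associativity and division in the tangent groupoid\<close>

lemma dsrc_dunit:
  assumes "x \<in> Obj G"
  shows "dsrc G (gunit G x) (dunit G x v) = v" and "dtgt G (gunit G x) (dunit G x v) = v"
proof -
  obtain c where c: "velocity (objects G) x c v"
    using velocity_exists[OF charted_objects assms] by blast
  have ev: "\<forall>\<^sub>F n in sequentially. c n \<in> Obj G" by (rule velocity_in_points[OF charted_objects assms c])
  note u = velocity_gunit[OF assms c]
  have x: "gunit G x \<in> Arr G" using assms by simp
  have "\<forall>\<^sub>F n in sequentially. src G (gunit G (c n)) = c n" using ev by eventually_elim simp
  from vel_in_cong[OF velocity_src[OF x u] this] show "dsrc G (gunit G x) (dunit G x v) = v"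
    using c assms by (simp add: vel_in_unique)
  have "\<forall>\<^sub>F n in sequentially. tgt G (gunit G (c n)) = c n" using ev by eventually_elim simp
  from vel_in_cong[OF velocity_tgt[OF x u] this] show "dtgt G (gunit G x) (dunit G x v) = v"
    using c assms by (simp add: vel_in_unique)
qed

lemma dsrc_dinv:
  assumes "g \<in> Arr G"
  shows "dsrc G (ginv G g) (dinv G g X) = dtgt G g X" and "dtgt G (ginv G g) (dinv G g X) = dsrc G g X"
proof -
  obtain c where c: "velocity (arrows G) g c X" using velocity_arrow_exists[OF assms] .
  have ev: "\<forall>\<^sub>F n in sequentially. c n \<in> Arr G" by (rule velocity_in_points[OF charted_arrows assms c])
  note u = velocity_ginv[OF assms c]
  have i: "ginv G g \<in> Arr G" using assms by simp
  have "\<forall>\<^sub>F n in sequentially. src G (ginv G (c n)) = tgt G (c n)" using ev by eventually_elim simp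
  from vel_in_cong[OF velocity_src[OF i u] this] show "dsrc G (ginv G g) (dinv G g X) = dtgt G g X"
    using velocity_tgt[OF assms c] assms by (simp add: vel_in_unique)
  have "\<forall>\<^sub>F n in sequentially. tgt G (ginv G (c n)) = src G (c n)" using ev by eventually_elim simp
  from vel_in_cong[OF velocity_tgt[OF i u] this] show "dtgt G (ginv G g) (dinv G g X) = dsrc G g X"
    using velocity_src[OF assms c] assms by (simp add: vel_in_unique)
qed

lemma tangent_mul_dunit:
  assumes "g \<in> Arr G"
  shows "tangent_mul G g (gunit G (src G g)) X (dunit G (src G g) (dsrc G g X)) = X"
    and "tangent_mul G (gunit G (tgt G g)) g (dunit G (tgt G g) (dtgt G g X)) X = X"
proof -
  obtain c where c: "velocity (arrows G) g c X" using velocity_arrow_exists[OF assms] .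
  have ev: "\<forall>\<^sub>F n in sequentially. c n \<in> Arr G" by (rule velocity_in_points[OF charted_arrows assms c])
  have 1: "velocity (arrows G) (gunit G (src G g)) (\<lambda>n. gunit G (src G (c n))) (dunit G (src G g) (dsrc G g X))"
    using velocity_gunit[OF _ velocity_src[OF assms c]] assms by simp
  have e: "\<forall>\<^sub>F n in sequentially. src G (c n) = tgt G (gunit G (src G (c n)))"
    "\<forall>\<^sub>F n in sequentially. mul G (c n) (gunit G (src G (c n))) = c n"
    using ev by (eventually_elim, simp)+
  have "velocity (arrows G) (mul G g (gunit G (src G g))) c
      (tangent_mul G g (gunit G (src G g)) X (dunit G (src G g) (dsrc G g X)))"
    by (rule vel_in_cong[OF velocity_mul[OF assms _ _ c 1 e(1)] e(2)]) (use assms in auto)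
  then show "tangent_mul G g (gunit G (src G g)) X (dunit G (src G g) (dsrc G g X)) = X"
    using c assms by (simp add: vel_in_unique)
  have 2: "velocity (arrows G) (gunit G (tgt G g)) (\<lambda>n. gunit G (tgt G (c n))) (dunit G (tgt G g) (dtgt G g X))"
    using velocity_gunit[OF _ velocity_tgt[OF assms c]] assms by simp
  have e: "\<forall>\<^sub>F n in sequentially. src G (gunit G (tgt G (c n))) = tgt G (c n)"
    "\<forall>\<^sub>F n in sequentially. mul G (gunit G (tgt G (c n))) (c n) = c n"
    using ev by (eventually_elim, simp)+
  have "velocity (arrows G) (mul G (gunit G (tgt G g)) g) c
      (tangent_mul G (gunit G (tgt G g)) g (dunit G (tgt G g) (dtgt G g X)) X)"
    by (rule vel_in_cong[OF velocity_mul[OF _ assms _ 2 c e(1)] e(2)]) (use assms in auto)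
  then show "tangent_mul G (gunit G (tgt G g)) g (dunit G (tgt G g) (dtgt G g X)) X = X"
    using c assms by (simp add: vel_in_unique)
qed

lemma tangent_mul_dinv:
  assumes "g \<in> Arr G"
  shows "tangent_mul G g (ginv G g) X (dinv G g X) = dunit G (tgt G g) (dtgt G g X)"
    and "tangent_mul G (ginv G g) g (dinv G g X) X = dunit G (src G g) (dsrc G g X)"
proof -
  obtain c where c: "velocity (arrows G) g c X" using velocity_arrow_exists[OF assms] .
  have ev: "\<forall>\<^sub>F n in sequentially. c n \<in> Arr G" by (rule velocity_in_points[OF charted_arrows assms c])
  note i = velocity_ginv[OF assms c]
  have e: "\<forall>\<^sub>F n in sequentially. src G (c n) = tgt G (ginv G (c n))"
    "\<forall>\<^sub>F n in sequentially. src G (ginv G (c n)) = tgt G (c n)"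
    "\<forall>\<^sub>F n in sequentially. mul G (c n) (ginv G (c n)) = gunit G (tgt G (c n))"
    "\<forall>\<^sub>F n in sequentially. mul G (ginv G (c n)) (c n) = gunit G (src G (c n))"
    using ev by (eventually_elim, simp)+
  have "velocity (arrows G) (mul G g (ginv G g)) (\<lambda>n. gunit G (tgt G (c n)))
      (tangent_mul G g (ginv G g) X (dinv G g X))"
    by (rule vel_in_cong[OF velocity_mul[OF assms _ _ c i e(1)] e(3)]) (use assms in auto)
  then show "tangent_mul G g (ginv G g) X (dinv G g X) = dunit G (tgt G g) (dtgt G g X)"
    using velocity_gunit[OF _ velocity_tgt[OF assms c]] assms by (simp add: vel_in_unique)
  have "velocity (arrows G) (mul G (ginv G g) g) (\<lambda>n. gunit G (src G (c n)))
      (tangent_mul G (ginv G g) g (dinv G g X) X)"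
    by (rule vel_in_cong[OF velocity_mul[OF _ assms _ i c e(2)] e(4)]) (use assms in auto)
  then show "tangent_mul G (ginv G g) g (dinv G g X) X = dunit G (src G g) (dsrc G g X)"
    using velocity_gunit[OF _ velocity_src[OF assms c]] assms by (simp add: vel_in_unique)
qed

lemma tangent_mul_assoc:
  assumes a: "g \<in> Arr G" "h \<in> Arr G" "k \<in> Arr G" "src G g = tgt G h" "src G h = tgt G k"
    and XY: "dsrc G g X = dtgt G h Y" and YZ: "dsrc G h Y = dtgt G k Z"
  shows "tangent_mul G (mul G g h) k (tangent_mul G g h X Y) Z =
    tangent_mul G g (mul G h k) X (tangent_mul G h k Y Z)"
proof -
  \<comment> \<open>The middle factor is chosen first, so that each of its neighbours can be lifted
    to match it.\<close>
  obtain y where y: "velocity (arrows G) h y Y" using velocity_arrow_exists[OF a(2)] .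
  obtain x where x: "velocity (arrows G) g x X"
    and xy: "\<forall>\<^sub>F n in sequentially. x n \<in> Arr G \<and> src G (x n) = tgt G (y n)"
    using lift_composable_left[OF a(1,2,4) XY y] .
  obtain z where z: "velocity (arrows G) k z Z"
    and yz: "\<forall>\<^sub>F n in sequentially. z n \<in> Arr G \<and> src G (y n) = tgt G (z n)"
    using lift_composable_right[OF a(2,3,5) YZ y] .
  have yA: "\<forall>\<^sub>F n in sequentially. y n \<in> Arr G" by (rule velocity_in_points[OF charted_arrows a(2) y])
  have e: "\<forall>\<^sub>F n in sequentially. src G (x n) = tgt G (y n)"
    "\<forall>\<^sub>F n in sequentially. src G (y n) = tgt G (z n)"
    "\<forall>\<^sub>F n in sequentially. src G (mul G (x n) (y n)) = tgt G (z n)"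
    "\<forall>\<^sub>F n in sequentially. src G (x n) = tgt G (mul G (y n) (z n))"
    "\<forall>\<^sub>F n in sequentially. mul G (mul G (x n) (y n)) (z n) = mul G (x n) (mul G (y n) (z n))"
    using xy yz yA by (eventually_elim, simp add: mul_assoc)+
  have "velocity (arrows G) (mul G (mul G g h) k) (\<lambda>n. mul G (mul G (x n) (y n)) (z n))
      (tangent_mul G (mul G g h) k (tangent_mul G g h X Y) Z)"
    by (rule velocity_mul[OF _ a(3) _ velocity_mul[OF a(1,2,4) x y e(1)] z e(3)]) (use a in auto)
  from vel_in_cong[OF this e(5)]
  have "velocity (arrows G) (mul G g (mul G h k)) (\<lambda>n. mul G (x n) (mul G (y n) (z n)))
      (tangent_mul G (mul G g h) k (tangent_mul G g h X Y) Z)"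
    using mul_assoc[OF a] by simp
  moreover have "velocity (arrows G) (mul G g (mul G h k)) (\<lambda>n. mul G (x n) (mul G (y n) (z n)))
      (tangent_mul G g (mul G h k) X (tangent_mul G h k Y Z))"
    by (rule velocity_mul[OF a(1) _ _ x velocity_mul[OF a(2,3,5) y z e(2)] e(4)]) (use a in auto)
  ultimately show ?thesis by (rule vel_in_unique)
qed

text \<open>Division in the tangent groupoid: take any \<open>Y\<close> at \<open>h\<close> with the
  same source as \<open>Z\<close>, and let \<open>X\<close> be the product of \<open>Z\<close> with
  the inverse of \<open>Y\<close>.\<close>

lemma tangent_mul_surj:
  assumes a: "g \<in> Arr G" "h \<in> Arr G" "src G g = tgt G h"
  obtains X Y where "dsrc G g X = dtgt G h Y" "tangent_mul G g h X Y = Z"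
proof -
  obtain Y where Y: "dsrc G h Y = dsrc G (mul G g h) Z" using surj_dsrc[OF a(2)] by (metis surjD)
  have gh: "mul G g h \<in> Arr G" "ginv G h \<in> Arr G" "src G (mul G g h) = tgt G (ginv G h)" using a by simp_all
  have c: "dsrc G (mul G g h) Z = dtgt G (ginv G h) (dinv G h Y)" using dsrc_dinv(2)[OF a(2)] Y by simp
  define X where "X = tangent_mul G (mul G g h) (ginv G h) Z (dinv G h Y)"
  have "dsrc G g X = dtgt G h Y"
    using dsrc_tangent_mul(1)[OF gh c] dsrc_dinv(1)[OF a(2)] by (simp add: X_def mul_mul_inv[OF a])
  moreover have "tangent_mul G g h X Y = Z"
    using tangent_mul_assoc[OF gh(1,2) a(2) gh(3) _ c] a dsrc_dinv(1)[OF a(2)] gh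
      tangent_mul_dinv(2)[OF a(2), of Y] tangent_mul_dunit(1)[OF gh(1), of Z] Y
    by (simp add: X_def mul_mul_inv[OF a])
  ultimately show thesis by (rule that)
qed

section \<open>Left and right translates\<close>

lemma alg_fibreD: "u \<in> alg_fibre G x \<Longrightarrow> dsrc G (gunit G x) u = 0"
  by (simp add: alg_fibre_def)

lemma dinv_gunit_tangent:
  assumes "x \<in> Obj G" "u \<in> alg_fibre G x"
  shows "dtgt G (gunit G x) (dinv G (gunit G x) u) = 0"
    and "dsrc G (gunit G x) (dinv G (gunit G x) u) = dtgt G (gunit G x) u"
  using dsrc_dinv[of "gunit G x" u] assms alg_fibreD by simp_all

text \<open>A lift of the constant sequence at \<open>tgt g\<close> stays in the source fibre. Along
  it, right translation by \<open>g\<close> is multiplication by the constant sequence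
  \<open>g\<close>, whose velocity is 0.\<close>

lemma right_transl_eq:
  assumes g: "g \<in> Arr G" and u: "u \<in> alg_fibre G (tgt G g)"
  shows "right_transl G g u = tangent_mul G (gunit G (tgt G g)) g u 0"
proof -
  let ?x = "tgt G g" and ?S = "{k \<in> Arr G. src G k = tgt G g}"
  have x: "gunit G ?x \<in> Arr G" using g by simp
  have "velocity (objects G) (src G (gunit G ?x)) (\<lambda>_. ?x) (dsrc G (gunit G ?x) u)"
    using vel_in_const[OF chartedD(7)[OF charted_objects]] g alg_fibreD[OF u] by simp
  then obtain k where k: "velocity (arrows G) (gunit G ?x) k u"
    "\<forall>\<^sub>F n in sequentially. k n \<in> Arr G \<and> src G (k n) = ?x"
    by (rule lift_src[OF x])
  have "{k. (k, g) \<in> composable G} = ?S" using g by auto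
  then have "smooth_map (arrows G) ?S (arrows G) (\<lambda>k. mul G k g)"
    using smooth_map_section(2)[OF charted_arrows charted_arrows smooth_mul g] by simp
  from velocity_map[OF charted_arrows this _ k(1)]
  have "velocity (arrows G) (mul G (gunit G ?x) g) (\<lambda>n. mul G (k n) g) (right_transl G g u)"
    unfolding right_transl_def using g k(2) by simp
  moreover have "velocity (arrows G) (mul G (gunit G ?x) g) (\<lambda>n. mul G (k n) g)
      (tangent_mul G (gunit G ?x) g u 0)"
    by (rule velocity_mul[OF x g _ k(1) vel_in_const[OF chartedD(7)[OF charted_arrows g]]])
       (use g k(2) in \<open>auto elim: eventually_mono\<close>)
  ultimately show ?thesis by (rule vel_in_unique)
qed

lemma left_transl_eq:
  assumes g: "g \<in> Arr G" and u: "u \<in> alg_fibre G (src G g)"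
  shows "left_transl G g u = - tangent_mul G g (gunit G (src G g)) 0 (dinv G (gunit G (src G g)) u)"
proof -
  let ?x = "src G g" and ?S = "{k \<in> Arr G. tgt G k = src G g}"
  let ?w = "dinv G (gunit G ?x) u"
  have x: "gunit G ?x \<in> Arr G" using g by simp
  have "velocity (objects G) (tgt G (gunit G ?x)) (\<lambda>_. ?x) (dtgt G (gunit G ?x) ?w)"
    using vel_in_const[OF chartedD(7)[OF charted_objects]] g dinv_gunit_tangent(1)[OF _ u] by simp
  then obtain k where k: "velocity (arrows G) (gunit G ?x) k ?w"
    "\<forall>\<^sub>F n in sequentially. k n \<in> Arr G \<and> tgt G (k n) = ?x"
    by (rule lift_tgt[OF x])
  have "{k. (g, k) \<in> composable G} = ?S" using g by auto
  then have "smooth_map (arrows G) ?S (arrows G) (\<lambda>k. mul G g k)"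
    using smooth_map_section(1)[OF charted_arrows charted_arrows smooth_mul g] by simp
  from velocity_map[OF charted_arrows this _ k(1)]
  have "velocity (arrows G) (mul G g (gunit G ?x)) (\<lambda>n. mul G g (k n)) (- left_transl G g u)"
    unfolding left_transl_def using g k(2) by simp
  moreover have "velocity (arrows G) (mul G g (gunit G ?x)) (\<lambda>n. mul G g (k n))
      (tangent_mul G g (gunit G ?x) 0 ?w)"
    by (rule velocity_mul[OF g x _ vel_in_const[OF chartedD(7)[OF charted_arrows g]] k(1)])
       (use g k(2) in \<open>auto elim: eventually_mono\<close>)
  ultimately have "- left_transl G g u = tangent_mul G g (gunit G ?x) 0 ?w" by (rule vel_in_unique)
  then show ?thesis by (metis minus_minus)
qed

text \<open>Linearity on pairs splits the product of \<open>u\<close> and its inverse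
  \<open>w\<close> as \<open>u 0 + 0 w = u + w\<close>, while the product itself is the unit vector
  over \<open>dtgt u\<close>.\<close>

lemma dinv_alg_fibre:
  assumes x: "x \<in> Obj G" and u: "u \<in> alg_fibre G x"
  shows "dinv G (gunit G x) u = dunit G x (dtgt G (gunit G x) u) - u"
proof -
  let ?e = "gunit G x"
  have e: "?e \<in> Arr G" "src G ?e = x" "tgt G ?e = x" using x by simp_all
  have 0: "dunit G x 0 = 0" using linear_0[OF linear_dunit[OF x]] .
  have "tangent_mul G ?e ?e u (dinv G ?e u) = tangent_mul G ?e ?e u 0 + tangent_mul G ?e ?e 0 (dinv G ?e u)"
    using tangent_mul_add[OF e(1,1), of u 0 0 "dinv G ?e u"] e by simp
  moreover have "tangent_mul G ?e ?e u 0 = u"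
    using tangent_mul_dunit(1)[OF e(1), of u] e alg_fibreD[OF u] 0 by simp
  moreover have "tangent_mul G ?e ?e 0 (dinv G ?e u) = dinv G ?e u"
    using tangent_mul_dunit(2)[OF e(1), of "dinv G ?e u"] e dinv_gunit_tangent(1)[OF x u] 0 by simp
  moreover have "tangent_mul G ?e ?e u (dinv G ?e u) = dunit G x (dtgt G ?e u)"
    using tangent_mul_dinv(1)[OF e(1), of u] e x by simp
  ultimately show ?thesis by (metis add_diff_cancel_left')
qed

lemma dsrc_right_transl:
  assumes g: "g \<in> Arr G" and u: "u \<in> alg_fibre G (tgt G g)"
  shows "dsrc G g (right_transl G g u) = 0" "dtgt G g (right_transl G g u) = dtgt G (gunit G (tgt G g)) u"
proof -
  have c: "dsrc G (gunit G (tgt G g)) u = dtgt G g 0"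
    using alg_fibreD[OF u] linear_0[OF linear_dtgt[OF g]] by simp
  show "dsrc G g (right_transl G g u) = 0" "dtgt G g (right_transl G g u) = dtgt G (gunit G (tgt G g)) u"
    using dsrc_tangent_mul[OF _ g _ c] g linear_0[OF linear_dsrc[OF g]] by (simp_all add: right_transl_eq[OF g u])
qed

lemma dsrc_left_transl:
  assumes g: "g \<in> Arr G" and u: "u \<in> alg_fibre G (src G g)"
  shows "dsrc G g (left_transl G g u) = - dtgt G (gunit G (src G g)) u" "dtgt G g (left_transl G g u) = 0"
proof -
  have x: "src G g \<in> Obj G" using g by simp
  have c: "dsrc G g 0 = dtgt G (gunit G (src G g)) (dinv G (gunit G (src G g)) u)"
    using dinv_gunit_tangent(1)[OF x u] linear_0[OF linear_dsrc[OF g]] by simp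
  show "dsrc G g (left_transl G g u) = - dtgt G (gunit G (src G g)) u" "dtgt G g (left_transl G g u) = 0"
    using dsrc_tangent_mul[OF g _ _ c] g linear_0[OF linear_dtgt[OF g]] dinv_gunit_tangent(2)[OF x u]
    by (simp_all add: left_transl_eq[OF g u] linear_neg[OF linear_dsrc[OF g]] linear_neg[OF linear_dtgt[OF g]])
qed

text \<open>Let \<open>w\<close> be the inverse of \<open>u\<close>. Up to one common sign the two
  factors are \<open>0 w\<close> and \<open>u 0\<close>, and associativity gives
  \<open>(0 w)(u 0) = 0 ((w u) 0)\<close>, where \<open>w u\<close> is the unit over
  \<open>dsrc u = 0\<close>, that is, zero.\<close>

lemma tangent_mul_left_right_transl:
  assumes a: "g \<in> Arr G" "h \<in> Arr G" "src G g = tgt G h" and u: "u \<in> alg_fibre G (src G g)"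
  shows "tangent_mul G g h (left_transl G g u) (- right_transl G h u) = 0"
proof -
  let ?x = "src G g"
  let ?e = "gunit G ?x"
  let ?w = "dinv G ?e u"
  have x: "?x \<in> Obj G" using a by simp
  have e: "?e \<in> Arr G" "src G ?e = ?x" "tgt G ?e = ?x" using x by simp_all
  have uh: "u \<in> alg_fibre G (tgt G h)" using u a(3) by simp
  note z = linear_0[OF linear_dsrc[OF a(1)]] linear_0[OF linear_dtgt[OF a(2)]]
  note w = dinv_gunit_tangent[OF x u] alg_fibreD[OF u]
  have R: "right_transl G h u = tangent_mul G ?e h u 0" using right_transl_eq[OF a(2) uh] a(3) by simp
  have R': "dtgt G h (tangent_mul G ?e h u 0) = dtgt G ?e u"
    using dsrc_tangent_mul(2)[OF e(1) a(2), of u 0] e a w z by simp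
  have "tangent_mul G g h (tangent_mul G g ?e 0 ?w) (tangent_mul G ?e h u 0) =
      tangent_mul G g h 0 (tangent_mul G ?e h ?w (tangent_mul G ?e h u 0))"
    using tangent_mul_assoc[OF a(1) e(1) a(2), of 0 ?w "tangent_mul G ?e h u 0"] a e w z R' by simp
  also have "tangent_mul G ?e h ?w (tangent_mul G ?e h u 0) = tangent_mul G ?e h (tangent_mul G ?e ?e ?w u) 0"
    using tangent_mul_assoc[OF e(1) e(1) a(2), of ?w u 0] a e w z x by simp
  also have "tangent_mul G ?e ?e ?w u = 0"
    using tangent_mul_dinv(2)[OF e(1), of u] x w linear_0[OF linear_dunit[OF x]] by simp
  finally have "tangent_mul G g h (tangent_mul G g ?e 0 ?w) (tangent_mul G ?e h u 0) = 0"
    using tangent_mul_zero[OF e(1) a(2)] tangent_mul_zero[OF a] a e by simp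
  then show ?thesis
    using tangent_mul_minus[OF a, of "tangent_mul G g ?e 0 ?w" "tangent_mul G ?e h u 0"]
    by (simp add: left_transl_eq[OF a(1) u] R)
qed

text \<open>Translating \<open>Y\<close> back to the unit gives \<open>W = Y 0\<close>, a vector in
  \<open>A\<close> with \<open>Y = W 0\<close>. From \<open>X Y = 0\<close> follows
  \<open>X W = 0\<close>, so \<open>X = X (W W') = 0 W'\<close> for the inverse \<open>W'\<close> of
  \<open>W\<close>. The required element of \<open>A\<close> is \<open>- W\<close>, the sign coming
  from the definition of the left translate.\<close>

lemma tangent_mul_kernel:
  assumes a: "g \<in> Arr G" "h \<in> Arr G" "src G g = tgt G h"
    and XY: "dsrc G g X = dtgt G h Y" and m: "tangent_mul G g h X Y = 0"
  obtains u where "u \<in> alg_fibre G (src G g)" "X = left_transl G g u" "Y = - right_transl G h u"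
proof -
  let ?x = "src G g"
  let ?e = "gunit G ?x" and ?i = "ginv G h"
  have x: "?x \<in> Obj G" using a by simp
  have e: "?e \<in> Arr G" "src G ?e = ?x" "tgt G ?e = ?x" using x by simp_all
  have i: "?i \<in> Arr G" "src G ?i = ?x" "tgt G ?i = src G h" "mul G h ?i = ?e" "mul G ?i h = gunit G (src G h)"
    using a by simp_all
  note z = linear_0[OF linear_dsrc[OF i(1)]] linear_0[OF linear_dtgt[OF i(1)]] linear_0[OF linear_dtgt[OF a(2)]]
    linear_0[OF linear_dsrc[OF a(1)]]
  have gh: "mul G g h \<in> Arr G" using a by simp
  have Y0: "dsrc G h Y = 0"
    using dsrc_tangent_mul(1)[OF a XY] m linear_0[OF linear_dsrc[OF gh]] by simp
  define W where "W = tangent_mul G h ?i Y 0"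
  have W: "dsrc G ?e W = 0" "dtgt G ?e W = dsrc G g X"
    using dsrc_tangent_mul[OF a(2) i(1), of Y 0] i z Y0 XY by (simp_all add: W_def)
  have mW: "- W \<in> alg_fibre G ?x"
    using W(1) linear_neg[OF linear_dsrc[OF e(1)]] by (simp add: alg_fibre_def)
  have "tangent_mul G ?e h W 0 = tangent_mul G h (gunit G (src G h)) Y (tangent_mul G ?i h 0 0)"
    using tangent_mul_assoc[OF a(2) i(1) a(2), of Y 0 0] i z Y0 a by (simp add: W_def)
  also have "\<dots> = Y"
    using tangent_mul_dunit(1)[OF a(2), of Y] tangent_mul_zero[OF i(1) a(2)] i a Y0
      linear_0[OF linear_dunit[of "src G h"]] by simp
  finally have WY: "tangent_mul G ?e h W 0 = Y" .
  have "right_transl G h (- W) = tangent_mul G ?e h (- W) (- 0)"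
    using right_transl_eq[OF a(2), of "- W"] mW a(3) by simp
  also have "\<dots> = - Y" using tangent_mul_minus[OF e(1) a(2), of W 0] a e WY by simp
  finally have R: "Y = - right_transl G h (- W)" by simp
  have "tangent_mul G g ?e X W = tangent_mul G (mul G g h) ?i (tangent_mul G g h X Y) 0"
    using tangent_mul_assoc[OF a(1,2) i(1), of X Y 0] i z Y0 a XY by (simp add: W_def)
  also have "\<dots> = 0" using m tangent_mul_zero[OF gh i(1)] a i by simp
  finally have XW: "tangent_mul G g ?e X W = 0" .
  have dW: "dtgt G ?e (dinv G ?e W) = 0" using dsrc_dinv(2)[OF e(1), of W] W x by simp
  have "X = tangent_mul G g ?e X (dunit G ?x (dsrc G g X))" using tangent_mul_dunit(1)[OF a(1)] by simp
  also have "dunit G ?x (dsrc G g X) = tangent_mul G ?e ?e W (dinv G ?e W)"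
    using tangent_mul_dinv(1)[OF e(1), of W] x W by simp
  also have "tangent_mul G g ?e X (tangent_mul G ?e ?e W (dinv G ?e W)) =
      tangent_mul G g ?e (tangent_mul G g ?e X W) (dinv G ?e W)"
    using tangent_mul_assoc[OF a(1) e(1) e(1), of X W "dinv G ?e W"] e a x W dW by simp
  also have "\<dots> = tangent_mul G g ?e 0 (dinv G ?e W)" using XW by simp
  also have "\<dots> = - tangent_mul G g ?e (- 0) (- dinv G ?e W)"
    using tangent_mul_minus[OF a(1) e(1), of 0 "dinv G ?e W"] e by simp
  also have "\<dots> = left_transl G g (- W)"
    using left_transl_eq[OF a(1) mW] linear_neg[OF linear_dinv[OF e(1)]] by simp
  finally show thesis using that[OF mW _ R] by blast
qed

end

lemma subspace_separating_functional:
  fixes K :: "'a::real_vector set"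
  assumes "subspace K" "x \<notin> K"
  obtains f :: "'a \<Rightarrow> real" where "linear f" "\<And>k. k \<in> K \<Longrightarrow> f k = 0" "f x = 1"
proof -
  obtain B where B: "B \<subseteq> K" "independent B" "K \<subseteq> span B"
    using maximal_independent_subset[of K] by blast
  have x: "x \<notin> span B" using assms span_minimal[OF B(1)] by blast
  have "independent (insert x B)" using B(2) x by (simp add: independent_insert)
  from linear_independent_extend[OF this, of "\<lambda>b. if b = x then 1 else 0"]
  obtain f :: "'a \<Rightarrow> real" where f: "linear f" "\<And>b. b \<in> insert x B \<Longrightarrow> f b = (if b = x then 1 else 0)"
    by blast
  have "f b = 0" if "b \<in> B" for b using f(2)[of b] that x span_base by auto
  then have "f k = 0" if "k \<in> K" for k
    using linear_eq_0_on_span[OF f(1), of B k] B(3) that by blast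
  then show thesis using that f by simp
qed

context lie_gpd
begin

section \<open>Affine tensors as maps that factor through the multiplication\<close>

lemma subspace_composable_vectors:
  assumes "g \<in> Arr G" "h \<in> Arr G"
  shows "subspace {(X, Y). dsrc G g X = dtgt G h Y}"
  using linear_dsrc[OF assms(1)] linear_dtgt[OF assms(2)]
  by (auto simp: subspace_def linear_add linear_scale linear_0 zero_prod_def)

lemma zero_in_alg_fibre: "x \<in> Obj G \<Longrightarrow> 0 \<in> alg_fibre G x"
  using linear_0[OF linear_dsrc] by (simp add: alg_fibre_def)

lemma linear_right_transl_formula:
  assumes "g \<in> Arr G"
  shows "linear (\<lambda>u. tangent_mul G (gunit G (tgt G g)) g u 0)"
proof -
  have "linear (\<lambda>u::'e. (u, 0::'e))" by (simp add: linear_iff)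
  from linear_compose[OF this linear_tangent_mul, of "gunit G (tgt G g)" g] show ?thesis
    using assms by (simp add: comp_def)
qed

lemma linear_left_transl_formula:
  assumes "g \<in> Arr G"
  shows "linear (\<lambda>u. - tangent_mul G g (gunit G (src G g)) 0 (dinv G (gunit G (src G g)) u))"
proof -
  have "linear (\<lambda>u::'e. (0::'e, u))" by (simp add: linear_iff)
  from linear_compose[OF linear_dinv linear_compose[OF this linear_tangent_mul],
      of "gunit G (src G g)" g "gunit G (src G g)"]
  have "linear (\<lambda>u. tangent_mul G g (gunit G (src G g)) 0 (dinv G (gunit G (src G g)) u))"
    using assms by (simp add: comp_def)
  then show ?thesis by (rule linear_compose_neg)
qed

lemma right_transl_zero: "g \<in> Arr G \<Longrightarrow> right_transl G g 0 = 0"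
  using right_transl_eq[OF _ zero_in_alg_fibre] linear_0[OF linear_right_transl_formula] by simp

lemma left_transl_zero: "g \<in> Arr G \<Longrightarrow> left_transl G g 0 = 0"
  using left_transl_eq[OF _ zero_in_alg_fibre] linear_0[OF linear_left_transl_formula] by simp

lemma right_transl_gunit:
  assumes "x \<in> Obj G" "u \<in> alg_fibre G x"
  shows "right_transl G (gunit G x) u = u"
  using right_transl_eq[of "gunit G x" u] tangent_mul_dunit(1)[of "gunit G x" u] assms
    alg_fibreD[OF assms(2)] linear_0[OF linear_dunit[OF assms(1)]] by simp

text \<open>The zero vector at the product is the product of zero vectors, so
  \<open>u 0 = u (0 0) = (u 0) 0\<close>.\<close>

lemma right_transl_mul:
  assumes a: "g \<in> Arr G" "h \<in> Arr G" "src G g = tgt G h" and u: "u \<in> alg_fibre G (tgt G g)"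
  shows "right_transl G (mul G g h) u = tangent_mul G g h (right_transl G g u) 0"
proof -
  let ?e = "gunit G (tgt G g)"
  have gh: "mul G g h \<in> Arr G" "tgt G (mul G g h) = tgt G g" using a by simp_all
  have e: "?e \<in> Arr G" "src G ?e = tgt G g" using a by simp_all
  have "right_transl G (mul G g h) u = tangent_mul G ?e (mul G g h) u (tangent_mul G g h 0 0)"
    using right_transl_eq[OF gh(1)] gh u tangent_mul_zero[OF a] by simp
  also have "\<dots> = tangent_mul G (mul G ?e g) h (tangent_mul G ?e g u 0) 0"
    using tangent_mul_assoc[OF e(1) a(1,2) e(2) a(3), of u 0 0] alg_fibreD[OF u]
      linear_0[OF linear_dsrc[OF a(1)]] linear_0[OF linear_dtgt[OF a(1)]] linear_0[OF linear_dtgt[OF a(2)]] by simp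
  also have "\<dots> = tangent_mul G g h (right_transl G g u) 0"
    using right_transl_eq[OF a(1) u] a by simp
  finally show ?thesis .
qed

lemma left_transl_mul:
  assumes a: "g \<in> Arr G" "h \<in> Arr G" "src G g = tgt G h" and u: "u \<in> alg_fibre G (src G h)"
  shows "left_transl G (mul G g h) u = tangent_mul G g h 0 (left_transl G h u)"
proof -
  let ?e = "gunit G (src G h)"
  let ?w = "dinv G ?e u"
  have gh: "mul G g h \<in> Arr G" "src G (mul G g h) = src G h" using a by simp_all
  have e: "?e \<in> Arr G" "src G h = tgt G ?e" using a by simp_all
  have "left_transl G (mul G g h) u = - tangent_mul G (mul G g h) ?e (tangent_mul G g h 0 0) ?w"
    using left_transl_eq[OF gh(1)] gh u tangent_mul_zero[OF a] by simp
  also have "tangent_mul G (mul G g h) ?e (tangent_mul G g h 0 0) ?w =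
      tangent_mul G g (mul G h ?e) 0 (tangent_mul G h ?e 0 ?w)"
    using tangent_mul_assoc[OF a(1,2) e(1) a(3) e(2), of 0 0 ?w] dinv_gunit_tangent(1)[OF _ u] a
      linear_0[OF linear_dsrc[OF a(1)]] linear_0[OF linear_dtgt[OF a(2)]] linear_0[OF linear_dsrc[OF a(2)]] by simp
  also have "\<dots> = tangent_mul G g h 0 (- left_transl G h u)"
    using left_transl_eq[OF a(2) u] a by simp
  also have "\<dots> = - tangent_mul G g h 0 (left_transl G h u)"
    using tangent_mul_minus[OF a, of 0 "left_transl G h u"] by simp
  finally show ?thesis by simp
qed

lemma core_part_in_alg_fibre:
  assumes "x \<in> Obj G"
  shows "core_part G N x v \<in> alg_fibre G x"
  using linear_diff[OF linear_dsrc] dsrc_dunit(1)[OF assms] assms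
  by (simp add: core_part_def alg_fibre_def Let_def)

lemma linear_core_part:
  assumes x: "x \<in> Obj G" and N: "linear (N (gunit G x))"
  shows "linear (core_part G N x)"
proof -
  have Z: "linear (\<lambda>v. N (gunit G x) (dunit G x v))"
    using linear_compose[OF linear_dunit[OF x] N] by (simp add: comp_def)
  have "linear (\<lambda>v. dunit G x (dsrc G (gunit G x) (N (gunit G x) (dunit G x v))))"
    using linear_compose[OF linear_compose[OF Z linear_dsrc] linear_dunit[OF x], of "gunit G x"] x
    by (simp add: comp_def)
  from linear_compose_sub[OF Z this] show ?thesis by (simp add: core_part_def[abs_def] Let_def)
qed

text \<open>The prescription is well defined because equality of cotangent source and target says
  exactly that \<open>\<xi> X + \<eta> Y\<close> vanishes on the kernel of the multiplication. A
  linear section \<open>r\<close> with composable values then yields the functional, and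
  surjectivity of the multiplication its uniqueness.\<close>

lemma cotangent_mul_spec:
  assumes a: "g \<in> Arr G" "h \<in> Arr G" "src G g = tgt G h" and lin: "linear \<xi>" "linear \<eta>"
    and st: "cotangent_src G g \<xi> = cotangent_tgt G h \<eta>"
  shows "linear (cotangent_mul G g h \<xi> \<eta>)"
    and "\<And>X Y. dsrc G g X = dtgt G h Y \<Longrightarrow> cotangent_mul G g h \<xi> \<eta> (tangent_mul G g h X Y) = \<xi> X + \<eta> Y"
proof -
  let ?P = "\<lambda>\<zeta>. linear \<zeta> \<and> (\<forall>X Y. dsrc G g X = dtgt G h Y \<longrightarrow> \<zeta> (tangent_mul G g h X Y) = \<xi> X + \<eta> Y)"
  let ?C = "{(X, Y). dsrc G g X = dtgt G h Y}"
  let ?m = "\<lambda>(X, Y). tangent_mul G g h X Y"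
  have m: "linear ?m" using linear_tangent_mul a by simp
  obtain r where r: "range r \<subseteq> ?C" "linear r" "\<And>Z. Z \<in> ?m ` ?C \<Longrightarrow> ?m (r Z) = Z"
    using linear_exists_right_inverse_on[OF m subspace_composable_vectors[OF a(1,2)]] by metis
  define \<zeta> where "\<zeta> = (\<lambda>Z. \<xi> (fst (r Z)) + \<eta> (snd (r Z)))"
  have \<zeta>: "linear \<zeta>"
    unfolding \<zeta>_def using lin r(2) by (auto simp: linear_iff algebra_simps)
  have "\<zeta> (tangent_mul G g h X Y) = \<xi> X + \<eta> Y" if XY: "dsrc G g X = dtgt G h Y" for X Y
  proof -
    let ?Z = "tangent_mul G g h X Y"
    obtain X' Y' where r': "r ?Z = (X', Y')" by fastforce
    have c: "dsrc G g X' = dtgt G h Y'" using r(1) r' by (metis (mono_tags, lifting) case_prodD mem_Collect_eq rangeI subsetD)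
    have "?Z \<in> ?m ` ?C" using XY by force
    from r(3)[OF this] have "tangent_mul G g h X' Y' = ?Z" using r' by simp
    then have 0: "tangent_mul G g h (X - X') (Y - Y') = 0" using tangent_mul_diff[OF a] by simp
    have "dsrc G g (X - X') = dtgt G h (Y - Y')"
      using XY c by (simp add: linear_diff[OF linear_dsrc[OF a(1)]] linear_diff[OF linear_dtgt[OF a(2)]])
    then obtain u where u: "u \<in> alg_fibre G (src G g)" "X - X' = left_transl G g u" "Y - Y' = - right_transl G h u"
      using tangent_mul_kernel[OF a _ 0] by blast
    have "\<xi> (left_transl G g u) = \<eta> (right_transl G h u)"
      using fun_cong[OF st, of u] u(1) a(3) by (simp add: cotangent_src_def cotangent_tgt_def)
    then have "\<xi> (X - X') + \<eta> (Y - Y') = 0" using u lin by (simp add: linear_neg)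
    then show ?thesis using lin r' by (simp add: \<zeta>_def linear_diff)
  qed
  with \<zeta> have P: "?P \<zeta>" by blast
  have "\<zeta>' = \<zeta>" if "?P \<zeta>'" for \<zeta>'
  proof
    fix Z
    obtain X Y where "dsrc G g X = dtgt G h Y" "tangent_mul G g h X Y = Z"
      using tangent_mul_surj[OF a, of Z] by blast
    then show "\<zeta>' Z = \<zeta> Z" using P that by metis
  qed
  with P have "?P (cotangent_mul G g h \<xi> \<eta>)"
    unfolding cotangent_mul_def by (rule theI)
  then show "linear (cotangent_mul G g h \<xi> \<eta>)"
    and "\<And>X Y. dsrc G g X = dtgt G h Y \<Longrightarrow> cotangent_mul G g h \<xi> \<eta> (tangent_mul G g h X Y) = \<xi> X + \<eta> Y"
    by blast+
qed

text \<open>Covector-free form of affinity. The factor \<open>M\<close> is a separate argument so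
  that closure under sums and composites can be shown before \<open>M\<close> is identified.
  Composability of the images is part of the definition, as \<open>tangent_mul\<close> is only
  meaningful on composable vectors.\<close>

definition left_factor :: "('g \<Rightarrow> 'e \<Rightarrow> 'e) \<Rightarrow> ('g \<Rightarrow> 'e \<Rightarrow> 'e) \<Rightarrow> bool" where
  "left_factor N M \<longleftrightarrow> (\<forall>g h X Y. g \<in> Arr G \<longrightarrow> h \<in> Arr G \<longrightarrow> src G g = tgt G h \<longrightarrow> dsrc G g X = dtgt G h Y \<longrightarrow>
     dsrc G g (M g X) = dtgt G h (N h Y) \<and>
     N (mul G g h) (tangent_mul G g h X Y) = tangent_mul G g h (M g X) (N h Y))"

definition right_factor :: "('g \<Rightarrow> 'e \<Rightarrow> 'e) \<Rightarrow> ('g \<Rightarrow> 'e \<Rightarrow> 'e) \<Rightarrow> bool" where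
  "right_factor N M \<longleftrightarrow> (\<forall>g h X Y. g \<in> Arr G \<longrightarrow> h \<in> Arr G \<longrightarrow> src G g = tgt G h \<longrightarrow> dsrc G g X = dtgt G h Y \<longrightarrow>
     dsrc G g (N g X) = dtgt G h (M h Y) \<and>
     N (mul G g h) (tangent_mul G g h X Y) = tangent_mul G g h (N g X) (M h Y))"

lemma left_factorD:
  assumes "left_factor N M" "g \<in> Arr G" "h \<in> Arr G" "src G g = tgt G h" "dsrc G g X = dtgt G h Y"
  shows "dsrc G g (M g X) = dtgt G h (N h Y)"
    and "N (mul G g h) (tangent_mul G g h X Y) = tangent_mul G g h (M g X) (N h Y)"
  using assms unfolding left_factor_def by blast+

lemma right_factorD:
  assumes "right_factor N M" "g \<in> Arr G" "h \<in> Arr G" "src G g = tgt G h" "dsrc G g X = dtgt G h Y"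
  shows "dsrc G g (N g X) = dtgt G h (M h Y)"
    and "N (mul G g h) (tangent_mul G g h X Y) = tangent_mul G g h (N g X) (M h Y)"
  using assms unfolding right_factor_def by blast+

lemma left_factor_self: "left_factor N N \<longleftrightarrow> right_factor N N"
  by (simp add: left_factor_def right_factor_def)

section \<open>Factorizations of linear combinations and composites\<close>

lemma left_factor_lincomb:
  assumes "left_factor N M" "left_factor N' M'"
  shows "left_factor (a *\<^sub>R N + b *\<^sub>R N') (a *\<^sub>R M + b *\<^sub>R M')"
  unfolding left_factor_def
  using left_factorD[OF assms(1)] left_factorD[OF assms(2)]
  by (simp add: scaleR_fun_def tangent_mul_add tangent_mul_scaleR
      linear_add[OF linear_dsrc] linear_add[OF linear_dtgt] linear_scale[OF linear_dsrc] linear_scale[OF linear_dtgt])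

lemma right_factor_lincomb:
  assumes "right_factor N M" "right_factor N' M'"
  shows "right_factor (a *\<^sub>R N + b *\<^sub>R N') (a *\<^sub>R M + b *\<^sub>R M')"
  unfolding right_factor_def
  using right_factorD[OF assms(1)] right_factorD[OF assms(2)]
  by (simp add: scaleR_fun_def tangent_mul_add tangent_mul_scaleR
      linear_add[OF linear_dsrc] linear_add[OF linear_dtgt] linear_scale[OF linear_dsrc] linear_scale[OF linear_dtgt])

text \<open>The composability clause for \<open>N'\<close> and \<open>M'\<close> is what allows the
  factorization of \<open>N\<close> to be applied to their values.\<close>

lemma left_factor_comp:
  assumes "left_factor N M" "left_factor N' M'"
  shows "left_factor (tensor_comp N N') (tensor_comp M M')"
  unfolding left_factor_def tensor_comp_def comp_def
  using left_factorD[OF assms(1)] left_factorD[OF assms(2)] by simp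

lemma right_factor_comp:
  assumes "right_factor N M" "right_factor N' M'"
  shows "right_factor (tensor_comp N N') (tensor_comp M M')"
  unfolding right_factor_def tensor_comp_def comp_def
  using right_factorD[OF assms(1)] right_factorD[OF assms(2)] by simp

lemma left_tensor_apply: "g \<in> Arr G \<Longrightarrow> left_tensor G n g X = left_transl G g (n (src G g) (dsrc G g X))"
  by (simp add: left_tensor_def)

lemma right_tensor_apply: "g \<in> Arr G \<Longrightarrow> right_tensor G n g X = right_transl G g (n (tgt G g) (dtgt G g X))"
  by (simp add: right_tensor_def)

lemma target_tensor_apply:
  "g \<in> Arr G \<Longrightarrow> target_tensor G N g X = N g X - left_transl G g (core_part G N (src G g) (dsrc G g X))"
  by (simp add: target_tensor_def left_tensor_apply)

lemma source_tensor_apply: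
  "g \<in> Arr G \<Longrightarrow> source_tensor G N g X = N g X - right_transl G g (core_part G N (tgt G g) (dtgt G g X))"
  by (simp add: source_tensor_def right_tensor_apply)

text \<open>Evaluate at the product of \<open>X\<close> with the unit over the source of \<open>X\<close>.\<close>

lemma left_factor_unique:
  assumes N: "left_factor N M" and g: "g \<in> Arr G"
  shows "M g X = target_tensor G N g X"
proof -
  let ?x = "src G g"
  let ?e = "gunit G ?x"
  define v where "v = dsrc G g X"
  define Z where "Z = N ?e (dunit G ?x v)"
  define n where "n = core_part G N ?x v"
  have x: "?x \<in> Obj G" using g by simp
  have e: "?e \<in> Arr G" "tgt G ?e = ?x" using x by simp_all
  have c: "dsrc G g X = dtgt G ?e (dunit G ?x v)" using dsrc_dunit(2)[OF x] by (simp add: v_def)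
  have MZ: "dsrc G g (M g X) = dtgt G ?e Z" "N g X = tangent_mul G g ?e (M g X) Z"
    using left_factorD[OF N g e(1) _ c] e tangent_mul_dunit(1)[OF g, of X] g by (simp_all add: Z_def v_def)
  have n: "n = Z - dunit G ?x (dsrc G ?e Z)" by (simp add: n_def core_part_def Z_def Let_def)
  have nA: "n \<in> alg_fibre G ?x" unfolding n_def by (rule core_part_in_alg_fibre[OF x])
  have "dtgt G ?e n = dtgt G ?e Z - dsrc G ?e Z"
    using linear_diff[OF linear_dtgt[OF e(1)]] dsrc_dunit(2)[OF x] by (simp add: n)
  then have "dinv G ?e n = dunit G ?x (dtgt G ?e Z) - Z"
    using dinv_alg_fibre[OF x nA] linear_diff[OF linear_dunit[OF x]] by (simp add: n)
  then have "left_transl G g n = - tangent_mul G g ?e (M g X - M g X) (dunit G ?x (dsrc G g (M g X)) - Z)"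
    using left_transl_eq[OF g nA] MZ(1) by simp
  also have "\<dots> = N g X - M g X"
    using tangent_mul_diff[OF g e(1), of "M g X" "M g X"] e tangent_mul_dunit(1)[OF g, of "M g X"] MZ(2) by simp
  finally show ?thesis using g by (simp add: target_tensor_apply n_def v_def)
qed

text \<open>Mirror image: evaluate at the product of the unit over the target of \<open>Y\<close>
  with \<open>Y\<close>.\<close>

lemma right_factor_unique:
  assumes N: "right_factor N M" and g: "g \<in> Arr G"
  shows "M g Y = source_tensor G N g Y"
proof -
  let ?x = "tgt G g"
  let ?e = "gunit G ?x"
  define v where "v = dtgt G g Y"
  define Z where "Z = N ?e (dunit G ?x v)"
  define n where "n = core_part G N ?x v"
  have x: "?x \<in> Obj G" using g by simp
  have e: "?e \<in> Arr G" "src G ?e = ?x" using x by simp_all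
  have c: "dsrc G ?e (dunit G ?x v) = dtgt G g Y" using dsrc_dunit(1)[OF x] by (simp add: v_def)
  have MZ: "dsrc G ?e Z = dtgt G g (M g Y)" "N g Y = tangent_mul G ?e g Z (M g Y)"
    using right_factorD[OF N e(1) g _ c] e tangent_mul_dunit(2)[OF g, of Y] g by (simp_all add: Z_def v_def)
  have n: "n = Z - dunit G ?x (dsrc G ?e Z)" by (simp add: n_def core_part_def Z_def Let_def)
  have nA: "n \<in> alg_fibre G ?x" unfolding n_def by (rule core_part_in_alg_fibre[OF x])
  \<comment> \<open>The core is \<open>Z\<close> minus a unit vector whose product with
    \<open>M g Y\<close> is \<open>M g Y\<close> again, so the pair \<open>(n, 0)\<close> is a
    difference of two composable pairs.\<close>
  have "right_transl G g n = tangent_mul G ?e g (Z - dunit G ?x (dtgt G g (M g Y))) (M g Y - M g Y)"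
    using right_transl_eq[OF g nA] MZ(1) n by simp
  also have "\<dots> = N g Y - M g Y"
    using tangent_mul_diff[OF e(1) g, of Z _ "M g Y" "M g Y"] e tangent_mul_dunit(2)[OF g, of "M g Y"] MZ(2) by simp
  finally show ?thesis using g by (simp add: source_tensor_apply n_def v_def)
qed

text \<open>Passing from \<open>(N\<^sub>l(X), N(Y))\<close> to \<open>(N(X), N\<^sub>r(Y))\<close>
  adds a left translate of the core \<open>u\<close> to the first entry and subtracts its right
  translate from the second. That pair has product 0, and the two composability conditions differ by
  adding \<open>dtgt u\<close> on one side or subtracting it on the other.\<close>

lemma left_factor_iff_right_factor:
  "left_factor N (target_tensor G N) \<longleftrightarrow> right_factor N (source_tensor G N)"
proof -
  have "(dsrc G g (target_tensor G N g X) = dtgt G h (N h Y) \<and>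
      N (mul G g h) (tangent_mul G g h X Y) = tangent_mul G g h (target_tensor G N g X) (N h Y)) \<longleftrightarrow>
    (dsrc G g (N g X) = dtgt G h (source_tensor G N h Y) \<and>
      N (mul G g h) (tangent_mul G g h X Y) = tangent_mul G g h (N g X) (source_tensor G N h Y))"
    if a: "g \<in> Arr G" "h \<in> Arr G" "src G g = tgt G h" and c: "dsrc G g X = dtgt G h Y" for g h X Y
  proof -
    define u where "u = core_part G N (src G g) (dsrc G g X)"
    have x: "src G g \<in> Obj G" using a by simp
    have u: "u \<in> alg_fibre G (src G g)" unfolding u_def by (rule core_part_in_alg_fibre[OF x])
    then have u': "u \<in> alg_fibre G (tgt G h)" using a by simp
    have t: "target_tensor G N g X = N g X - left_transl G g u" using a by (simp add: target_tensor_apply u_def)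
    have s: "source_tensor G N h Y = N h Y - right_transl G h u" using a c by (simp add: source_tensor_apply u_def)
    have "tangent_mul G g h (N g X) (N h Y - right_transl G h u) - tangent_mul G g h (N g X - left_transl G g u) (N h Y)
        = tangent_mul G g h (left_transl G g u) (- right_transl G h u)"
      using tangent_mul_diff[OF a, of "N g X" "N g X - left_transl G g u" "N h Y - right_transl G h u" "N h Y"] by simp
    then have t_eq_s: "tangent_mul G g h (N g X) (source_tensor G N h Y) =
        tangent_mul G g h (target_tensor G N g X) (N h Y)"
      using tangent_mul_left_right_transl[OF a u] by (simp add: t s)
    have dt: "dsrc G g (target_tensor G N g X) = dsrc G g (N g X) + dtgt G (gunit G (src G g)) u"
      using dsrc_left_transl(1)[OF a(1) u] by (simp add: t linear_diff[OF linear_dsrc[OF a(1)]])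
    have ds: "dtgt G h (source_tensor G N h Y) = dtgt G h (N h Y) - dtgt G (gunit G (src G g)) u"
      using dsrc_right_transl(2)[OF a(2) u'] a(3) by (simp add: s linear_diff[OF linear_dtgt[OF a(2)]])
    have "dsrc G g (target_tensor G N g X) = dtgt G h (N h Y) \<longleftrightarrow>
        dsrc G g (N g X) = dtgt G h (source_tensor G N h Y)"
      unfolding dt ds by (rule eq_diff_eq[symmetric])
    then show ?thesis using t_eq_s by simp
  qed
  then show ?thesis unfolding left_factor_def right_factor_def by (simp cong: imp_cong)
qed

text \<open>Write \<open>N(X Y)\<close> as a product \<open>Z W\<close>. Composability of
  \<open>N\<^sub>l(X)\<close> with \<open>N(Y)\<close> is not yet known, so the difference of the
  pairs is studied in the whole product space: a functional vanishing on the translates of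
  \<open>A\<close> splits into two composable covectors, and affinity forces it to vanish on the
  difference. Hence the difference is itself such a translate pair, which is composable with product
  0.\<close>

lemma affine_tensors_left_factor:
  assumes N: "N \<in> affine_tensors G"
  shows "left_factor N (target_tensor G N)"
  unfolding left_factor_def
proof (intro allI impI)
  fix g h X Y
  assume a: "g \<in> Arr G" "h \<in> Arr G" "src G g = tgt G h" and XY: "dsrc G g X = dtgt G h Y"
  have aff: "cotangent_mul G g h \<xi> \<eta> (N (mul G g h) (tangent_mul G g h X Y)) =
      \<xi> (N g X) + \<eta> (N h Y) - cotangent_src G g \<xi> (core_part G N (src G g) (dsrc G g X))"
    if "linear \<xi>" "linear \<eta>" "cotangent_src G g \<xi> = cotangent_tgt G h \<eta>" for \<xi> \<eta>
    using N a XY that unfolding affine_tensors_def by (fastforce simp: composable_def)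
  define u where "u = core_part G N (src G g) (dsrc G g X)"
  have x: "src G g \<in> Obj G" using a by simp
  have u: "u \<in> alg_fibre G (src G g)" unfolding u_def by (rule core_part_in_alg_fibre[OF x])
  have t: "target_tensor G N g X = N g X - left_transl G g u" using a by (simp add: target_tensor_apply u_def)
  obtain Z W where ZW: "dsrc G g Z = dtgt G h W" "tangent_mul G g h Z W = N (mul G g h) (tangent_mul G g h X Y)"
    using tangent_mul_surj[OF a] by metis
  define T where "T = target_tensor G N g X"
  \<comment> \<open>On \<open>A\<close> this is the pair of translates. The formula through
    \<open>tangent_mul\<close> is visibly linear in \<open>u\<close>, so the image of the fibre is a
    subspace.\<close>
  let ?k = "\<lambda>u. (- tangent_mul G g (gunit G (src G g)) 0 (dinv G (gunit G (src G g)) u),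
      - tangent_mul G (gunit G (tgt G h)) h u 0)"
  let ?K = "?k ` alg_fibre G (src G g)"
  have "linear ?k"
    using linear_left_transl_formula[OF a(1)] linear_compose_neg[OF linear_right_transl_formula[OF a(2)]]
    by (auto simp: linear_iff)
  moreover have "subspace (alg_fibre G (src G g))"
    using linear_dsrc[of "gunit G (src G g)"] x
    by (simp add: subspace_def alg_fibre_def linear_add linear_scale linear_0)
  ultimately have K: "subspace ?K" by (rule linear_subspace_image)
  have k: "?k w = (left_transl G g w, - right_transl G h w)" if "w \<in> alg_fibre G (src G g)" for w
    using left_transl_eq[OF a(1) that] right_transl_eq[OF a(2)] that a(3) by simp
  have "(Z - T, W - N h Y) \<in> ?K"
  proof (rule ccontr)
    assume "(Z - T, W - N h Y) \<notin> ?K"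
    then obtain f where f: "linear f" "\<And>k. k \<in> ?K \<Longrightarrow> f k = (0::real)" "f (Z - T, W - N h Y) = 1"
      using subspace_separating_functional[OF K] by blast
    \<comment> \<open>The restrictions of \<open>f\<close> to the two axes; that \<open>f\<close>
      vanishes on \<open>?K\<close> says that the cotangent source of \<open>\<xi>\<close> is the
      cotangent target of \<open>\<eta>\<close>.\<close>
    define \<xi> \<eta> where "\<xi> = (\<lambda>X. f (X, 0))" and "\<eta> = (\<lambda>Y. f (0, Y))"
    have fs: "f (A, B) = \<xi> A + \<eta> B" for A B
      using linear_add[OF f(1), of "(A, 0)" "(0, B)"] by (simp add: \<xi>_def \<eta>_def)
    have "linear (\<lambda>X::'e. (X, 0::'e))" "linear (\<lambda>Y::'e. (0::'e, Y))" by (simp_all add: linear_iff)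
    from linear_compose[OF this(1) f(1)] linear_compose[OF this(2) f(1)]
    have lin: "linear \<xi>" "linear \<eta>" by (simp_all add: \<xi>_def \<eta>_def comp_def)
    have eq: "\<xi> (left_transl G g w) = \<eta> (right_transl G h w)" if "w \<in> alg_fibre G (src G g)" for w
      using f(2)[OF imageI[OF that, of ?k]] fs lin(2) unfolding k[OF that] by (simp add: linear_neg)
    then have st: "cotangent_src G g \<xi> = cotangent_tgt G h \<eta>"
      unfolding cotangent_src_def cotangent_tgt_def a(3)[symmetric] by (auto intro!: restrict_ext)
    have "\<xi> Z + \<eta> W = \<xi> (N g X) + \<eta> (N h Y) - \<xi> (left_transl G g u)"
      using aff[OF lin st] cotangent_mul_spec(2)[OF a lin st ZW(1)] u
      by (simp add: ZW(2) u_def cotangent_src_def)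
    then have "f (Z - T, W - N h Y) = 0"
      using lin by (simp add: fs T_def t linear_diff)
    with f(3) show False by simp
  qed
  then obtain w where "w \<in> alg_fibre G (src G g)" "(Z - T, W - N h Y) = ?k w" by blast
  then have w: "w \<in> alg_fibre G (src G g)" "Z - T = left_transl G g w" "W - N h Y = - right_transl G h w"
    using k by auto
  have w': "w \<in> alg_fibre G (tgt G h)" using w(1) a by simp
  have "dsrc G g Z - dsrc G g T = - dtgt G (gunit G (src G g)) w"
    using dsrc_left_transl(1)[OF a(1) w(1)] linear_diff[OF linear_dsrc[OF a(1)], of Z T] w(2) by simp
  moreover have "dtgt G h W - dtgt G h (N h Y) = - dtgt G (gunit G (src G g)) w"
    using dsrc_right_transl(2)[OF a(2) w'] linear_diff[OF linear_dtgt[OF a(2)], of W "N h Y"] w(3) a(3)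
    by (simp add: linear_neg[OF linear_dtgt[OF a(2)]])
  ultimately have 1: "dsrc G g T = dtgt G h (N h Y)" using ZW(1) by (metis diff_left_imp_eq)
  have "tangent_mul G g h Z W - tangent_mul G g h T (N h Y) = 0"
    using tangent_mul_diff[OF a, of Z T W "N h Y"] w tangent_mul_left_right_transl[OF a w(1)] by simp
  then have 2: "N (mul G g h) (tangent_mul G g h X Y) = tangent_mul G g h T (N h Y)" using ZW(2) by simp
  show "dsrc G g (target_tensor G N g X) = dtgt G h (N h Y) \<and>
      N (mul G g h) (tangent_mul G g h X Y) = tangent_mul G g h (target_tensor G N g X) (N h Y)"
    using 1 2 unfolding T_def by blast
qed

lemma left_factor_affine_tensors:
  assumes N: "N \<in> tensors11 (arrows G)" and "left_factor N M"
  shows "N \<in> affine_tensors G"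
proof -
  have "cotangent_mul G g h \<xi> \<eta> (N (mul G g h) (tangent_mul G g h X Y)) =
      \<xi> (N g X) + \<eta> (N h Y) - cotangent_src G g \<xi> (core_part G N (src G g) (dsrc G g X))"
    if a: "g \<in> Arr G" "h \<in> Arr G" "src G g = tgt G h" and XY: "dsrc G g X = dtgt G h Y"
      and lin: "linear \<xi>" "linear \<eta>" and st: "cotangent_src G g \<xi> = cotangent_tgt G h \<eta>" for g h X Y \<xi> \<eta>
  proof -
    have "src G g \<in> Obj G" using a by simp
    note u = core_part_in_alg_fibre[OF this, of N "dsrc G g X"]
    have "cotangent_mul G g h \<xi> \<eta> (N (mul G g h) (tangent_mul G g h X Y)) = \<xi> (M g X) + \<eta> (N h Y)"
      using left_factorD[OF assms(2) a XY] cotangent_mul_spec(2)[OF a lin st] by simp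
    also have "\<xi> (M g X) = \<xi> (N g X) - \<xi> (left_transl G g (core_part G N (src G g) (dsrc G g X)))"
      using left_factor_unique[OF assms(2) a(1)] lin(1) a(1) by (simp add: target_tensor_apply linear_diff)
    finally show ?thesis using u by (simp add: cotangent_src_def)
  qed
  then show ?thesis using N unfolding affine_tensors_def by (simp add: composable_def)
qed

lemma affine_tensorsD:
  assumes "N \<in> affine_tensors G"
  shows "N \<in> tensors11 (arrows G)" "left_factor N (target_tensor G N)" "right_factor N (source_tensor G N)"
  using affine_tensors_left_factor[OF assms] left_factor_iff_right_factor[of N] assms
  by (auto simp: affine_tensors_def)

text \<open>If \<open>N\<close> is its own factor, uniqueness gives \<open>N = N\<^sub>r\<close>. At
  a unit the right translate of the core is the core itself, so this equality says that the core is
  zero.\<close>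

lemma mult_tensors_iff: "N \<in> mult_tensors G \<longleftrightarrow> N \<in> tensors11 (arrows G) \<and> left_factor N N"
proof
  assume N: "N \<in> mult_tensors G"
  then have aff: "N \<in> affine_tensors G" and core: "\<And>x v. x \<in> Obj G \<Longrightarrow> core_part G N x v = 0"
    by (simp_all add: mult_tensors_def)
  have "target_tensor G N g X = N g X" if "g \<in> Arr G" for g X
    using that core left_transl_zero by (simp add: target_tensor_apply)
  then show "N \<in> tensors11 (arrows G) \<and> left_factor N N"
    using affine_tensorsD(1,2)[OF aff] unfolding left_factor_def by simp
next
  assume N: "N \<in> tensors11 (arrows G) \<and> left_factor N N"
  have "core_part G N x v = 0" if x: "x \<in> Obj G" for x v
  proof -
    have "N (gunit G x) (dunit G x v) = source_tensor G N (gunit G x) (dunit G x v)"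
      using right_factor_unique[of N N "gunit G x"] N left_factor_self x by simp
    then show ?thesis
      using right_transl_gunit[OF x core_part_in_alg_fibre[OF x]] x dsrc_dunit(2)[OF x]
      by (simp add: source_tensor_apply)
  qed
  then show "N \<in> mult_tensors G"
    using N left_factor_affine_tensors by (auto simp: mult_tensors_def)
qed

section \<open>Smoothness of translated cores\<close>

lemma smooth_along_src:
  assumes "smooth_along P (arrows G) f V"
  shows "smooth_along P (objects G) (\<lambda>y. src G (f y)) (\<lambda>y. dsrc G (f y) (V y))"
  unfolding dsrc_def by (rule smooth_along_map_points[OF charted_arrows charted_objects smooth_src assms])

lemma smooth_along_tgt:
  assumes "smooth_along P (arrows G) f V"
  shows "smooth_along P (objects G) (\<lambda>y. tgt G (f y)) (\<lambda>y. dtgt G (f y) (V y))"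
  unfolding dtgt_def by (rule smooth_along_map_points[OF charted_arrows charted_objects smooth_tgt assms])

lemma smooth_along_ginv:
  assumes "smooth_along P (arrows G) f V"
  shows "smooth_along P (arrows G) (\<lambda>y. ginv G (f y)) (\<lambda>y. dinv G (f y) (V y))"
  unfolding dinv_def by (rule smooth_along_map_points[OF charted_arrows charted_arrows smooth_ginv assms])

lemma smooth_along_gunit:
  assumes "smooth_along P (objects G) f V"
  shows "smooth_along P (arrows G) (\<lambda>y. gunit G (f y)) (\<lambda>y. dunit G (f y) (V y))"
  unfolding dunit_def by (rule smooth_along_map_points[OF charted_objects charted_arrows smooth_gunit assms])

lemma smooth_along_mul:
  assumes V: "smooth_along P (arrows G) f V" and W: "smooth_along P (arrows G) h W"
    and c: "\<And>y. y \<in> P \<Longrightarrow> src G (f y) = tgt G (h y)" "\<And>y. y \<in> P \<Longrightarrow> dsrc G (f y) (V y) = dtgt G (h y) (W y)"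
  shows "smooth_along P (arrows G) (\<lambda>y. mul G (f y) (h y)) (\<lambda>y. tangent_mul G (f y) (h y) (V y) (W y))"
proof -
  have "smooth_along P (arrows G) (\<lambda>y. (\<lambda>(g, h). mul G g h) (f y, h y))
      (\<lambda>y. differential (prod_manifold (arrows G) (arrows G)) (composable G) (arrows G) (\<lambda>(g, h). mul G g h)
        (f y, h y) (V y, W y))"
    by (rule smooth_along_map[OF charted_arrows2 charted_arrows smooth_mul
          smooth_along_Pair[OF charted_arrows charted_arrows V W]])
       (use smooth_alongD(1)[OF V] smooth_alongD(1)[OF W] c tangent_to_composable in auto)
  then show ?thesis by (simp add: tangent_mul_def)
qed

lemma smooth_along_core_part:
  assumes N: "N \<in> tensors11 (arrows G)" and v: "smooth_along P (objects G) f v"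
  shows "smooth_along P (arrows G) (\<lambda>y. gunit G (f y)) (\<lambda>y. core_part G N (f y) (v y))"
proof -
  note u = smooth_along_gunit[OF v]
  have Z: "smooth_along P (arrows G) (\<lambda>y. gunit G (f y)) (\<lambda>y. N (gunit G (f y)) (dunit G (f y) (v y)))"
    by (rule smooth_along_endo[OF charted_arrows tensors11D(1)[OF N] tensors11D(3)[OF N] u])
  have "smooth_along P (arrows G) (\<lambda>y. gunit G (f y))
      (\<lambda>y. dunit G (f y) (dsrc G (gunit G (f y)) (N (gunit G (f y)) (dunit G (f y) (v y)))))"
    by (rule smooth_along_cong[OF smooth_along_gunit[OF smooth_along_src[OF Z]]])
       (use smooth_alongD(1)[OF v] in simp_all)
  from smooth_along_lincomb[OF charted_arrows Z this, of 1 "-1"] show ?thesis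
    by (simp add: core_part_def Let_def)
qed

lemma smooth_along_zero:
  assumes "smooth_along P (arrows G) f V"
  shows "smooth_along P (arrows G) f (\<lambda>_. 0)"
  using smooth_along_lincomb[OF charted_arrows assms assms, of 0 0] by simp

text \<open>By definition \<open>right_transl G g\<close> is the differential of a map that changes
  with \<open>g\<close>, so smoothness in \<open>g\<close> is not visible there. Rewritten as the
  product of the core with a zero vector, the tensor uses the one multiplication map for all
  \<open>g\<close>.\<close>

lemma right_tensor_tensors11:
  assumes N: "N \<in> tensors11 (arrows G)"
  shows "right_tensor G (core_part G N) \<in> tensors11 (arrows G)"
proof (rule tensors11I)
  have eq: "right_tensor G (core_part G N) g X =
      tangent_mul G (gunit G (tgt G g)) g (core_part G N (tgt G g) (dtgt G g X)) 0" if g: "g \<in> Arr G" for g X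
    using right_transl_eq[OF g core_part_in_alg_fibre] g by (simp add: right_tensor_apply)
  show "linear (right_tensor G (core_part G N) g)" if g: "g \<in> Arr G" for g
  proof -
    have "linear (core_part G N (tgt G g))" using linear_core_part tensors11D(1)[OF N] g by simp
    from linear_compose[OF linear_compose[OF linear_dtgt[OF g] this] linear_right_transl_formula[OF g]]
    show ?thesis by (simp add: comp_def eq[OF g, abs_def])
  qed
  show "smooth_endo_field (arrows G) (right_tensor G (core_part G N))"
  proof (rule smooth_endo_fieldI[OF charted_arrows])
    fix c v assume c: "c \<in> atlas (arrows G)"
    let ?f = "chart_inv c" and ?V = "\<lambda>y. from_chart (arrows G) c (chart_inv c y) v"
    let ?n = "\<lambda>y. core_part G N (tgt G (?f y)) (dtgt G (?f y) (?V y))"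
    have V: "smooth_along (snd c ` fst c) (arrows G) ?f ?V"
      by (rule smooth_along_from_chart[OF charted_arrows c])
    note f = smooth_alongD(1)[OF V]
    have n: "smooth_along (snd c ` fst c) (arrows G) (\<lambda>y. gunit G (tgt G (?f y))) ?n"
      by (rule smooth_along_core_part[OF N smooth_along_tgt[OF V]])
    have nA: "?n y \<in> alg_fibre G (tgt G (?f y))" if "y \<in> snd c ` fst c" for y
      using core_part_in_alg_fibre f[OF that] by simp
    show "smooth_along (snd c ` fst c) (arrows G) ?f (\<lambda>y. right_tensor G (core_part G N) (?f y) (?V y))"
    proof (rule smooth_along_cong[OF smooth_along_mul[OF n smooth_along_zero[OF V]]])
      fix y assume y: "y \<in> snd c ` fst c"
      show "dsrc G (gunit G (tgt G (?f y))) (?n y) = dtgt G (?f y) 0"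
        using alg_fibreD[OF nA[OF y]] linear_0[OF linear_dtgt[OF f[OF y]]] by simp
    qed (use f eq in simp_all)
  qed
qed (simp add: right_tensor_def)

lemma left_tensor_tensors11:
  assumes N: "N \<in> tensors11 (arrows G)"
  shows "left_tensor G (core_part G N) \<in> tensors11 (arrows G)"
proof (rule tensors11I)
  have eq: "left_tensor G (core_part G N) g X = - tangent_mul G g (gunit G (src G g)) 0
      (dinv G (gunit G (src G g)) (core_part G N (src G g) (dsrc G g X)))" if g: "g \<in> Arr G" for g X
    using left_transl_eq[OF g core_part_in_alg_fibre] g by (simp add: left_tensor_apply)
  show "linear (left_tensor G (core_part G N) g)" if g: "g \<in> Arr G" for g
  proof -
    have "linear (core_part G N (src G g))" using linear_core_part tensors11D(1)[OF N] g by simp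
    from linear_compose[OF linear_compose[OF linear_dsrc[OF g] this] linear_left_transl_formula[OF g]]
    show ?thesis by (simp add: comp_def eq[OF g, abs_def])
  qed
  show "smooth_endo_field (arrows G) (left_tensor G (core_part G N))"
  proof (rule smooth_endo_fieldI[OF charted_arrows])
    fix c v assume c: "c \<in> atlas (arrows G)"
    let ?f = "chart_inv c" and ?V = "\<lambda>y. from_chart (arrows G) c (chart_inv c y) v"
    let ?n = "\<lambda>y. core_part G N (src G (?f y)) (dsrc G (?f y) (?V y))"
    let ?e = "\<lambda>y. gunit G (src G (?f y))"
    have V: "smooth_along (snd c ` fst c) (arrows G) ?f ?V"
      by (rule smooth_along_from_chart[OF charted_arrows c])
    note f = smooth_alongD(1)[OF V]
    have "smooth_along (snd c ` fst c) (arrows G) ?e ?n"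
      by (rule smooth_along_core_part[OF N smooth_along_src[OF V]])
    from smooth_along_ginv[OF this]
    have w: "smooth_along (snd c ` fst c) (arrows G) ?e (\<lambda>y. dinv G (?e y) (?n y))"
      by (rule smooth_along_cong) (use f in simp_all)
    have nA: "?n y \<in> alg_fibre G (src G (?f y))" if "y \<in> snd c ` fst c" for y
      using core_part_in_alg_fibre f[OF that] by simp
    have m: "smooth_along (snd c ` fst c) (arrows G) (\<lambda>y. mul G (?f y) (?e y))
        (\<lambda>y. tangent_mul G (?f y) (?e y) 0 (dinv G (?e y) (?n y)))"
    proof (rule smooth_along_mul[OF smooth_along_zero[OF V] w])
      fix y assume y: "y \<in> snd c ` fst c"
      show "dsrc G (?f y) 0 = dtgt G (?e y) (dinv G (?e y) (?n y))"
        using dinv_gunit_tangent(1)[OF _ nA[OF y]] f[OF y] linear_0[OF linear_dsrc[OF f[OF y]]] by simp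
    qed (use f in simp)
    \<comment> \<open>The combination with coefficients -1 and 0 serves as negation.\<close>
    show "smooth_along (snd c ` fst c) (arrows G) ?f (\<lambda>y. left_tensor G (core_part G N) (?f y) (?V y))"
      by (rule smooth_along_cong[OF smooth_along_lincomb[OF charted_arrows m m, of "-1" 0]])
         (use f eq in simp_all)
  qed
qed (simp add: left_tensor_def)

lemma tensors11_diff:
  assumes "N \<in> tensors11 (arrows G)" "N' \<in> tensors11 (arrows G)"
  shows "N - N' \<in> tensors11 (arrows G)"
  using tensors11_lincomb[OF charted_arrows assms, of 1 "-1"] by simp

lemma source_tensor_tensors11: "N \<in> tensors11 (arrows G) \<Longrightarrow> source_tensor G N \<in> tensors11 (arrows G)"
  and target_tensor_tensors11: "N \<in> tensors11 (arrows G) \<Longrightarrow> target_tensor G N \<in> tensors11 (arrows G)"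
  unfolding source_tensor_def target_tensor_def
  using tensors11_diff right_tensor_tensors11 left_tensor_tensors11 by blast+

section \<open>The monoidal 2-vector space of affine tensors\<close>

lemma tensors11_eqI:
  assumes "N \<in> tensors11 (arrows G)" "N' \<in> tensors11 (arrows G)" "\<And>g X. g \<in> Arr G \<Longrightarrow> N g X = N' g X"
  shows "N = N'"
proof
  fix g show "N g = N' g"
    using assms(3) tensors11D(2)[OF assms(1)] tensors11D(2)[OF assms(2)] by (cases "g \<in> Arr G") auto
qed

lemma target_tensor_eqI:
  assumes "N \<in> tensors11 (arrows G)" "M \<in> tensors11 (arrows G)" "left_factor N M"
  shows "target_tensor G N = M"
  by (rule tensors11_eqI[OF target_tensor_tensors11[OF assms(1)] assms(2)])
     (simp add: left_factor_unique[OF assms(3)])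

lemma source_tensor_eqI:
  assumes "N \<in> tensors11 (arrows G)" "M \<in> tensors11 (arrows G)" "right_factor N M"
  shows "source_tensor G N = M"
  by (rule tensors11_eqI[OF source_tensor_tensors11[OF assms(1)] assms(2)])
     (simp add: right_factor_unique[OF assms(3)])

text \<open>In \<open>N(X Y) = N(X) N\<^sub>r(Y)\<close>, subtract the right translate at the
  product, which is the right translate at \<open>g\<close> times a zero vector: the result is
  \<open>N\<^sub>r(X) N\<^sub>r(Y)\<close>. Right translates have source 0, so composability
  survives.\<close>

lemma source_tensor_mult:
  assumes N: "N \<in> affine_tensors G"
  shows "source_tensor G N \<in> mult_tensors G"
proof -
  note N' = affine_tensorsD[OF N]
  have "left_factor (source_tensor G N) (source_tensor G N)"
    unfolding left_factor_def
  proof (intro allI impI)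
    fix g h X Y
    assume a: "g \<in> Arr G" "h \<in> Arr G" "src G g = tgt G h" and XY: "dsrc G g X = dtgt G h Y"
    let ?S = "source_tensor G N" and ?u = "core_part G N (tgt G g) (dtgt G g X)"
    have u: "?u \<in> alg_fibre G (tgt G g)" using core_part_in_alg_fibre a by simp
    note r = right_factorD[OF N'(3) a XY]
    have gh: "mul G g h \<in> Arr G" using a by simp
    have S: "?S g X = N g X - right_transl G g ?u" using a by (simp add: source_tensor_apply)
    have "?S (mul G g h) (tangent_mul G g h X Y) =
        tangent_mul G g h (N g X) (?S h Y) - tangent_mul G g h (right_transl G g ?u) 0"
      using source_tensor_apply[OF gh] dsrc_tangent_mul(2)[OF a XY] right_transl_mul[OF a u] r(2) a by simp
    also have "\<dots> = tangent_mul G g h (?S g X) (?S h Y)"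
      using tangent_mul_diff[OF a, of "N g X" "right_transl G g ?u" "?S h Y" 0] S by simp
    finally show "dsrc G g (?S g X) = dtgt G h (?S h Y) \<and>
        ?S (mul G g h) (tangent_mul G g h X Y) = tangent_mul G g h (?S g X) (?S h Y)"
      using r(1) dsrc_right_transl(1)[OF a(1) u] by (simp add: S linear_diff[OF linear_dsrc[OF a(1)]])
  qed
  then show ?thesis using mult_tensors_iff source_tensor_tensors11[OF N'(1)] by blast
qed

lemma target_tensor_mult:
  assumes N: "N \<in> affine_tensors G"
  shows "target_tensor G N \<in> mult_tensors G"
proof -
  note N' = affine_tensorsD[OF N]
  have "left_factor (target_tensor G N) (target_tensor G N)"
    unfolding left_factor_def
  proof (intro allI impI)
    fix g h X Y
    assume a: "g \<in> Arr G" "h \<in> Arr G" "src G g = tgt G h" and XY: "dsrc G g X = dtgt G h Y"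
    let ?T = "target_tensor G N" and ?u = "core_part G N (src G h) (dsrc G h Y)"
    have u: "?u \<in> alg_fibre G (src G h)" using core_part_in_alg_fibre a by simp
    note r = left_factorD[OF N'(2) a XY]
    have gh: "mul G g h \<in> Arr G" using a by simp
    have T: "?T h Y = N h Y - left_transl G h ?u" using a by (simp add: target_tensor_apply)
    have "?T (mul G g h) (tangent_mul G g h X Y) =
        tangent_mul G g h (?T g X) (N h Y) - tangent_mul G g h 0 (left_transl G h ?u)"
      using target_tensor_apply[OF gh] dsrc_tangent_mul(1)[OF a XY] left_transl_mul[OF a u] r(2) a by simp
    also have "\<dots> = tangent_mul G g h (?T g X) (?T h Y)"
      using tangent_mul_diff[OF a, of "?T g X" 0 "N h Y" "left_transl G h ?u"] T by simp
    finally show "dsrc G g (?T g X) = dtgt G h (?T h Y) \<and>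
        ?T (mul G g h) (tangent_mul G g h X Y) = tangent_mul G g h (?T g X) (?T h Y)"
      using r(1) dsrc_left_transl(2)[OF a(2) u] by (simp add: T linear_diff[OF linear_dtgt[OF a(2)]])
  qed
  then show ?thesis using mult_tensors_iff target_tensor_tensors11[OF N'(1)] by blast
qed

lemma mult_tensorsD:
  assumes "N \<in> mult_tensors G"
  shows "N \<in> tensors11 (arrows G)" "left_factor N N" "right_factor N N" "N \<in> affine_tensors G"
    "source_tensor G N = N" "target_tensor G N = N"
proof -
  show 1: "N \<in> tensors11 (arrows G)" and 2: "left_factor N N" using assms mult_tensors_iff by blast+
  show 3: "right_factor N N" using 2 left_factor_self by blast
  show "N \<in> affine_tensors G" using assms by (simp add: mult_tensors_def)
  show "source_tensor G N = N" by (rule source_tensor_eqI[OF 1 1 3])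
  show "target_tensor G N = N" by (rule target_tensor_eqI[OF 1 1 2])
qed

section \<open>Linear combinations, star products and composites of affine tensors\<close>

lemma star_tensor_eq: "star_tensor G N N' = N + (N' - target_tensor G N')"
  by (simp add: star_tensor_def target_tensor_def)

text \<open>Linear combinations of factors are factors of the linear combination; uniqueness of the
  factor then gives linearity of source and target.\<close>

lemma affine_lincomb:
  assumes N: "N \<in> affine_tensors G" and N': "N' \<in> affine_tensors G"
  shows "a *\<^sub>R N + b *\<^sub>R N' \<in> affine_tensors G"
    and "target_tensor G (a *\<^sub>R N + b *\<^sub>R N') = a *\<^sub>R target_tensor G N + b *\<^sub>R target_tensor G N'"
    and "source_tensor G (a *\<^sub>R N + b *\<^sub>R N') = a *\<^sub>R source_tensor G N + b *\<^sub>R source_tensor G N'"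
proof -
  note D = affine_tensorsD[OF N] and D' = affine_tensorsD[OF N']
  note t = tensors11_lincomb[OF charted_arrows D(1) D'(1), of a b]
  note l = left_factor_lincomb[OF D(2) D'(2), of a b]
  note r = right_factor_lincomb[OF D(3) D'(3), of a b]
  show "a *\<^sub>R N + b *\<^sub>R N' \<in> affine_tensors G" by (rule left_factor_affine_tensors[OF t l])
  show "target_tensor G (a *\<^sub>R N + b *\<^sub>R N') = a *\<^sub>R target_tensor G N + b *\<^sub>R target_tensor G N'"
    by (rule target_tensor_eqI[OF t _ l])
       (intro tensors11_lincomb[OF charted_arrows] target_tensor_tensors11 D(1) D'(1))
  show "source_tensor G (a *\<^sub>R N + b *\<^sub>R N') = a *\<^sub>R source_tensor G N + b *\<^sub>R source_tensor G N'"
    by (rule source_tensor_eqI[OF t _ r])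
       (intro tensors11_lincomb[OF charted_arrows] source_tensor_tensors11 D(1) D'(1))
qed

lemma star_tensor_affine:
  assumes N: "N \<in> affine_tensors G" and N': "N' \<in> affine_tensors G"
    and eq: "source_tensor G N = target_tensor G N'"
  shows "star_tensor G N N' \<in> affine_tensors G"
    and "source_tensor G (star_tensor G N N') = source_tensor G N'"
    and "target_tensor G (star_tensor G N N') = target_tensor G N"
proof -
  let ?M = "target_tensor G N'"
  have M: "?M \<in> mult_tensors G" by (rule target_tensor_mult[OF N'])
  note MD = mult_tensorsD[OF M]
  \<comment> \<open>With the multiplicative tensor \<open>?M\<close> as a third summand the product
    is a linear combination of affine tensors, so its source and target follow from
    linearity.\<close>
  have star: "star_tensor G N N' = 1 *\<^sub>R N + 1 *\<^sub>R (1 *\<^sub>R N' + (-1) *\<^sub>R ?M)"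
    by (simp add: star_tensor_eq)
  note d = affine_lincomb[OF N' MD(4), of 1 "-1"]
  note s = affine_lincomb[OF N d(1), of 1 1]
  show "star_tensor G N N' \<in> affine_tensors G" unfolding star by (rule s(1))
  show "source_tensor G (star_tensor G N N') = source_tensor G N'"
    unfolding star s(3) d(3) MD(5) eq by simp
  show "target_tensor G (star_tensor G N N') = target_tensor G N"
    unfolding star s(2) d(2) MD(6) by simp
qed

lemma tensor_comp_affine:
  assumes N: "N \<in> affine_tensors G" and N': "N' \<in> affine_tensors G"
  shows "tensor_comp N N' \<in> affine_tensors G"
    and "source_tensor G (tensor_comp N N') = tensor_comp (source_tensor G N) (source_tensor G N')"
    and "target_tensor G (tensor_comp N N') = tensor_comp (target_tensor G N) (target_tensor G N')"
proof -
  note D = affine_tensorsD[OF N] and D' = affine_tensorsD[OF N']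
  note t = tensors11_comp[OF charted_arrows D(1) D'(1)]
  note l = left_factor_comp[OF D(2) D'(2)]
  note r = right_factor_comp[OF D(3) D'(3)]
  show "tensor_comp N N' \<in> affine_tensors G" by (rule left_factor_affine_tensors[OF t l])
  show "target_tensor G (tensor_comp N N') = tensor_comp (target_tensor G N) (target_tensor G N')"
    by (rule target_tensor_eqI[OF t _ l])
       (intro tensors11_comp[OF charted_arrows] target_tensor_tensors11 D(1) D'(1))
  show "source_tensor G (tensor_comp N N') = tensor_comp (source_tensor G N) (source_tensor G N')"
    by (rule source_tensor_eqI[OF t _ r])
       (intro tensors11_comp[OF charted_arrows] source_tensor_tensors11 D(1) D'(1))
qed

lemma tensor_comp_mult:
  assumes "N \<in> mult_tensors G" "N' \<in> mult_tensors G"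
  shows "tensor_comp N N' \<in> mult_tensors G"
  using left_factor_comp[OF mult_tensorsD(2)[OF assms(1)] mult_tensorsD(2)[OF assms(2)]]
    tensors11_comp[OF charted_arrows mult_tensorsD(1)[OF assms(1)] mult_tensorsD(1)[OF assms(2)]]
  by (simp add: mult_tensors_iff)

lemma tensor_id_mult: "tensor_id (arrows G) \<in> mult_tensors G"
proof -
  have "left_factor (tensor_id (arrows G)) (tensor_id (arrows G))"
    by (simp add: left_factor_def tensor_id_def)
  then show ?thesis using mult_tensors_iff tensors11_id[OF charted_arrows] by blast
qed

text \<open>Left-invariant vectors are killed by the differential of the target map, right-invariant ones
  by that of the source map; this makes the mixed terms in the interchange law vanish.\<close>

lemma source_diff_target_diff:
  assumes N: "N \<in> tensors11 (arrows G)" and g: "g \<in> Arr G"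
  shows "N g (N' g X - target_tensor G N' g X) = source_tensor G N g (N' g X - target_tensor G N' g X)"
    and "N g (N' g X - source_tensor G N' g X) = target_tensor G N g (N' g X - source_tensor G N' g X)"
proof -
  have z: "core_part G N x 0 = 0" if "x \<in> Obj G" for x
    using linear_0[OF linear_core_part[OF that]] tensors11D(1)[OF N] that by simp
  have "dtgt G g (N' g X - target_tensor G N' g X) = 0"
    using dsrc_left_transl(2)[OF g core_part_in_alg_fibre] g by (simp add: target_tensor_apply)
  then show "N g (N' g X - target_tensor G N' g X) = source_tensor G N g (N' g X - target_tensor G N' g X)"
    using z g right_transl_zero by (simp add: source_tensor_apply[of g N])
  have "dsrc G g (N' g X - source_tensor G N' g X) = 0"
    using dsrc_right_transl(1)[OF g core_part_in_alg_fibre] g by (simp add: source_tensor_apply)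
  then show "N g (N' g X - source_tensor G N' g X) = target_tensor G N g (N' g X - source_tensor G N' g X)"
    using z g left_transl_zero by (simp add: target_tensor_apply[of g N])
qed

text \<open>With \<open>M = f\<^sub>r = g\<^sub>l\<close> and
  \<open>M' = f'\<^sub>r = g'\<^sub>l\<close>, expand \<open>(f + g - M)(f' + g' - M')\<close>. The
  rules \<open>f(g' - M') = M(g' - M')\<close> and \<open>g(f' - M') = M(f' - M')\<close> reduce it
  to \<open>f f' + g g' - M M'\<close>.\<close>

lemma interchange:
  assumes aff: "f \<in> affine_tensors G" "g \<in> affine_tensors G" "f' \<in> affine_tensors G" "g' \<in> affine_tensors G"
    and eq: "source_tensor G f = target_tensor G g" "source_tensor G f' = target_tensor G g'"
  shows "tensor_comp (star_tensor G f g) (star_tensor G f' g') =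
    star_tensor G (tensor_comp f f') (tensor_comp g g')"
proof (rule tensors11_eqI)
  show "tensor_comp (star_tensor G f g) (star_tensor G f' g') \<in> tensors11 (arrows G)"
    by (intro affine_tensorsD(1) tensor_comp_affine(1) star_tensor_affine(1) aff eq)
  have "source_tensor G (tensor_comp f f') = target_tensor G (tensor_comp g g')"
    by (simp add: tensor_comp_affine aff eq)
  then show "star_tensor G (tensor_comp f f') (tensor_comp g g') \<in> tensors11 (arrows G)"
    by (intro affine_tensorsD(1) star_tensor_affine(1) tensor_comp_affine(1) aff)
next
  fix p X assume p: "p \<in> Arr G"
  let ?M = "target_tensor G g" and ?M' = "target_tensor G g'"
  have lin: "linear (f p)" "linear (g p)" "linear (?M p)"
    using tensors11D(1)[OF affine_tensorsD(1)[OF aff(1)] p] tensors11D(1)[OF affine_tensorsD(1)[OF aff(2)] p]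
      tensors11D(1)[OF target_tensor_tensors11[OF affine_tensorsD(1)[OF aff(2)]] p] by simp_all
  have e: "f p (g' p X) = f p (?M' p X) + (?M p (g' p X) - ?M p (?M' p X))"
    using source_diff_target_diff(1)[OF affine_tensorsD(1)[OF aff(1)] p, of g' X] eq(1) lin
    by (simp add: linear_diff algebra_simps)
  have e': "g p (f' p X) = g p (?M' p X) + (?M p (f' p X) - ?M p (?M' p X))"
    using source_diff_target_diff(2)[OF affine_tensorsD(1)[OF aff(2)] p, of f' X] eq(2) lin
    by (simp add: linear_diff algebra_simps)
  show "tensor_comp (star_tensor G f g) (star_tensor G f' g') p X =
      star_tensor G (tensor_comp f f') (tensor_comp g g') p X"
    using tensor_comp_affine(3)[OF aff(2,4)] lin
    by (simp add: star_tensor_eq tensor_comp_def linear_add linear_diff e e')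
qed

section \<open>The category, its linear structure and its monoidal structure\<close>

lemma small_category_affine:
  "small_category (mult_tensors G) (affine_tensors G) (source_tensor G) (target_tensor G) (\<lambda>N. N) (star_tensor G)"
proof
  fix f g h assume "f \<in> affine_tensors G" "g \<in> affine_tensors G" "h \<in> affine_tensors G"
    "source_tensor G f = target_tensor G g" "source_tensor G g = target_tensor G h"
  \<comment> \<open>With this, both bracketings equal
    \<open>f + (g - g\<^sub>l) + (h - h\<^sub>l)\<close>.\<close>
  then have "target_tensor G (star_tensor G g h) = target_tensor G g" using star_tensor_affine(3) by blast
  then show "star_tensor G (star_tensor G f g) h = star_tensor G f (star_tensor G g h)"
    unfolding star_tensor_eq[of f "star_tensor G g h"] by (simp add: star_tensor_eq)
next
  fix f assume f: "f \<in> affine_tensors G"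
  show "star_tensor G (target_tensor G f) f = f" by (simp add: star_tensor_eq)
  show "star_tensor G f (source_tensor G f) = f"
    using mult_tensorsD(6)[OF source_tensor_mult[OF f]] by (simp add: star_tensor_eq)
qed (use source_tensor_mult target_tensor_mult mult_tensorsD star_tensor_affine in simp_all)

lemma subspace_affine: "subspace (affine_tensors G)"
proof -
  have "0 \<in> affine_tensors G"
  proof (rule left_factor_affine_tensors[OF tensors11_zero[OF charted_arrows]])
    show "left_factor 0 0"
      by (simp add: left_factor_def tangent_mul_zero linear_0[OF linear_dsrc] linear_0[OF linear_dtgt])
  qed
  moreover have "N + N' \<in> affine_tensors G" if "N \<in> affine_tensors G" "N' \<in> affine_tensors G" for N N'
    using affine_lincomb(1)[OF that, of 1 1] by simp
  moreover have "a *\<^sub>R N \<in> affine_tensors G" if "N \<in> affine_tensors G" for a N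
    using affine_lincomb(1)[OF that that, of a 0] by simp
  ultimately show ?thesis by (simp add: subspace_def)
qed

text \<open>Multiplicative tensors are the fixed points of the target map, which is linear on affine
  tensors.\<close>

lemma subspace_mult: "subspace (mult_tensors G)"
proof -
  have iff: "N \<in> mult_tensors G \<longleftrightarrow> N \<in> affine_tensors G \<and> target_tensor G N = N" for N
    using mult_tensorsD(4,6)[of N] target_tensor_mult[of N] by auto
  have sub: "0 \<in> affine_tensors G" using subspace_0[OF subspace_affine] .
  have "target_tensor G 0 = 0"
    using affine_lincomb(2)[OF sub sub, of 0 0] by simp
  moreover have "target_tensor G (N + N') = N + N'" if "N \<in> affine_tensors G" "N' \<in> affine_tensors G"
    "target_tensor G N = N" "target_tensor G N' = N'" for N N'
    using affine_lincomb(2)[OF that(1,2), of 1 1] that(3,4) by simp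
  moreover have "target_tensor G (a *\<^sub>R N) = a *\<^sub>R N" if "N \<in> affine_tensors G" "target_tensor G N = N" for a N
    using affine_lincomb(2)[OF that(1) that(1), of a 0] that(2) by simp
  ultimately show ?thesis
    using subspace_affine by (simp add: subspace_def iff)
qed

lemma two_vector_space_affine:
  "two_vector_space (mult_tensors G) (affine_tensors G) (source_tensor G) (target_tensor G) (\<lambda>N. N) (star_tensor G)"
proof -
  interpret small_category "mult_tensors G" "affine_tensors G" "source_tensor G" "target_tensor G" "\<lambda>N. N" "star_tensor G"
    by (rule small_category_affine)
  show ?thesis
  proof
    fix f g f' g' a b
    assume "f \<in> affine_tensors G" and g: "g \<in> affine_tensors G" and "f' \<in> affine_tensors G"
      and g': "g' \<in> affine_tensors G"
    show "star_tensor G (a *\<^sub>R f + b *\<^sub>R f') (a *\<^sub>R g + b *\<^sub>R g') = a *\<^sub>R star_tensor G f g + b *\<^sub>R star_tensor G f' g'"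
      by (simp add: star_tensor_eq affine_lincomb(2)[OF g g'] algebra_simps)
  qed (use subspace_affine subspace_mult affine_lincomb in simp_all)
qed

lemma strict_monoidal_category_affine:
  "strict_monoidal_category (mult_tensors G) (affine_tensors G) (source_tensor G) (target_tensor G) (\<lambda>N. N)
     (star_tensor G) tensor_comp tensor_comp (tensor_id (arrows G))"
proof -
  interpret small_category "mult_tensors G" "affine_tensors G" "source_tensor G" "target_tensor G" "\<lambda>N. N" "star_tensor G"
    by (rule small_category_affine)
  have id: "tensor_comp (tensor_id (arrows G)) N = N" "tensor_comp N (tensor_id (arrows G)) = N"
    if N: "N \<in> tensors11 (arrows G)" for N
  proof -
    \<comment> \<open>Away from the arrows \<open>tensor_id\<close> is 0 rather than the identity;
      this is consistent because \<open>N\<close> is normalised to 0 there.\<close>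
    have "tensor_comp (tensor_id (arrows G)) N p = N p \<and> tensor_comp N (tensor_id (arrows G)) p = N p" for p
      using tensors11D(2)[OF N, of p] by (auto simp: tensor_comp_def tensor_id_def fun_eq_iff)
    then show "tensor_comp (tensor_id (arrows G)) N = N" "tensor_comp N (tensor_id (arrows G)) = N" by blast+
  qed
  show ?thesis
  proof
    show "tensor_id (arrows G) \<in> mult_tensors G" by (rule tensor_id_mult)
    show "tensor_comp (star_tensor G f g) (star_tensor G f' g') = star_tensor G (tensor_comp f f') (tensor_comp g g')"
      if "f \<in> affine_tensors G" "g \<in> affine_tensors G" "f' \<in> affine_tensors G" "g' \<in> affine_tensors G"
        "source_tensor G f = target_tensor G g" "source_tensor G f' = target_tensor G g'" for f g f' g'
      using interchange[OF that] .
  qed (use tensor_comp_affine tensor_comp_mult id mult_tensorsD(1) affine_tensorsD(1) in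
      \<open>simp_all add: tensor_comp_def[abs_def] comp_assoc\<close>)
qed

end

theorem theorem5p11:
  fixes G :: "('g, 'm, 'e::real_normed_vector, 'f::real_normed_vector) lie_groupoid_data"
  assumes "lie_groupoid G"
  shows "two_vector_space (mult_tensors G) (affine_tensors G)
           (source_tensor G) (target_tensor G) (\<lambda>N. N) (star_tensor G) \<and>
         strict_monoidal_category (mult_tensors G) (affine_tensors G)
           (source_tensor G) (target_tensor G) (\<lambda>N. N) (star_tensor G)
           tensor_comp tensor_comp (tensor_id (arrows G))"
proof -
  interpret lie_gpd G by standard (rule assms)
  show ?thesis using two_vector_space_affine strict_monoidal_category_affine ..
qed

end
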